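(* Let $W$ be an irreducible finite Coxeter group with simple reflections $S$, rank $r$ and Coxeter number $h$, let $\mathbf{c}$ be a Coxeter word, and let $p$ be a positive integer coprime to $h$. Then $$\Big|\bigsqcup_{v\in W}\mathcal{M}^{(v)}_{e,\mathbf{c}^p}(W)\Big| = p^r.$$
   Context: $h$ is the order of a Coxeter element. A Coxeter word $\mathbf{c}$ is an ordering of $S$; $\mathbf{c}^p=(s_1,\dots,s_m)$, $m=pr$, is $p$ concatenated copies. A subword is $\mathbf{u}=(u_1,\dots,u_m)$ with $u_i\in\{s_i,e\}$; $U_{(i)}=u_1\cdots u_i$, $U_{(0)}=e$; it is an $e$-subword if $U_{(m)}=e$; $\mathrm{e}_{\mathbf{u}}=|\{i:u_i=e\}|$. For $v\in W$, $\mathbf{u}$ is $v$-distinguished if $vU_{(i)}\le vU_{(i-1)}s_i$ in weak order for all $i$, i.e. $u_i=s_i$ whenever $\ell(vU_{(i-1)}s_i)<\ell(vU_{(i-1)})$. $\mathcal{M}^{(v)}_{e,\mathbf{c}^p}(W)$ is the set of $v$-distinguished $e$-subwords $\mathbf{u}$ of $\mathbf{c}^p$ with $\mathrm{e}_{\mathbf{u}}=r$ (maximal $(\mathbf{c}^p,v)$-Deograms). The union is disjoint by definition (the same subword for different $v$ counts separately). *)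

theory Defs
  imports "HOL-Algebra.Algebra"
begin

definition word_prod :: "('a, 'b) monoid_scheme \<Rightarrow> 'a list \<Rightarrow> 'a" where
  "word_prod G xs = foldr (\<lambda>x y. x \<otimes>\<^bsub>G\<^esub> y) xs \<one>\<^bsub>G\<^esub>"

text \<open>The entry \<open>m(s,t)\<close> of the Coxeter matrix. As for \<^const>\<open>group.ord\<close>, the value \<open>0\<close>
  stands for infinite order.\<close>

definition coxeter_m :: "('a, 'b) monoid_scheme \<Rightarrow> 'a \<Rightarrow> 'a \<Rightarrow> nat" where
  "coxeter_m G s t = group.ord G (s \<otimes>\<^bsub>G\<^esub> t)"

text \<open>Equality of words over \<open>S\<close> modulo the relations \<open>(s t)\<^bsup>m(s,t)\<^esup> = 1\<close>. As \<open>m(s,s) = 1\<close>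
  for an involution \<open>s\<close>, these include \<open>s s = 1\<close>; hence no formal inverses are needed, and the
  monoid so presented is the group with this presentation. For \<open>m(s,t) = 0\<close> the relator is the
  empty word, i.e. there is no relation.\<close>

inductive coxeter_equiv :: "('a, 'b) monoid_scheme \<Rightarrow> 'a set \<Rightarrow> 'a list \<Rightarrow> 'a list \<Rightarrow> bool"
  for G :: "('a, 'b) monoid_scheme" and S :: "'a set" where
  relator: "\<lbrakk>xs \<in> lists S; ys \<in> lists S; s \<in> S; t \<in> S\<rbrakk> \<Longrightarrow>
    coxeter_equiv G S (xs @ concat (replicate (coxeter_m G s t) [s, t]) @ ys) (xs @ ys)"
| refl: "xs \<in> lists S \<Longrightarrow> coxeter_equiv G S xs xs"
| sym: "coxeter_equiv G S xs ys \<Longrightarrow> coxeter_equiv G S ys xs"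
| trans: "\<lbrakk>coxeter_equiv G S xs ys; coxeter_equiv G S ys zs\<rbrakk> \<Longrightarrow> coxeter_equiv G S xs zs"

text \<open>The axiom \<open>presentation\<close> says that all relations among the generators follow from the
  Coxeter relations.\<close>

locale coxeter_system = group G for G (structure) +
  fixes S :: "'a set"
  assumes simple_closed: "S \<subseteq> carrier G"
    and simple_not_one: "\<one> \<notin> S"
    and simple_involution: "s \<in> S \<Longrightarrow> s \<otimes> s = \<one>"
    and simple_generate: "generate G S = carrier G"
    and presentation: "\<lbrakk>xs \<in> lists S; word_prod G xs = \<one>\<rbrakk> \<Longrightarrow> coxeter_equiv G S xs []"

definition coxeter_graph :: "('a, 'b) monoid_scheme \<Rightarrow> 'a set \<Rightarrow> ('a \<times> 'a) set" where
  "coxeter_graph G S = {(s, t). s \<in> S \<and> t \<in> S \<and> s \<noteq> t \<and> coxeter_m G s t \<noteq> 2}"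

definition coxeter_irreducible :: "('a, 'b) monoid_scheme \<Rightarrow> 'a set \<Rightarrow> bool" where
  "coxeter_irreducible G S \<longleftrightarrow>
    S \<noteq> {} \<and> (\<forall>s\<in>S. \<forall>t\<in>S. (s, t) \<in> (coxeter_graph G S)\<^sup>*)"

definition coxeter_word :: "'a set \<Rightarrow> 'a list \<Rightarrow> bool" where
  "coxeter_word S c \<longleftrightarrow> distinct c \<and> set c = S"

definition coxeter_element :: "('a, 'b) monoid_scheme \<Rightarrow> 'a set \<Rightarrow> 'a \<Rightarrow> bool" where
  "coxeter_element G S g \<longleftrightarrow> (\<exists>c. coxeter_word S c \<and> g = word_prod G c)"

definition coxeter_length :: "('a, 'b) monoid_scheme \<Rightarrow> 'a set \<Rightarrow> 'a \<Rightarrow> nat" where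
  "coxeter_length G S w = (LEAST n. \<exists>xs\<in>lists S. length xs = n \<and> word_prod G xs = w)"

text \<open>The right weak order: \<open>y\<close> is obtained from \<open>x\<close> by length-additive multiplication on the
  right, so that \<open>x\<close> and \<open>x s\<close> are always comparable for simple \<open>s\<close>.\<close>

definition weak_le :: "('a, 'b) monoid_scheme \<Rightarrow> 'a set \<Rightarrow> 'a \<Rightarrow> 'a \<Rightarrow> bool" where
  "weak_le G S x y \<longleftrightarrow>
    coxeter_length G S x + coxeter_length G S (inv\<^bsub>G\<^esub> x \<otimes>\<^bsub>G\<^esub> y) = coxeter_length G S y"

definition subwords :: "('a, 'b) monoid_scheme \<Rightarrow> 'a list \<Rightarrow> 'a list set" where
  "subwords G ws =
    {us. length us = length ws \<and> (\<forall>i<length ws. us ! i \<in> {ws ! i, \<one>\<^bsub>G\<^esub>})}"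

text \<open>Positions are counted from \<open>0\<close>, so \<open>take i us\<close> multiplies to \<open>U\<^sub>(\<^sub>i\<^sub>)\<close> and \<open>ws ! i\<close> is the
  letter \<open>s\<^sub>i\<^sub>+\<^sub>1\<close>.\<close>

definition distinguished ::
  "('a, 'b) monoid_scheme \<Rightarrow> 'a set \<Rightarrow> 'a \<Rightarrow> 'a list \<Rightarrow> 'a list \<Rightarrow> bool" where
  "distinguished G S v ws us \<longleftrightarrow>
    (\<forall>i<length ws. weak_le G S
        (v \<otimes>\<^bsub>G\<^esub> word_prod G (take (Suc i) us))
        (v \<otimes>\<^bsub>G\<^esub> word_prod G (take i us) \<otimes>\<^bsub>G\<^esub> ws ! i))"

definition skips :: "('a, 'b) monoid_scheme \<Rightarrow> 'a list \<Rightarrow> nat" where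
  "skips G us = card {i. i < length us \<and> us ! i = \<one>\<^bsub>G\<^esub>}"

definition word_power :: "'a list \<Rightarrow> nat \<Rightarrow> 'a list" where
  "word_power c p = concat (replicate p c)"

definition maximal_deograms ::
  "('a, 'b) monoid_scheme \<Rightarrow> 'a set \<Rightarrow> 'a list \<Rightarrow> 'a \<Rightarrow> 'a list set" where
  "maximal_deograms G S ws v =
    {us \<in> subwords G ws.
      word_prod G us = \<one>\<^bsub>G\<^esub> \<and> distinguished G S v ws us \<and> skips G us = card S}"

end

theory Submission
  imports Defs "Jordan_Normal_Form.Schur_Decomposition" "HOL-Number_Theory.Number_Theory"
begin

text \<open>
  Put \<open>z = exp x - exp (-x)\<close>. The operators \<open>(R\<^sub>s f) v = f (v s) + [\<ell>(v) < \<ell>(v s)] z f(v)\<close> on functions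
  on \<open>W\<close> satisfy the relations of the normalised Hecke algebra. Expanding their product along \<open>c\<^sup>p\<close>
  gives \<open>tr (R\<^sub>c)\<^sup>p = \<Sum> f\<^sub>k z\<^sup>k\<close>, where \<open>f\<^sub>k\<close> counts the pairs of some \<open>v\<close> and a \<open>v\<close>-distinguished
  \<open>e\<close>-subword of \<open>c\<^sup>p\<close> with \<open>k\<close> skips; for \<open>p = 1\<close> only \<open>v = 1\<close> with the empty selection contributes, so
  \<open>tr R\<^sub>c = z\<^sup>r\<close>.

  Commutation moves turn the word \<open>c\<^sup>h\<close> into an even number of copies of reduced words of the longest
  element. Hence \<open>(R\<^sub>c)\<^sup>h\<close> is central and the square of a real symmetric operator, and comparing
  determinants on its eigenspaces shows that each eigenvalue of \<open>R\<^sub>c\<close> has the form \<open>\<omega> exp (\<kappa> x)\<close> with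
  \<open>\<omega>\<^sup>h = 1\<close> and \<open>\<kappa>\<close> in a finite set of rationals independent of \<open>x\<close>. By the pigeonhole principle the
  same pairs \<open>(\<omega>, \<kappa>)\<close> occur for infinitely many \<open>x\<close>. On the other hand \<open>tr (R\<^sub>c)\<^sup>m\<close> is an integral Laurent
  polynomial in \<open>exp x\<close> that counts closed walks in a signed graph and so satisfies the Gauss
  congruences. These force the power sums \<open>\<Sum> \<omega>\<^sup>m\<close> over a fixed \<open>\<kappa>\<close> to be invariant under \<open>m \<mapsto> p m\<close> for
  \<open>p\<close> coprime to \<open>h\<close>.

  Therefore \<open>tr (R\<^sub>c)\<^sup>p\<close> at \<open>x\<close> equals \<open>tr R\<^sub>c\<close> at \<open>p x\<close>, that is \<open>\<Sum> f\<^sub>k z(x)\<^sup>k = z(p x)\<^sup>r\<close>, and dividing by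
  \<open>z(x)\<^sup>r\<close> and letting \<open>x \<rightarrow> 0\<close> gives \<open>f\<^sub>r = p\<^sup>r\<close>.
\<close>

text \<open>The obstacle is that \<open>R_c\<close> is not symmetric, so its eigenvalues are reached
  only through \<open>(R_c)^h\<close>, and centrality of that power needs a combinatorial reason.
  Attach to each position of the word c c c ... the reflection that turns one prefix into the next,
  and call the number of its earlier occurrences the level of the position. The Euler form of two
  positions with noncommuting letters is nonzero if they are close, and its signs force the
  occurrences of the two reflections to interleave. So the level never drops from a letter to a
  later one that does not commute with it, and sorting by level needs commutations only. All
  reflections occur equally often in \<open>c^h\<close> because the levels grow linearly and their
  slopes agree across each edge of the connected Coxeter graph. With this choice of \<open>z\<close>
  each \<open>R_s\<close> has eigenvalues \<open>exp x\<close> and \<open>- exp (-x)\<close>. So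
  determinants on invariant subspaces are, up to sign, integral powers of \<open>exp x\<close>; the
  denominators of \<kappa> come from the dimension of an eigenspace and from the h-th root. As
  \<open>h\<close> belongs to an arbitrary Coxeter element, these must be shown to have the same
  order; this rests on the Coxeter graph being a forest.\<close>

lemma word_prod_Nil [simp]: "word_prod G [] = \<one>\<^bsub>G\<^esub>"
  by (simp add: word_prod_def)

lemma word_prod_Cons [simp]: "word_prod G (x # xs) = x \<otimes>\<^bsub>G\<^esub> word_prod G xs"
  by (simp add: word_prod_def)

section \<open>Words, length and parity\<close>

context coxeter_system
begin

abbreviation len :: "'a \<Rightarrow> nat" where "len \<equiv> coxeter_length G S"

lemma simple_carrier [simp, intro]: "s \<in> S \<Longrightarrow> s \<in> carrier G"
  using simple_closed by blast

lemma simple_inv [simp]: "s \<in> S \<Longrightarrow> inv s = s"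
  by (simp add: inv_equality simple_involution)

lemma simple_cancel_left [simp]: "\<lbrakk>s \<in> S; g \<in> carrier G\<rbrakk> \<Longrightarrow> s \<otimes> (s \<otimes> g) = g"
  by (metis l_one m_assoc simple_carrier simple_involution)

lemma simple_cancel_right [simp]: "\<lbrakk>s \<in> S; g \<in> carrier G\<rbrakk> \<Longrightarrow> g \<otimes> s \<otimes> s = g"
  by (simp add: m_assoc simple_involution)

lemma word_closed [simp, intro]: "set xs \<subseteq> S \<Longrightarrow> word_prod G xs \<in> carrier G"
  by (induction xs) auto

lemma word_append: "\<lbrakk>set xs \<subseteq> S; set ys \<subseteq> S\<rbrakk> \<Longrightarrow> word_prod G (xs @ ys) = word_prod G xs \<otimes> word_prod G ys"
  by (induction xs) (auto simp: m_assoc)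

lemma word_rev: "set xs \<subseteq> S \<Longrightarrow> word_prod G (rev xs) = inv (word_prod G xs)"
  by (induction xs) (auto simp: word_append inv_mult_group)

lemma word_exists: "w \<in> carrier G \<Longrightarrow> \<exists>xs. set xs \<subseteq> S \<and> word_prod G xs = w"
  unfolding simple_generate[symmetric]
proof (induction rule: generate.induct)
  case one
  show ?case by (rule exI[of _ "[]"]) simp
next
  case (incl h)
  then show ?case by (intro exI[of _ "[h]"]) simp
next
  case (inv h)
  then show ?case by (intro exI[of _ "[h]"]) simp
next
  case (eng h1 h2)
  then obtain xs ys where "set xs \<subseteq> S" "word_prod G xs = h1" "set ys \<subseteq> S" "word_prod G ys = h2"
    by blast
  then show ?case by (intro exI[of _ "xs @ ys"]) (simp add: word_append)
qed

lemma len_le: "set xs \<subseteq> S \<Longrightarrow> len (word_prod G xs) \<le> length xs"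
  unfolding coxeter_length_def by (rule Least_le) (auto simp: in_lists_conv_set)

lemma reduced_word_exists:
  assumes "w \<in> carrier G"
  obtains xs where "set xs \<subseteq> S" "length xs = len w" "word_prod G xs = w"
proof -
  have "\<exists>n. \<exists>xs\<in>lists S. length xs = n \<and> word_prod G xs = w"
    using word_exists[OF assms] by (auto simp: in_lists_conv_set)
  from LeastI_ex[OF this] show thesis
    using that unfolding coxeter_length_def by (auto simp: in_lists_conv_set)
qed

lemma len_one [simp]: "len \<one> = 0"
  using len_le[of "[]"] by simp

lemma len_mult_le:
  assumes "g \<in> carrier G" "h \<in> carrier G"
  shows "len (g \<otimes> h) \<le> len g + len h"
proof -
  obtain xs ys where "set xs \<subseteq> S" "length xs = len g" "word_prod G xs = g"
    "set ys \<subseteq> S" "length ys = len h" "word_prod G ys = h"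
    using reduced_word_exists[OF assms(1)] reduced_word_exists[OF assms(2)] by metis
  then show ?thesis using len_le[of "xs @ ys"] by (simp add: word_append)
qed

lemma len_eq_0: assumes "w \<in> carrier G" shows "len w = 0 \<longleftrightarrow> w = \<one>"
proof -
  obtain xs where "set xs \<subseteq> S" "length xs = len w" "word_prod G xs = w"
    using reduced_word_exists[OF assms] .
  then show ?thesis by auto
qed

lemma len_inv: assumes "w \<in> carrier G" shows "len (inv w) = len w"
proof -
  have le: "len (inv v) \<le> len v" if v: "v \<in> carrier G" for v
  proof -
    obtain xs where "set xs \<subseteq> S" "length xs = len v" "word_prod G xs = v"
      using reduced_word_exists[OF v] .
    then show ?thesis using len_le[of "rev xs"] by (simp add: word_rev)
  qed
  show ?thesis using le[OF assms] le[of "inv w"] assms by simp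
qed

text \<open>Every relator has even length, so the parity of the length is an invariant of the
  relations. This plays the part of the sign character.\<close>

lemma coxeter_equiv_parity: "coxeter_equiv G S xs ys \<Longrightarrow> even (length xs) \<longleftrightarrow> even (length ys)"
proof (induction rule: coxeter_equiv.induct)
  case (relator xs ys s t)
  have "even (length (concat (replicate n [s, t])))" for n by (induction n) auto
  then show ?case by simp
qed auto

lemma parity_eq:
  assumes "set xs \<subseteq> S" "set ys \<subseteq> S" "word_prod G xs = word_prod G ys"
  shows "even (length xs) \<longleftrightarrow> even (length ys)"
proof -
  have "word_prod G (xs @ rev ys) = \<one>" using assms by (simp add: word_append word_rev)
  then have "coxeter_equiv G S (xs @ rev ys) []"
    using assms presentation[of "xs @ rev ys"] by (auto simp: in_lists_conv_set)
  from coxeter_equiv_parity[OF this] show ?thesis by simp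
qed

lemma len_simple_neq: assumes "w \<in> carrier G" "s \<in> S" shows "len (w \<otimes> s) \<noteq> len w"
proof -
  obtain xs where xs: "set xs \<subseteq> S" "length xs = len w" "word_prod G xs = w"
    using reduced_word_exists[OF assms(1)] .
  obtain ys where ys: "set ys \<subseteq> S" "length ys = len (w \<otimes> s)" "word_prod G ys = w \<otimes> s"
    using reduced_word_exists[of "w \<otimes> s"] assms by auto
  have "word_prod G ys = word_prod G (xs @ [s])" using xs ys assms by (simp add: word_append)
  from parity_eq[OF _ _ this] xs ys assms show ?thesis by auto
qed

lemma len_simple: "s \<in> S \<Longrightarrow> len s = 1"
  using len_le[of "[s]"] len_simple_neq[of \<one> s] by simp

lemma len_mult_simple:
  assumes "w \<in> carrier G" "s \<in> S"
  shows "len (w \<otimes> s) = len w + 1 \<or> len (w \<otimes> s) + 1 = len w"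
proof -
  have "len (w \<otimes> s) \<le> len w + 1" using len_mult_le[of w s] len_simple assms by simp
  moreover have "len w \<le> len (w \<otimes> s) + 1"
    using len_mult_le[of "w \<otimes> s" s] len_simple assms by simp
  ultimately show ?thesis using len_simple_neq[OF assms] by linarith
qed

subsection \<open>The geometric representation\<close>

text \<open>Twice the canonical bilinear form on the simple roots, so that roots have norm 2. The
  value m = 1 gives the diagonal entry 2, and m = 0 gives -2, the convention for infinite order,
  since division by 0 yields 0.\<close>

definition cartan :: "'a \<Rightarrow> 'a \<Rightarrow> real" where
  "cartan s t = - 2 * cos (pi / real (coxeter_m G s t))"

definition pairing :: "('a \<Rightarrow> real) \<Rightarrow> 'a \<Rightarrow> real" where
  "pairing x s = (\<Sum>t\<in>S. x t * cartan t s)"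

text \<open>Vectors are coordinate functions in the basis of simple roots, so a simple reflection
  changes a single coordinate. Many sign arguments below rest on this.\<close>

definition reflect :: "'a \<Rightarrow> ('a \<Rightarrow> real) \<Rightarrow> 'a \<Rightarrow> real" where
  "reflect s x = x(s := x s - pairing x s)"

definition simple_root :: "'a \<Rightarrow> 'a \<Rightarrow> real" where
  "simple_root s t = (if t = s then 1 else 0)"

lemma coxeter_m_sym: "\<lbrakk>s \<in> S; t \<in> S\<rbrakk> \<Longrightarrow> coxeter_m G s t = coxeter_m G t s"
  using ord_inv[of "s \<otimes> t"] by (simp add: coxeter_m_def inv_mult_group)

lemma coxeter_m_self: "s \<in> S \<Longrightarrow> coxeter_m G s s = 1"
  by (simp add: coxeter_m_def simple_involution)

lemma coxeter_m_neq_1: "\<lbrakk>s \<in> S; t \<in> S; s \<noteq> t\<rbrakk> \<Longrightarrow> coxeter_m G s t \<noteq> 1"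
  unfolding coxeter_m_def using ord_eq_1[of "s \<otimes> t"] inv_equality[of s t] by auto

lemma cartan_sym: "\<lbrakk>s \<in> S; t \<in> S\<rbrakk> \<Longrightarrow> cartan s t = cartan t s"
  by (simp add: cartan_def coxeter_m_sym)

lemma cartan_self [simp]: "s \<in> S \<Longrightarrow> cartan s s = 2"
  by (simp add: cartan_def coxeter_m_self)

lemma reflect_apply: "reflect s x t = (if t = s then x s - pairing x s else x t)"
  by (simp add: reflect_def)

lemma reflect_lin:
  "reflect s (\<lambda>t. a * x t + b * y t) = (\<lambda>t. a * reflect s x t + b * reflect s y t)"
proof -
  have "pairing (\<lambda>t. a * x t + b * y t) s = a * pairing x s + b * pairing y s"
    by (simp add: pairing_def sum.distrib sum_distrib_left algebra_simps)
  then show ?thesis by (auto simp: reflect_apply algebra_simps)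
qed

lemma reflect_sum:
  "reflect s (\<lambda>t. \<Sum>i\<in>A. c i * f i t) = (\<lambda>t. \<Sum>i\<in>A. c i * reflect s (f i) t)"
proof -
  have "pairing (\<lambda>t. \<Sum>i\<in>A. c i * f i t) s = (\<Sum>i\<in>A. c i * pairing (f i) s)"
    unfolding pairing_def sum_distrib_left sum_distrib_right
    by (subst sum.swap) (simp add: mult.assoc)
  then show ?thesis by (auto simp: reflect_apply algebra_simps sum_subtractf)
qed

end

locale finite_coxeter_system = coxeter_system +
  assumes finite_carrier: "finite (carrier G)"
begin

lemma finite_S [simp]: "finite S"
  using finite_carrier simple_closed finite_subset by blast

lemma coxeter_m_ge_2: "\<lbrakk>s \<in> S; t \<in> S; s \<noteq> t\<rbrakk> \<Longrightarrow> coxeter_m G s t \<ge> 2"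
  using coxeter_m_neq_1[of s t] ord_ge_1[OF finite_carrier, of "s \<otimes> t"]
  by (auto simp: coxeter_m_def)

lemma commute_if_m_2:
  assumes "s \<in> S" "t \<in> S" "coxeter_m G s t = 2" shows "s \<otimes> t = t \<otimes> s"
proof -
  have "(s \<otimes> t) [^] (2::nat) = \<one>"
    using assms by (metis coxeter_m_def m_closed pow_ord_eq_1 simple_carrier)
  then have "inv (s \<otimes> t) = s \<otimes> t"
    using assms by (intro inv_equality) (simp_all add: numeral_2_eq_2)
  then show ?thesis using assms by (simp add: inv_mult_group)
qed

lemma m_2_if_commute:
  assumes "s \<in> S" "t \<in> S" "s \<noteq> t" "s \<otimes> t = t \<otimes> s" shows "coxeter_m G s t = 2"
proof -
  have "(s \<otimes> t) \<otimes> (t \<otimes> s) = \<one>" using assms(1,2) by (simp add: m_assoc simple_involution)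
  then have "(s \<otimes> t) \<otimes> (s \<otimes> t) = \<one>" using assms(4) by simp
  then have "(s \<otimes> t) [^] (2::nat) = \<one>" using assms by (simp add: numeral_2_eq_2)
  then have "coxeter_m G s t dvd 2" using pow_eq_id[of "s \<otimes> t" 2] assms by (simp add: coxeter_m_def)
  then have "coxeter_m G s t \<le> 2" by (simp add: dvd_imp_le)
  then show ?thesis using coxeter_m_ge_2[OF assms(1-3)] by simp
qed

lemma cartan_nonpos: assumes "s \<in> S" "t \<in> S" "s \<noteq> t" shows "cartan s t \<le> 0"
proof -
  have "pi / real (coxeter_m G s t) \<le> pi / 2" "pi / real (coxeter_m G s t) \<ge> 0"
    using coxeter_m_ge_2[OF assms] by (auto simp: divide_simps)
  then have "cos (pi / real (coxeter_m G s t)) \<ge> 0" using pi_ge_zero by (intro cos_ge_zero) linarith+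
  then show ?thesis unfolding cartan_def by simp
qed

lemma cartan_neg:
  assumes "s \<in> S" "t \<in> S" "s \<otimes> t \<noteq> t \<otimes> s" shows "cartan s t < 0"
proof -
  have ne: "s \<noteq> t" using assms by auto
  have "coxeter_m G s t \<noteq> 2" using commute_if_m_2 assms by blast
  then have "coxeter_m G s t > 2" using coxeter_m_ge_2[OF assms(1,2) ne] by simp
  then have "pi / real (coxeter_m G s t) < pi / 2" "pi / real (coxeter_m G s t) > 0"
    by (auto simp: divide_simps)
  then show ?thesis unfolding cartan_def
    using cos_gt_zero_pi[of "pi / real (coxeter_m G s t)"] by simp
qed

lemma pairing_reflect:
  assumes "s \<in> S"
  shows "pairing (reflect s x) t = pairing x t - pairing x s * cartan s t"
proof -
  have "pairing (reflect s x) t = (\<Sum>u\<in>S. x u * cartan u t - (if u = s then pairing x s * cartan s t else 0))"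
    unfolding pairing_def[of _ t] by (intro sum.cong) (auto simp: reflect_apply algebra_simps)
  then show ?thesis using assms by (simp add: sum_subtractf pairing_def)
qed

lemma pairing_simple_root: "s \<in> S \<Longrightarrow> pairing (simple_root s) t = cartan s t"
  by (simp add: pairing_def simple_root_def if_distrib[where f = "\<lambda>x. x * _"] cong: if_cong)

lemma reflect_simple_root:
  "t \<in> S \<Longrightarrow> reflect s (simple_root t) = (\<lambda>u. simple_root t u - cartan t s * simple_root s u)"
  unfolding reflect_def pairing_simple_root by (auto simp: simple_root_def)

lemma reflect_reflect [simp]: "s \<in> S \<Longrightarrow> reflect s (reflect s x) = x"
  by (auto simp: reflect_apply pairing_reflect)

lemma sin_next: "sin (y + \<theta>) = 2 * cos \<theta> * sin y - sin (y - \<theta>)" for y \<theta> :: real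
  by (simp add: sin_add sin_diff)

lemma sin_pi_div_pos: "m \<ge> 2 \<Longrightarrow> sin (pi / real m) > 0"
  by (rule sin_gt_zero) (auto simp: field_simps)

text \<open>The product of the two reflections is a rotation by twice the angle \<theta> in the
  plane of \<open>s\<close> and \<open>t\<close>, and its effect is determined by the two pairings
  tracked here. The factor \<open>sin \<theta>\<close> avoids divisions in the induction, which is
  driven by the recursion \<open>sin_next\<close>.\<close>

lemma pairing_dihedral_power:
  assumes st: "s \<in> S" "t \<in> S" "s \<noteq> t" and "\<theta> = pi / real (coxeter_m G s t)"
  shows "sin \<theta> * pairing (((\<lambda>x. reflect s (reflect t x)) ^^ n) x) s
      = - (sin (2 * real n * \<theta>) * pairing x t + sin (2 * real n * \<theta> - \<theta>) * pairing x s) \<and>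
    sin \<theta> * pairing (((\<lambda>x. reflect s (reflect t x)) ^^ n) x) t
      = sin (2 * real n * \<theta> + \<theta>) * pairing x t + sin (2 * real n * \<theta>) * pairing x s"
proof (induction n)
  case 0
  then show ?case by simp
next
  case (Suc n)
  define y where "y = ((\<lambda>x. reflect s (reflect t x)) ^^ n) x"
  define a where "a = 2 * real n * \<theta>"
  define k where "k = 2 * cos \<theta>"
  have c: "cartan s t = - k" "cartan t s = - k"
    using assms cartan_sym[of s t] by (auto simp: cartan_def k_def)
  have y': "((\<lambda>x. reflect s (reflect t x)) ^^ Suc n) x = reflect s (reflect t y)" by (simp add: y_def)
  have a': "2 * real (Suc n) * \<theta> = a + 2 * \<theta>" by (simp add: a_def algebra_simps)
  have p: "pairing (reflect s (reflect t y)) s = - (pairing y s + k * pairing y t)"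
    "pairing (reflect s (reflect t y)) t = k * pairing y s + (k * k - 1) * pairing y t"
    using st by (simp_all add: pairing_reflect c algebra_simps)
  have IH: "sin \<theta> * pairing y s = - (sin a * pairing x t + sin (a - \<theta>) * pairing x s)"
    "sin \<theta> * pairing y t = sin (a + \<theta>) * pairing x t + sin a * pairing x s"
    using Suc by (simp_all add: y_def a_def)
  have s1: "sin (a + \<theta>) = k * sin a - sin (a - \<theta>)" by (simp add: k_def sin_next)
  have s2: "sin (a + 2 * \<theta>) = k * sin (a + \<theta>) - sin a"
    using sin_next[of "a + \<theta>" \<theta>] by (simp add: k_def algebra_simps)
  have s3: "sin (a + 2 * \<theta> + \<theta>) = k * sin (a + 2 * \<theta>) - sin (a + \<theta>)"
    using sin_next[of "a + 2 * \<theta>" \<theta>] by (simp add: k_def algebra_simps)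
  have s4: "sin (a + 2 * \<theta> - \<theta>) = sin (a + \<theta>)" by (simp add: algebra_simps)
  have e1: "sin \<theta> * (- (pairing y s + k * pairing y t)) = - (sin \<theta> * pairing y s) - k * (sin \<theta> * pairing y t)"
    "sin \<theta> * (k * pairing y s + (k * k - 1) * pairing y t)
      = k * (sin \<theta> * pairing y s) + (k * k - 1) * (sin \<theta> * pairing y t)"
    by (simp_all add: algebra_simps)
  show ?case
    unfolding y' a' p e1 IH s4 s3 s2 s1 by (simp add: algebra_simps)
qed

text \<open>After m steps the rotation is a full turn, so the vector and its image have the same
  pairings with \<open>s\<close> and \<open>t\<close>. Their difference lies in the span of these
  two simple roots, whose Gram determinant is \<open>4 - k * k\<close>, that is 4 times the square
  of \<open>sin \<theta>\<close>. As this is nonzero, the difference vanishes.\<close>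

lemma dihedral_relation:
  assumes st: "s \<in> S" "t \<in> S"
  shows "((\<lambda>x. reflect s (reflect t x)) ^^ coxeter_m G s t) x = x"
proof (cases "s = t")
  case True
  then show ?thesis using st by (simp add: coxeter_m_self)
next
  case False
  define m where "m = coxeter_m G s t"
  define \<theta> where "\<theta> = pi / real m"
  define y where "y = ((\<lambda>x. reflect s (reflect t x)) ^^ m) x"
  have m: "m \<ge> 2" using coxeter_m_ge_2[OF st False] by (simp add: m_def)
  have s0: "sin \<theta> > 0" using sin_pi_div_pos[OF m] by (simp add: \<theta>_def)
  have a: "2 * real m * \<theta> = 2 * pi" using m by (simp add: \<theta>_def)
  have sa: "sin (2 * pi - \<theta>) = - sin \<theta>" "sin (2 * pi + \<theta>) = sin \<theta>"
    by (simp_all add: sin_diff sin_add)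
  have eq: "pairing y s = pairing x s" "pairing y t = pairing x t"
    using pairing_dihedral_power[OF st False \<theta>_def[unfolded m_def], of m x] s0
    unfolding y_def[symmetric] a sa by auto
  have off: "((\<lambda>x. reflect s (reflect t x)) ^^ n) x u = x u" if "u \<noteq> s" "u \<noteq> t" for n u
    using that by (induction n) (auto simp: reflect_apply)
  define A B where "A = y s - x s" and "B = y t - x t"
  have diff: "pairing y v - pairing x v = A * cartan s v + B * cartan t v" for v
  proof -
    have "pairing y v - pairing x v
      = (\<Sum>u\<in>S. (if u = s then A * cartan s v else 0) + (if u = t then B * cartan t v else 0))"
      unfolding pairing_def sum_subtractf[symmetric]
      by (intro sum.cong) (use False off in \<open>auto simp: A_def B_def y_def algebra_simps\<close>)
    then show ?thesis using st by (simp add: sum.distrib)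
  qed
  define k where "k = 2 * cos \<theta>"
  have c: "cartan s t = - k" "cartan t s = - k"
    using cartan_sym[OF st] by (auto simp: cartan_def k_def \<theta>_def m_def)
  have "2 * A - k * B = 0" "2 * B - k * A = 0"
    using diff[of s] diff[of t] eq st c by (simp_all add: mult.commute[of k])
  moreover have "(4 - k * k) * A = 2 * (2 * A - k * B) + k * (2 * B - k * A)"
    "(4 - k * k) * B = k * (2 * A - k * B) + 2 * (2 * B - k * A)"
    by (simp_all add: algebra_simps)
  ultimately have "(4 - k * k) * A = 0" "(4 - k * k) * B = 0" by (simp_all only: mult_zero_right add_0)
  moreover have "4 - k * k = 4 * (sin \<theta>)\<^sup>2"
    unfolding k_def sin_squared_eq by (simp add: power2_eq_square)
  ultimately have "A = 0" "B = 0" using s0 by simp_all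
  then have "y u = x u" for u using off[of u m] by (cases "u = s \<or> u = t") (auto simp: A_def B_def y_def)
  then show ?thesis by (auto simp: y_def m_def)
qed

lemma foldr_reflect_equiv:
  "coxeter_equiv G S xs ys \<Longrightarrow> foldr reflect xs x = foldr reflect ys x"
proof (induction arbitrary: x rule: coxeter_equiv.induct)
  case (relator xs ys s t)
  have "foldr reflect (concat (replicate n [s, t])) y = ((\<lambda>x. reflect s (reflect t x)) ^^ n) y" for n y
    by (induction n) auto
  then show ?case using dihedral_relation relator by simp
qed auto

lemma foldr_reflect_rev: "set xs \<subseteq> S \<Longrightarrow> foldr reflect (rev xs) (foldr reflect xs x) = x"
  by (induction xs arbitrary: x) auto

lemma foldr_reflect_cong:
  assumes "set xs \<subseteq> S" "set ys \<subseteq> S" "word_prod G xs = word_prod G ys"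
  shows "foldr reflect xs x = foldr reflect ys x"
proof -
  have "word_prod G (rev ys @ xs) = \<one>" using assms by (simp add: word_append word_rev)
  then have "coxeter_equiv G S (rev ys @ xs) []"
    using assms presentation[of "rev ys @ xs"] by (auto simp: in_lists_conv_set)
  from foldr_reflect_equiv[OF this, of x]
  have "foldr reflect (rev ys) (foldr reflect xs x) = x" by simp
  then have "foldr reflect (rev (rev ys)) (foldr reflect (rev ys) (foldr reflect xs x)) = foldr reflect ys x"
    by simp
  then show ?thesis using foldr_reflect_rev[of "rev ys"] assms by simp
qed

text \<open>The choice of the word is immaterial by \<open>foldr_reflect_cong\<close>; this is where
  the presentation turns the reflections into a representation of the group.\<close>

definition act :: "'a \<Rightarrow> ('a \<Rightarrow> real) \<Rightarrow> 'a \<Rightarrow> real" where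
  "act w = foldr reflect (SOME xs. set xs \<subseteq> S \<and> word_prod G xs = w)"

lemma act_word: assumes "set xs \<subseteq> S" shows "act (word_prod G xs) x = foldr reflect xs x"
proof -
  have "\<exists>ys. set ys \<subseteq> S \<and> word_prod G ys = word_prod G xs" using assms by blast
  from someI_ex[OF this] show ?thesis
    unfolding act_def using foldr_reflect_cong assms by blast
qed

lemma act_one [simp]: "act \<one> x = x"
  using act_word[of "[]"] by simp

lemma act_simple: "s \<in> S \<Longrightarrow> act s x = reflect s x"
  using act_word[of "[s]"] by simp

lemma act_mult:
  assumes "g \<in> carrier G" "h \<in> carrier G" shows "act (g \<otimes> h) x = act g (act h x)"
proof -
  obtain xs ys where "set xs \<subseteq> S" "word_prod G xs = g" "set ys \<subseteq> S" "word_prod G ys = h"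
    using word_exists assms by metis
  then show ?thesis using act_word[of "xs @ ys"] act_word[of xs] act_word[of ys]
    by (simp add: word_append)
qed

lemma act_inv [simp]: "g \<in> carrier G \<Longrightarrow> act (inv g) (act g x) = x"
  by (simp add: act_mult[symmetric])

lemma act_inv' [simp]: "g \<in> carrier G \<Longrightarrow> act g (act (inv g) x) = x"
  by (simp add: act_mult[symmetric])

lemma act_lin:
  assumes "w \<in> carrier G"
  shows "act w (\<lambda>t. a * x t + b * y t) = (\<lambda>t. a * act w x t + b * act w y t)"
proof -
  obtain xs where xs: "set xs \<subseteq> S" "word_prod G xs = w" using word_exists assms by metis
  have "foldr reflect xs (\<lambda>t. a * x t + b * y t) = (\<lambda>t. a * foldr reflect xs x t + b * foldr reflect xs y t)"
    by (induction xs) (simp_all add: reflect_lin)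
  then show ?thesis using act_word[OF xs(1)] xs(2) by simp
qed

lemma act_uminus: "w \<in> carrier G \<Longrightarrow> act w (\<lambda>t. - x t) = (\<lambda>t. - act w x t)"
  using act_lin[of w "-1" x 0 x] by simp

lemma act_sum:
  assumes "w \<in> carrier G"
  shows "act w (\<lambda>t. \<Sum>i\<in>A. c i * f i t) = (\<lambda>t. \<Sum>i\<in>A. c i * act w (f i) t)"
proof -
  obtain xs where xs: "set xs \<subseteq> S" "word_prod G xs = w" using word_exists assms by metis
  have "foldr reflect xs (\<lambda>t. \<Sum>i\<in>A. c i * f i t) = (\<lambda>t. \<Sum>i\<in>A. c i * foldr reflect xs (f i) t)"
    by (induction xs) (simp_all add: reflect_sum)
  then show ?thesis using act_word[OF xs(1)] xs(2) by simp
qed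

definition supported :: "('a \<Rightarrow> real) \<Rightarrow> bool" where "supported x \<longleftrightarrow> (\<forall>t. t \<notin> S \<longrightarrow> x t = 0)"

lemma supported_simple_root: "s \<in> S \<Longrightarrow> supported (simple_root s)"
  by (auto simp: supported_def simple_root_def)

lemma supported_act: assumes "w \<in> carrier G" "supported x" shows "supported (act w x)"
proof -
  obtain xs where xs: "set xs \<subseteq> S" "word_prod G xs = w" using word_exists assms by metis
  have "supported (foldr reflect xs x)"
    using xs(1) assms(2) by (induction xs) (auto simp: supported_def reflect_apply)
  then show ?thesis using act_word[OF xs(1)] xs(2) by simp
qed

lemma act_expand:
  assumes "w \<in> carrier G" "supported x"
  shows "act w x t = (\<Sum>s\<in>S. x s * act w (simple_root s) t)"
proof -
  have "x = (\<lambda>t. \<Sum>s\<in>S. x s * simple_root s t)"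
    using assms(2) by (auto simp: simple_root_def supported_def fun_eq_iff if_distrib[of "\<lambda>y. _
        * y"] cong: if_cong)
  then have "act w x t = act w (\<lambda>t. \<Sum>s\<in>S. x s * simple_root s t) t" by simp
  then show ?thesis by (simp only: act_sum[OF assms(1)])
qed

lemma act_zero: "w \<in> carrier G \<Longrightarrow> act w (\<lambda>t. 0) = (\<lambda>t. 0)"
  using act_lin[of w 0 "\<lambda>t. 0" 0 "\<lambda>t. 0"] by simp

lemma act_simple_root_nonzero:
  assumes "w \<in> carrier G" shows "act w (simple_root s) \<noteq> (\<lambda>t. 0)"
proof
  assume "act w (simple_root s) = (\<lambda>t. 0)"
  then have "simple_root s = act (inv w) (\<lambda>t. 0)" using act_inv[OF assms, of "simple_root s"] by simp
  then have "simple_root s s = 0" using act_zero[of "inv w"] assms by simp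
  then show False by (simp add: simple_root_def)
qed

end

context finite_coxeter_system
begin

subsection \<open>Signs of roots\<close>

abbreviation nonneg :: "('a \<Rightarrow> real) \<Rightarrow> bool" where "nonneg x \<equiv> \<forall>t. 0 \<le> x t"
abbreviation nonpos :: "('a \<Rightarrow> real) \<Rightarrow> bool" where "nonpos x \<equiv> \<forall>t. x t \<le> 0"

definition alternating :: "'a \<Rightarrow> 'a \<Rightarrow> nat \<Rightarrow> 'a list" where
  "alternating s t k = map (\<lambda>i. if even i then s else t) [0..<k]"

lemma alternating_0 [simp]: "alternating s t 0 = []"
  by (simp add: alternating_def)

lemma alternating_Suc: "alternating s t (Suc k) = alternating s t k @ [if even k then s else t]"
  by (simp add: alternating_def)

lemma alternating_Suc': "alternating s t (Suc k) = s # alternating t s k"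
proof -
  have "[0..<Suc k] = 0 # map Suc [0..<k]" by (simp add: map_Suc_upt upt_conv_Cons del: upt_Suc)
  then show ?thesis by (simp add: alternating_def del: upt_Suc)
qed

lemma length_alternating [simp]: "length (alternating s t k) = k"
  by (simp add: alternating_def)

lemma set_alternating [intro, simp]: "\<lbrakk>s \<in> S; t \<in> S\<rbrakk> \<Longrightarrow> set (alternating s t k) \<subseteq> S"
  by (auto simp: alternating_def)

lemma conj_power:
  assumes "s \<in> S" "t \<in> S" shows "t \<otimes> (s \<otimes> t) [^] (j::nat) \<otimes> s = (t \<otimes> s) [^] Suc j"
proof (induction j)
  case 0
  then show ?case using assms by simp
next
  case (Suc j)
  have "t \<otimes> (s \<otimes> t) [^] Suc j \<otimes> s = (t \<otimes> (s \<otimes> t) [^] j \<otimes> s) \<otimes> (t \<otimes> s)"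
    using assms by (simp add: m_assoc)
  then show ?case using Suc by simp
qed

text \<open>One more letter at each end turns a power of one of the products \<open>s t\<close>,
  \<open>t s\<close> into the next power of the other, by \<open>conj_power\<close>. At length
  m(s,t) this power is trivial, which is the braid relation.\<close>

lemma rev_alternating_power:
  assumes "s \<in> S" "t \<in> S"
  shows "word_prod G (rev (alternating s t j) @ alternating t s j)
    = (if even j then t \<otimes> s else s \<otimes> t) [^] j"
proof (induction j)
  case 0
  then show ?case by simp
next
  case (Suc j)
  let ?a = "if even j then s else t" and ?b = "if even j then t else s"
  have m: "word_prod G (rev (alternating s t j) @ alternating t s j) \<in> carrier G"
    using assms by auto
  have "word_prod G (rev (alternating s t (Suc j)) @ alternating t s (Suc j))
    = word_prod G ([?a] @ (rev (alternating s t j) @ alternating t s j) @ [?b])"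
    by (simp add: alternating_Suc)
  also have "\<dots> = ?a \<otimes> word_prod G (rev (alternating s t j) @ alternating t s j) \<otimes> ?b"
    using assms m word_append[of "rev (alternating s t j) @ alternating t s j" "[?b]"] by (simp add: m_assoc)
  also have "\<dots> = (?a \<otimes> ?b) [^] Suc j"
    unfolding Suc using conj_power[of s t j] conj_power[of t s j] assms by auto
  finally show ?case by simp
qed

lemma braid_relation:
  assumes "s \<in> S" "t \<in> S"
  shows "word_prod G (alternating s t (coxeter_m G s t)) = word_prod G (alternating t s (coxeter_m G s t))"
proof -
  let ?m = "coxeter_m G s t"
  have "(s \<otimes> t) [^] ?m = \<one>" "(t \<otimes> s) [^] ?m = \<one>"
    using assms coxeter_m_sym[of s t] by (metis coxeter_m_def m_closed pow_ord_eq_1 simple_carrier)+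
  then have "word_prod G (rev (alternating s t ?m) @ alternating t s ?m) = \<one>"
    unfolding rev_alternating_power[OF assms] by (simp split: if_splits)
  then have "inv (word_prod G (alternating s t ?m)) \<otimes> word_prod G (alternating t s ?m) = \<one>"
    using assms by (simp add: word_append word_rev)
  then have "inv (word_prod G (alternating t s ?m)) = inv (word_prod G (alternating s t ?m))"
    using assms by (intro inv_equality) simp_all
  then have "inv (inv (word_prod G (alternating t s ?m))) = inv (inv (word_prod G (alternating s t ?m)))"
    by simp
  then show ?thesis using assms by simp
qed

text \<open>These are the roots of a dihedral group. For k < m every multiple of \<theta> that
  occurs is at most \<pi>, so both coordinates are nonnegative.\<close>

lemma dihedral_root:
  assumes st: "s \<in> S" "t \<in> S" "s \<noteq> t" and "\<theta> = pi / real (coxeter_m G s t)"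
  shows "foldr reflect (rev (alternating t s k)) (simple_root s) =
    (\<lambda>u. sin (real (if even k then Suc k else k) * \<theta>) / sin \<theta> * simple_root s u
       + sin (real (if even k then k else Suc k) * \<theta>) / sin \<theta> * simple_root t u)"
proof (induction k)
  case 0
  have "sin \<theta> > 0" using sin_pi_div_pos coxeter_m_ge_2[OF st] assms(4) by simp
  then show ?case by simp
next
  case (Suc k)
  have c: "cartan s t = - 2 * cos \<theta>" "cartan t s = - 2 * cos \<theta>"
    using assms cartan_sym[of s t] by (auto simp: cartan_def)
  have rs: "reflect s (\<lambda>u. a * simple_root s u + b * simple_root t u)
      = (\<lambda>u. (2 * cos \<theta> * b - a) * simple_root s u + b * simple_root t u)" for a b
    using st by (simp add: reflect_lin reflect_simple_root c algebra_simps)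
  have rt: "reflect t (\<lambda>u. a * simple_root s u + b * simple_root t u)
      = (\<lambda>u. a * simple_root s u + (2 * cos \<theta> * a - b) * simple_root t u)" for a b
    using st by (simp add: reflect_lin reflect_simple_root c algebra_simps)
  have "sin (real (Suc (Suc k)) * \<theta>) = 2 * cos \<theta> * sin (real (Suc k) * \<theta>) - sin (real k * \<theta>)"
    using sin_next[of "real (Suc k) * \<theta>" \<theta>] by (simp add: algebra_simps)
  then have sn: "2 * cos \<theta> * (sin (real (Suc k) * \<theta>) / sin \<theta>) - sin (real k * \<theta>) / sin \<theta>
      = sin (real (Suc (Suc k)) * \<theta>) / sin \<theta>"
    by (simp add: diff_divide_distrib)
  have step: "foldr reflect (rev (alternating t s (Suc k))) (simple_root s)
      = reflect (if even k then t else s) (foldr reflect (rev (alternating t s k)) (simple_root s))"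
    by (simp add: alternating_Suc)
  show ?case
  proof (cases "even k")
    case True
    then show ?thesis unfolding step Suc by (simp only: if_True rt sn even_Suc if_False simp_thms)
  next
    case False
    then show ?thesis unfolding step Suc by (simp only: if_True rs sn even_Suc if_False simp_thms)
  qed
qed

lemma last_letter:
  assumes "w \<in> carrier G" "w \<noteq> \<one>"
  obtains s y where "s \<in> S" "y \<in> carrier G" "w = y \<otimes> s" "len w = len y + 1"
proof -
  obtain xs where xs: "set xs \<subseteq> S" "length xs = len w" "word_prod G xs = w"
    using reduced_word_exists[OF assms(1)] .
  with assms(2) have "xs \<noteq> []" by auto
  then obtain ys s where ys: "xs = ys @ [s]" by (metis rev_exhaust)
  have w: "w = word_prod G ys \<otimes> s" using xs ys by (auto simp: word_append)
  have "len w = length ys + 1" using xs ys by simp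
  moreover have "len (word_prod G ys) \<le> length ys" using xs ys by (intro len_le) auto
  moreover have "len w \<le> len (word_prod G ys) + 1"
    using len_mult_simple[of "word_prod G ys" s] xs ys w by auto
  ultimately show thesis using that[of s "word_prod G ys"] w xs ys by auto
qed

text \<open>The basic link between length and roots. Divide \<open>w\<close> by the dihedral
  subgroup of \<open>s\<close> and a descent \<open>t\<close>: the shorter quotient keeps both
  simple roots nonnegative by induction, and what remains is a dihedral root with nonnegative
  coordinates.\<close>

lemma ascent_nonneg:
  assumes "w \<in> carrier G" "s \<in> S" "len w < len (w \<otimes> s)"
  shows "nonneg (act w (simple_root s))"
  using assms
proof (induction "len w" arbitrary: w s rule: less_induct)
  case less
  show ?case
  proof (cases "w = \<one>")
    case True
    then show ?thesis by (simp add: simple_root_def)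
  next
    case False
    then obtain t y where t: "t \<in> S" "y \<in> carrier G" "w = y \<otimes> t" "len w = len y + 1"
      using last_letter less.prems(1) by metis
    have wt: "w \<otimes> t = y" using t by simp
    with t less.prems have st: "s \<noteq> t" by auto
    define m where "m = coxeter_m G s t"
    define \<theta> where "\<theta> = pi / real m"
    have m: "m \<ge> 2" using coxeter_m_ge_2[of s t] st t less.prems by (simp add: m_def)
    define v where "v k = w \<otimes> word_prod G (alternating t s k)" for k
    define x where "x k = (if even k then t else s)" for k :: nat
    have xS: "x k \<in> S" for k using t less.prems by (simp add: x_def)
    have altS: "set (alternating t s k) \<subseteq> S" for k using t less.prems by simp
    have vc [simp]: "v k \<in> carrier G" for k using less.prems altS by (simp add: v_def)
    have v0: "v 0 = w" using less.prems by (simp add: v_def)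
    have vS: "v (Suc k) = v k \<otimes> x k" for k
      using less.prems altS[of k] xS[of k]
      by (simp add: v_def alternating_Suc word_append m_assoc x_def[symmetric])
    have vP: "v k = v (Suc k) \<otimes> x k" for k using vS[of k] xS[of k] by simp
    have lo: "len w \<le> len (v k) + k" for k
    proof (induction k)
      case (Suc k)
      then show ?case using len_mult_simple[of "v k" "x k"] xS[of k] vS[of k] by auto
    qed (simp add: v0)
    define P where "P k \<longleftrightarrow> len (v k) + k = len w" for k
    have bound: "k \<le> len w" if "P k" for k using that by (simp add: P_def)
    have P1: "P 1" using t wt vS[of 0] by (simp add: P_def v0 x_def)
    \<comment> \<open>\<open>v k\<close> is where the descent from \<open>w\<close> along t, s, t,
      ... ends: every step so far has shortened the element, and from here both letters lengthen
      it.\<close>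
    define k where "k = (GREATEST k. P k)"
    have Pk: "P k" unfolding k_def using GreatestI_nat[of P 1 "len w"] P1 bound by blast
    have kmax: "j \<le> k" if "P j" for j
      unfolding k_def using Greatest_le_nat[of P j "len w"] that bound by blast
    have k1: "k \<ge> 1" using kmax[OF P1] .
    have up: "len (v k) < len (v k \<otimes> x k)"
      using len_mult_simple[of "v k" "x k"] xS[of k] kmax[of "Suc k"] Pk vS[of k]
      by (auto simp: P_def)
    have up': "len (v k) < len (v k \<otimes> x (k - 1))"
    proof -
      have "v k \<otimes> x (k - 1) = v (k - 1)" using vP[of "k - 1"] k1 by simp
      then show ?thesis using lo[of "k - 1"] Pk k1 by (simp add: P_def)
    qed
    have less_v: "len (v k) < len w" using Pk k1 by (simp add: P_def)
    have "nonneg (act (v k) (simple_root (x k)))" "nonneg (act (v k) (simple_root (x (k - 1))))"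
      using less.hyps[OF less_v] up up' xS by simp_all
    then have nn: "nonneg (act (v k) (simple_root s))" "nonneg (act (v k) (simple_root t))"
      using k1 by (auto simp: x_def split: if_splits)
    \<comment> \<open>After m steps the braid relation would let the alternating word begin with
      \<open>s\<close> instead. Then \<open>w \<otimes> s\<close> would be within m - 1 letters of
      \<open>v m\<close>, hence shorter than \<open>w\<close>.\<close>
    have km: "k < m"
    proof (rule ccontr)
      assume "\<not> k < m"
      have dec: "len (v j) \<le> len (v (j + i)) + i" for i j
      proof (induction i)
        case (Suc i)
        then show ?case
          using len_mult_simple[of "v (j + i)" "x (j + i)"] xS[of "j + i"] vS[of "j + i"] by auto
      qed simp
      have "len (v m) + m \<le> len w" using dec[of m "k - m"] Pk \<open>\<not> k < m\<close> by (simp add: P_def)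
      have "v m = w \<otimes> word_prod G (alternating s t m)"
        using braid_relation[of s t] t less.prems by (simp add: v_def m_def)
      also have "alternating s t m = s # alternating t s (m - 1)"
        using alternating_Suc'[of s t "m - 1"] m by simp
      finally have "v m = (w \<otimes> s) \<otimes> word_prod G (alternating t s (m - 1))"
        using less.prems altS by (simp add: m_assoc)
      then have "w \<otimes> s = v m \<otimes> word_prod G (rev (alternating t s (m - 1)))"
        using less.prems altS by (simp add: m_assoc word_rev)
      then have "len (w \<otimes> s) \<le> len (v m) + (m - 1)"
        using len_mult_le[of "v m" "word_prod G (rev (alternating t s (m - 1)))"]
          len_le[of "rev (alternating t s (m - 1))"] altS[of "m - 1"] by simp
      then show False using \<open>len (v m) + m \<le> len w\<close> m less.prems by simp
    qed
    have "w = v k \<otimes> word_prod G (rev (alternating t s k))"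
      using less.prems altS[of k] by (simp add: v_def m_assoc word_rev)
    then have "act w (simple_root s) = act (v k) (foldr reflect (rev (alternating t s k)) (simple_root s))"
      using act_mult[of "v k" "word_prod G (rev (alternating t s k))" "simple_root s"]
        act_word[of "rev (alternating t s k)" "simple_root s"] altS[of k] by simp
    also have "\<dots> = (\<lambda>u. sin (real (if even k then Suc k else k) * \<theta>) / sin \<theta> * act (v k) (simple_root s) u
       + sin (real (if even k then k else Suc k) * \<theta>) / sin \<theta> * act (v k) (simple_root t) u)"
      unfolding dihedral_root[OF less.prems(2) t(1) st \<theta>_def[unfolded m_def]] by (rule act_lin) simp
    finally have eq: "act w (simple_root s) = \<dots>" .
    have "sin (real j * \<theta>) \<ge> 0" if "j \<le> m" for j
    proof (rule sin_ge_zero)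
      show "real j * \<theta> \<le> pi" using that m by (simp add: \<theta>_def field_simps)
    qed (simp add: \<theta>_def)
    then show ?thesis
      unfolding eq using nn km sin_pi_div_pos[OF m] by (auto simp: \<theta>_def simp del: of_nat_Suc)
  qed
qed

lemma act_mult_simple_root:
  "\<lbrakk>w \<in> carrier G; s \<in> S\<rbrakk> \<Longrightarrow> act (w \<otimes> s) (simple_root s) = (\<lambda>u. - act w (simple_root s) u)"
proof -
  assume a: "w \<in> carrier G" "s \<in> S"
  have "reflect s (simple_root s) = (\<lambda>u. - simple_root s u)"
    using a by (auto simp: reflect_simple_root)
  then show ?thesis using a by (simp add: act_mult act_simple act_uminus)
qed

lemma descent_nonpos:
  assumes "w \<in> carrier G" "s \<in> S" "len (w \<otimes> s) < len w"
  shows "nonpos (act w (simple_root s))"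
  using ascent_nonneg[of "w \<otimes> s" s] act_mult_simple_root[of w s] assms by simp

lemma act_simple_root_not_both:
  assumes "w \<in> carrier G" "nonneg (act w (simple_root s))" "nonpos (act w (simple_root s))" shows False
proof -
  have "act w (simple_root s) = (\<lambda>t. 0)" using assms by (auto simp: fun_eq_iff intro: antisym)
  then show False using act_simple_root_nonzero assms(1) by blast
qed

lemma ascent_iff:
  "\<lbrakk>w \<in> carrier G; s \<in> S\<rbrakk> \<Longrightarrow> len w < len (w \<otimes> s) \<longleftrightarrow> nonneg (act w (simple_root s))"
  by (metis ascent_nonneg descent_nonpos act_simple_root_not_both len_simple_neq linorder_neqE_nat)

lemma descent_iff:
  "\<lbrakk>w \<in> carrier G; s \<in> S\<rbrakk> \<Longrightarrow> len (w \<otimes> s) < len w \<longleftrightarrow> nonpos (act w (simple_root s))"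
  by (metis ascent_nonneg descent_nonpos act_simple_root_not_both len_simple_neq linorder_neqE_nat)

lemma root_sign: "\<lbrakk>w \<in> carrier G; s \<in> S\<rbrakk> \<Longrightarrow> nonneg (act w (simple_root s)) \<or> nonpos (act w (simple_root s))"
  using ascent_nonneg descent_nonpos len_simple_neq by (meson linorder_neqE_nat)

text \<open>A nontrivial element has a last letter, and it makes the simple root of that letter
  nonpositive.\<close>

lemma act_faithful:
  assumes "g \<in> carrier G" "\<And>s. s \<in> S \<Longrightarrow> act g (simple_root s) = simple_root s"
  shows "g = \<one>"
proof (rule ccontr)
  assume "g \<noteq> \<one>"
  then obtain s y where sy: "s \<in> S" "y \<in> carrier G" "g = y \<otimes> s" "len g = len y + 1"
    using last_letter[OF assms(1)] by metis
  then have "len (g \<otimes> s) < len g" by simp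
  then have "nonpos (act g (simple_root s))" using descent_nonpos sy assms by blast
  then have "simple_root s s \<le> 0" using assms(2)[OF sy(1)] by metis
  then show False by (simp add: simple_root_def)
qed

section \<open>The invariant form, reflections and roots\<close>

definition form :: "('a \<Rightarrow> real) \<Rightarrow> ('a \<Rightarrow> real) \<Rightarrow> real" where
  "form x y = (\<Sum>s\<in>S. y s * pairing x s)"

lemma form_sym: "form x y = form y x"
proof -
  have "form x y = (\<Sum>s\<in>S. \<Sum>t\<in>S. y s * (x t * cartan t s))"
    by (simp add: form_def pairing_def sum_distrib_left)
  also have "\<dots> = (\<Sum>t\<in>S. \<Sum>s\<in>S. y s * (x t * cartan t s))" by (rule sum.swap)
  also have "\<dots> = (\<Sum>t\<in>S. \<Sum>s\<in>S. x t * (y s * cartan s t))"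
    by (intro sum.cong refl) (auto simp: cartan_sym)
  finally show ?thesis by (simp add: form_def pairing_def sum_distrib_left)
qed

lemma form_reflect_right:
  assumes "s \<in> S" shows "form x (reflect s y) = form x y - pairing y s * pairing x s"
proof -
  have "form x (reflect s y) = (\<Sum>u\<in>S. y u * pairing x u - (if u = s then pairing y s * pairing x s else 0))"
    unfolding form_def by (intro sum.cong) (auto simp: reflect_apply algebra_simps)
  then show ?thesis using assms by (simp add: sum_subtractf form_def)
qed

lemma form_reflect:
  assumes "s \<in> S" shows "form (reflect s x) (reflect s y) = form x y"
proof -
  have "form (reflect s x) (reflect s y) = form y (reflect s x) - pairing y s * pairing (reflect s x) s"
    using form_reflect_right[OF assms, of "reflect s x" y] form_sym by simp
  also have "\<dots> = form x y"
    using form_reflect_right[OF assms, of y x] pairing_reflect[OF assms, of x s] assms form_sym[of x y]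
    by (simp add: algebra_simps)
  finally show ?thesis .
qed

lemma form_act:
  assumes "w \<in> carrier G" shows "form (act w x) (act w y) = form x y"
proof -
  obtain xs where xs: "set xs \<subseteq> S" "word_prod G xs = w" using word_exists assms by metis
  have "form (foldr reflect xs x) (foldr reflect xs y) = form x y"
    using xs(1) by (induction xs) (auto simp: form_reflect)
  then show ?thesis using act_word[OF xs(1)] xs(2) by simp
qed

lemma form_simple_root: "s \<in> S \<Longrightarrow> form x (simple_root s) = pairing x s"
  by (simp add: form_def simple_root_def if_distrib[where f = "\<lambda>y. y * _"] cong: if_cong)

lemma form_root: "\<lbrakk>w \<in> carrier G; s \<in> S\<rbrakk> \<Longrightarrow> form (act w (simple_root s)) (act w (simple_root s)) = 2"
  by (simp add: form_act form_simple_root pairing_simple_root)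

lemma form_scale: "form (\<lambda>t. a * x t) (\<lambda>t. b * y t) = a * b * form x y"
  by (simp add: form_def pairing_def sum_distrib_left algebra_simps)

lemma act_reflection:
  assumes "w \<in> carrier G" "s \<in> S"
  shows "act (w \<otimes> s \<otimes> inv w) x = (\<lambda>t. x t - form x (act w (simple_root s)) * act w (simple_root s) t)"
proof -
  let ?y = "act (inv w) x"
  have r: "reflect s ?y = (\<lambda>t. 1 * ?y t + (- pairing ?y s) * simple_root s t)"
    by (auto simp: reflect_apply simple_root_def)
  have "pairing ?y s = form (act w ?y) (act w (simple_root s))"
    using assms by (simp only: form_act form_simple_root)
  then have p: "pairing ?y s = form x (act w (simple_root s))" using assms by simp
  have "act (w \<otimes> s \<otimes> inv w) x = act w (reflect s ?y)"
    using assms by (simp add: act_mult act_simple)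
  also have "\<dots> = (\<lambda>t. act w ?y t - pairing ?y s * act w (simple_root s) t)"
    unfolding r using assms by (subst act_lin) auto
  finally show ?thesis using p assms by simp
qed

lemma root_proportional:
  assumes "v \<in> carrier G" "w \<in> carrier G" "s \<in> S" "t \<in> S"
    and eq: "act v (simple_root s) = (\<lambda>u. c * act w (simple_root t) u)"
  shows "c = 1 \<or> c = -1"
proof -
  have "2 = form (\<lambda>u. c * act w (simple_root t) u) (\<lambda>u. c * act w (simple_root t) u)"
    unfolding eq[symmetric] using form_root[of v s] assms by simp
  then have "2 = c * c * 2" unfolding form_scale using form_root[of w t] assms by simp
  then have "(c - 1) * (c + 1) = 0" by (simp add: algebra_simps)
  then show ?thesis by auto
qed

text \<open>A reflection determines its root up to sign: comparing both formulas at the first root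
  shows that the roots are proportional, and both have norm 2. Conversely, opposite roots give the
  same formula, and the action is faithful.\<close>

lemma reflection_eq_iff:
  assumes "v \<in> carrier G" "w \<in> carrier G" "s \<in> S" "t \<in> S"
  shows "v \<otimes> s \<otimes> inv v = w \<otimes> t \<otimes> inv w \<longleftrightarrow>
    act v (simple_root s) = act w (simple_root t) \<or> act v (simple_root s) = (\<lambda>u. - act w (simple_root t) u)"
    (is "?L \<longleftrightarrow> ?R")
proof
  assume L: ?L
  let ?x = "act v (simple_root s)" and ?y = "act w (simple_root t)"
  have "(\<lambda>t. ?x t - form ?x ?x * ?x t) = (\<lambda>t. ?x t - form ?x ?y * ?y t)"
    using act_reflection[OF assms(1,3), of ?x] act_reflection[OF assms(2,4), of ?x] L by simp
  then have "?x u - form ?x ?x * ?x u = ?x u - form ?x ?y * ?y u" for u by meson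
  then have "2 * ?x u = form ?x ?y * ?y u" for u
    unfolding form_root[OF assms(1,3)] by (drule_tac meta_spec[of _ u]) linarith
  then have "?x = (\<lambda>u. (form ?x ?y / 2) * ?y u)" by (simp add: fun_eq_iff field_simps)
  moreover from root_proportional[OF assms this]
  have "form ?x ?y / 2 = 1 \<or> form ?x ?y / 2 = -1" .
  ultimately show ?R by auto
next
  assume R: ?R
  let ?g = "v \<otimes> s \<otimes> inv v" and ?h = "w \<otimes> t \<otimes> inv w"
  have eq: "act ?g x = act ?h x" for x
    using R act_reflection[OF assms(1,3), of x] act_reflection[OF assms(2,4), of x]
      form_scale[of 1 x "-1" "act w (simple_root t)"] by auto
  have "inv ?h \<otimes> ?g = \<one>"
    by (rule act_faithful) (use assms eq in \<open>simp_all add: act_mult[of "inv ?h" ?g]\<close>)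
  then have "inv ?g = inv ?h" using assms by (intro inv_equality) simp_all
  then have "inv (inv ?g) = inv (inv ?h)" by (rule arg_cong)
  then show ?L using assms by (simp only: inv_inv m_closed inv_closed simple_carrier)
qed

text \<open>Only coordinate \<open>s\<close> changes under the reflection, so a positive root that
  becomes negative has no other coordinate, and norm 2 fixes the remaining one.\<close>

lemma root_flip:
  assumes "w \<in> carrier G" "s \<in> S" "t \<in> S"
    and "nonneg (act w (simple_root t))" "nonpos (reflect s (act w (simple_root t)))"
  shows "act w (simple_root t) = simple_root s"
proof -
  let ?x = "act w (simple_root t)"
  have off: "?x u = 0" if "u \<noteq> s" for u
  proof -
    have "reflect s ?x u = ?x u" using that by (simp add: reflect_apply)
    then have "?x u \<le> 0" using assms(5) by metis
    then show ?thesis using assms(4) by (simp add: antisym)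
  qed
  have eq: "?x = (\<lambda>u. ?x s * act \<one> (simple_root s) u)" using off by (auto simp: simple_root_def)
  then have "?x s = 1 \<or> ?x s = -1"
    by (rule root_proportional[OF assms(1) one_closed assms(3,2)])
  moreover have "?x s \<ge> 0" using assms(4) by blast
  ultimately have "?x s = 1" by auto
  then show ?thesis using eq by simp
qed

text \<open>The root \<open>act g (simple_root t)\<close> is positive and \<open>s\<close> makes it
  negative, so it is the simple root of \<open>s\<close>. Hence conjugation by \<open>g\<close>
  takes \<open>t\<close> to \<open>s\<close>.\<close>

lemma ascent_descent_eq:
  assumes "g \<in> carrier G" "s \<in> S" "t \<in> S"
    and "len g < len (g \<otimes> t)" "len (s \<otimes> g \<otimes> t) < len (s \<otimes> g)"
  shows "s \<otimes> g = g \<otimes> t"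
proof -
  have "act g (simple_root t) = simple_root s"
  proof (rule root_flip)
    show "nonneg (act g (simple_root t))" using ascent_iff assms by blast
    have "nonpos (act (s \<otimes> g) (simple_root t))" using descent_iff[of "s \<otimes> g" t] assms by simp
    then show "nonpos (reflect s (act g (simple_root t)))" using assms by (simp add: act_mult act_simple)
  qed (use assms in auto)
  then have "g \<otimes> t \<otimes> inv g = \<one> \<otimes> s \<otimes> inv \<one>"
    using reflection_eq_iff[of g \<one> t s] assms by simp
  then have "g \<otimes> t \<otimes> inv g = s" using assms by simp
  then show ?thesis using assms by (metis inv_solve_right' m_closed simple_carrier)
qed

text \<open>The strong exchange condition, in a form that records the reflection. The letters of
  \<open>xs\<close> act on the root one after the other, the first letter first, and turn it from
  negative to positive. The letter at which the sign changes is the one belonging to the reflection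
  of that root.\<close>

lemma exchange:
  assumes "set xs \<subseteq> S" "g \<in> carrier G" "t \<in> S"
    and "nonpos (act g (simple_root t))" "nonneg (foldr reflect (rev xs) (act g (simple_root t)))"
  shows "\<exists>as b bs. xs = as @ b # bs \<and> word_prod G as \<otimes> b \<otimes> inv (word_prod G as) = g \<otimes> t \<otimes> inv g"
  using assms
proof (induction xs arbitrary: g)
  case Nil
  then show ?case using act_simple_root_not_both[of g t] by simp
next
  case (Cons b xs)
  have b: "b \<in> S" and bg: "b \<otimes> g \<in> carrier G" using Cons.prems by auto
  have eq: "act (b \<otimes> g) (simple_root t) = reflect b (act g (simple_root t))"
    using Cons.prems b by (simp add: act_mult act_simple)
  show ?case
  proof (cases "nonpos (act (b \<otimes> g) (simple_root t))")
    case True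
    have "\<exists>as b' bs. xs = as @ b' # bs \<and>
      word_prod G as \<otimes> b' \<otimes> inv (word_prod G as) = (b \<otimes> g) \<otimes> t \<otimes> inv (b \<otimes> g)"
      by (rule Cons.IH) (use Cons.prems True bg eq in simp_all)
    then obtain as b' bs where split: "xs = as @ b' # bs"
      and r: "word_prod G as \<otimes> b' \<otimes> inv (word_prod G as) = (b \<otimes> g) \<otimes> t \<otimes> inv (b \<otimes> g)" by blast
    have as: "set as \<subseteq> S" "b' \<in> S" using split Cons.prems by auto
    have "word_prod G (b # as) \<otimes> b' \<otimes> inv (word_prod G (b # as))
        = b \<otimes> (word_prod G as \<otimes> b' \<otimes> inv (word_prod G as)) \<otimes> b"
      using as b by (simp add: inv_mult_group m_assoc)
    also have "\<dots> = g \<otimes> t \<otimes> inv g"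
      unfolding r using Cons.prems b by (simp add: inv_mult_group m_assoc simple_involution)
    finally show ?thesis using split by (intro exI[of _ "b # as"]) auto
  next
    case False
    then have nn: "nonneg (act (b \<otimes> g) (simple_root t))" using root_sign[OF bg] Cons.prems by blast
    have gt: "act (g \<otimes> t) (simple_root t) = (\<lambda>u. - act g (simple_root t) u)"
      using act_mult_simple_root Cons.prems by blast
    have "act (g \<otimes> t) (simple_root t) = simple_root b"
    proof (rule root_flip)
      show "nonneg (act (g \<otimes> t) (simple_root t))" unfolding gt using Cons.prems by simp
      have "reflect b (\<lambda>u. - act g (simple_root t) u) = (\<lambda>u. - reflect b (act g (simple_root t)) u)"
        using reflect_lin[of b "-1" "act g (simple_root t)" 0 "act g (simple_root t)"] by simp
      then show "nonpos (reflect b (act (g \<otimes> t) (simple_root t)))" unfolding gt using nn eq by simp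
    qed (use Cons.prems b in auto)
    then have "act g (simple_root t) = (\<lambda>u. - act \<one> (simple_root b) u)"
      using gt by (metis act_one minus_equation_iff)
    then have "g \<otimes> t \<otimes> inv g = \<one> \<otimes> b \<otimes> inv \<one>"
      using reflection_eq_iff[of g \<one> t b] Cons.prems b by blast
    then show ?thesis using b by (intro exI[of _ "[]"]) auto
  qed
qed

subsection \<open>The longest element\<close>

definition longest :: "'a \<Rightarrow> bool" where
  "longest w \<longleftrightarrow> w \<in> carrier G \<and> (\<forall>s\<in>S. len (w \<otimes> s) < len w)"

lemma longest_exists: "\<exists>w. longest w"
proof -
  have "Max (len ` carrier G) \<in> len ` carrier G" using finite_carrier by (intro Max_in) auto
  then obtain w where "w \<in> carrier G" "len w = Max (len ` carrier G)" by auto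
  then have w: "w \<in> carrier G" "\<And>v. v \<in> carrier G \<Longrightarrow> len v \<le> len w"
    using finite_carrier by auto
  have "len (w \<otimes> s) < len w" if "s \<in> S" for s
    using w(2)[of "w \<otimes> s"] len_simple_neq[of w s] w(1) that by force
  then show ?thesis using w(1) by (auto simp: longest_def)
qed

lemma longest_nonpos:
  assumes "longest w" "supported x" "nonneg x" shows "nonpos (act w x)"
proof
  fix t
  have "act w (simple_root s) t \<le> 0" if "s \<in> S" for s
    using assms(1) that descent_iff[of w s] by (auto simp: longest_def)
  then show "act w x t \<le> 0"
    using act_expand[of w x t] assms
    by (auto simp: longest_def intro!: sum_nonpos mult_nonneg_nonpos)
qed

lemma no_descent: assumes "x \<in> carrier G" "\<And>s. s \<in> S \<Longrightarrow> len x < len (x \<otimes> s)" shows "x = \<one>"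
proof (rule ccontr)
  assume "x \<noteq> \<one>"
  then obtain s y where sy: "s \<in> S" "y \<in> carrier G" "x = y \<otimes> s" "len x = len y + 1"
    using last_letter[OF assms(1)] by metis
  then show False using assms(2)[of s] by simp
qed

text \<open>Each factor turns nonnegative vectors into nonpositive ones, so the product keeps simple
  roots nonnegative and has no descent. This gives at once that the longest element is unique and
  that it is an involution.\<close>

lemma longest_mult: assumes "longest v" "longest w" shows "v \<otimes> w = \<one>"
proof (rule no_descent)
  have c: "v \<in> carrier G" "w \<in> carrier G" using assms by (auto simp: longest_def)
  then show "v \<otimes> w \<in> carrier G" by simp
  fix s assume s: "s \<in> S"
  let ?y = "act w (simple_root s)"
  have np: "nonpos ?y" using assms(2) s descent_iff[of w s] by (auto simp: longest_def)
  have "supported ?y" using supported_act supported_simple_root s c by blast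
  then have "nonpos (act v (\<lambda>t. - ?y t))"
    using np by (intro longest_nonpos[OF assms(1)]) (auto simp: supported_def)
  then have "nonneg (act (v \<otimes> w) (simple_root s))"
    using c by (simp add: act_uminus act_mult)
  then show "len (v \<otimes> w) < len (v \<otimes> w \<otimes> s)" using ascent_iff[of "v \<otimes> w" s] c s by simp
qed

definition w0 :: 'a where "w0 = (SOME w. longest w)"

lemma longest_w0: "longest w0"
  unfolding w0_def using someI_ex[OF longest_exists] .

lemma w0_carrier [simp, intro]: "w0 \<in> carrier G"
  using longest_w0 by (simp add: longest_def)

lemma w0_w0 [simp]: "w0 \<otimes> w0 = \<one>"
  using longest_mult longest_w0 by blast

lemma inv_w0 [simp]: "inv w0 = w0"
  by (simp add: inv_equality)

lemma longest_eq_w0: assumes "longest w" shows "w = w0"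
proof -
  have "w \<otimes> w0 = \<one>" using longest_mult longest_w0 assms by blast
  then have "inv w0 = w" using assms by (intro inv_equality) (auto simp: longest_def)
  then show ?thesis by simp
qed

lemma len_w0_mult: "x \<in> carrier G \<Longrightarrow> len (w0 \<otimes> x) + len x = len w0"
proof (induction "len x" arbitrary: x)
  case 0
  then have "x = \<one>" using len_eq_0 by simp
  then show ?case by simp
next
  case (Suc n)
  then have "x \<noteq> \<one>" by auto
  then obtain s y where sy: "s \<in> S" "y \<in> carrier G" "x = y \<otimes> s" "len x = len y + 1"
    using last_letter Suc.prems by metis
  then have IH: "len (w0 \<otimes> y) + len y = len w0" using Suc by simp
  have "nonneg (act y (simple_root s))" using ascent_iff[of y s] sy by simp
  then have "nonpos (act w0 (act y (simple_root s)))"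
    using sy supported_act supported_simple_root by (intro longest_nonpos longest_w0) auto
  then have "len (w0 \<otimes> y \<otimes> s) < len (w0 \<otimes> y)"
    using descent_iff[of "w0 \<otimes> y" s] sy by (simp add: act_mult)
  then have "len (w0 \<otimes> y \<otimes> s) + 1 = len (w0 \<otimes> y)" using len_mult_simple[of "w0 \<otimes> y" s] sy by auto
  then show ?case using IH sy by (simp add: m_assoc)
qed

lemma len_mult_w0: assumes "x \<in> carrier G" shows "len (x \<otimes> w0) + len x = len w0"
proof -
  have "len (x \<otimes> w0) = len (inv (x \<otimes> w0))" using assms by (simp only: len_inv m_closed w0_carrier)
  also have "inv (x \<otimes> w0) = w0 \<otimes> inv x" using assms by (simp add: inv_mult_group)
  finally show ?thesis using len_w0_mult[of "inv x"] assms len_inv by simp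
qed

end

context finite_coxeter_system
begin

subsection \<open>Hecke operators on functions on the group\<close>

definition hecke :: "'c \<Rightarrow> 'a \<Rightarrow> ('a \<Rightarrow> 'c) \<Rightarrow> 'a \<Rightarrow> 'c :: comm_ring_1" where
  "hecke z s f = (\<lambda>v. f (v \<otimes> s) + (if len v < len (v \<otimes> s) then z * f v else 0))"

text \<open>The mirror images commute with the operators \<open>hecke\<close>. They carry identities
  that are visible at the single point \<open>w0\<close> to every other point, which replaces a rank
  two computation of the braid relations.\<close>

definition left_hecke :: "'c \<Rightarrow> 'a \<Rightarrow> ('a \<Rightarrow> 'c) \<Rightarrow> 'a \<Rightarrow> 'c :: comm_ring_1" where
  "left_hecke z s f = (\<lambda>v. f (s \<otimes> v) + (if len v < len (s \<otimes> v) then z * f v else 0))"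

lemma hecke_cong:
  "\<lbrakk>\<And>v. v \<in> carrier G \<Longrightarrow> f v = g v; s \<in> S; v \<in> carrier G\<rbrakk> \<Longrightarrow> hecke z s f v = hecke z s g v"
  by (simp add: hecke_def)

lemma left_hecke_cong:
  "\<lbrakk>\<And>v. v \<in> carrier G \<Longrightarrow> f v = g v; s \<in> S; v \<in> carrier G\<rbrakk> \<Longrightarrow> left_hecke z s f v = left_hecke z s g v"
  by (simp add: left_hecke_def)

lemma foldr_hecke_cong:
  "\<lbrakk>\<And>v. v \<in> carrier G \<Longrightarrow> f v = g v; set xs \<subseteq> S; v \<in> carrier G\<rbrakk>
    \<Longrightarrow> foldr (hecke z) xs f v = foldr (hecke z) xs g v"
  by (induction xs arbitrary: v) (auto intro: hecke_cong)

lemma len_simple_less: "\<lbrakk>v \<in> carrier G; s \<in> S\<rbrakk> \<Longrightarrow> \<not> len v < len (v \<otimes> s) \<longleftrightarrow> len (v \<otimes> s) < len v"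
  using len_simple_neq[of v s] by auto

lemma hecke_quadratic:
  assumes "s \<in> S" "v \<in> carrier G"
  shows "hecke z s (hecke z s f) v = f v + z * hecke z s f v"
  using assms len_simple_less[of v s] by (auto simp: hecke_def algebra_simps)

text \<open>By \<open>ascent_descent_eq\<close>, multiplication by \<open>s\<close> on the left can
  alter the ascent at \<open>t\<close> only if \<open>s \<otimes> g = g \<otimes> t\<close>.\<close>

lemma ascent_shift:
  assumes "g \<in> carrier G" "s \<in> S" "t \<in> S" "s \<otimes> g \<noteq> g \<otimes> t"
  shows "len g < len (g \<otimes> t) \<longleftrightarrow> len (s \<otimes> g) < len (s \<otimes> g \<otimes> t)"
proof
  assume "len g < len (g \<otimes> t)"
  then show "len (s \<otimes> g) < len (s \<otimes> g \<otimes> t)"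
    using ascent_descent_eq[of g s t] len_simple_less[of "s \<otimes> g" t] assms by auto
next
  assume a: "len (s \<otimes> g) < len (s \<otimes> g \<otimes> t)"
  show "len g < len (g \<otimes> t)"
  proof (rule ccontr)
    assume "\<not> ?thesis"
    then have d: "len (s \<otimes> (s \<otimes> g) \<otimes> t) < len (s \<otimes> (s \<otimes> g))"
      using len_simple_less[of g t] assms by simp
    have "s \<otimes> (s \<otimes> g) = s \<otimes> g \<otimes> t"
      using ascent_descent_eq[of "s \<otimes> g" s t] a d assms by simp
    then have "s \<otimes> (s \<otimes> g) = s \<otimes> (g \<otimes> t)" using assms by (simp add: m_assoc)
    then show False using assms by (simp del: simple_cancel_left)
  qed
qed

lemma left_ascent_shift:
  assumes "g \<in> carrier G" "s \<in> S" "t \<in> S" "s \<otimes> g \<noteq> g \<otimes> t"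
  shows "len g < len (s \<otimes> g) \<longleftrightarrow> len (g \<otimes> t) < len (s \<otimes> g \<otimes> t)"
proof -
  have i: "len (s \<otimes> g) = len (inv g \<otimes> s)" "len (g \<otimes> t) = len (t \<otimes> inv g)"
    "len (s \<otimes> g \<otimes> t) = len (t \<otimes> inv g \<otimes> s)"
    using assms len_inv[of "s \<otimes> g"] len_inv[of "g \<otimes> t"] len_inv[of "s \<otimes> g \<otimes> t"]
    by (simp_all add: inv_mult_group m_assoc)
  have "t \<otimes> inv g \<noteq> inv g \<otimes> s"
  proof
    assume "t \<otimes> inv g = inv g \<otimes> s"
    then have "inv (t \<otimes> inv g) = inv (inv g \<otimes> s)" by (rule arg_cong)
    then show False using assms by (simp add: inv_mult_group)
  qed
  then show ?thesis
    using ascent_shift[of "inv g" t s] assms unfolding i by (simp add: len_inv)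
qed

text \<open>If \<open>t \<otimes> v = v \<otimes> s\<close>, both operators do the same thing on the
  pair \<open>v\<close>, \<open>v \<otimes> s\<close>. Otherwise opposite edges of the square
  spanned by \<open>v\<close>, \<open>v \<otimes> s\<close> and \<open>t \<otimes> v\<close> are
  ascents simultaneously, so the \<open>z\<close>-terms match.\<close>

lemma hecke_left_hecke:
  assumes "s \<in> S" "t \<in> S" "v \<in> carrier G"
  shows "hecke z s (left_hecke z t f) v = left_hecke z t (hecke z s f) v"
proof (cases "t \<otimes> v = v \<otimes> s")
  case True
  then have "t \<otimes> (v \<otimes> s) = v" "v \<otimes> s \<otimes> s = v"
    using assms by (metis simple_cancel_left, simp)
  then show ?thesis using True len_simple_less[of v s] assms
    by (auto simp: hecke_def left_hecke_def algebra_simps)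
next
  case False
  have "t \<otimes> (v \<otimes> s) = t \<otimes> v \<otimes> s" using assms by (simp add: m_assoc)
  then show ?thesis
    using ascent_shift[OF assms(3,2,1) False] left_ascent_shift[OF assms(3,2,1) False]
    by (auto simp: hecke_def left_hecke_def algebra_simps)
qed

lemma hecke_foldr_left_hecke:
  assumes "s \<in> S" "set ys \<subseteq> S" "v \<in> carrier G"
  shows "hecke z s (foldr (left_hecke z) ys f) v = foldr (left_hecke z) ys (hecke z s f) v"
  using assms(2,3)
proof (induction ys arbitrary: v)
  case (Cons t ys)
  then have "hecke z s (foldr (left_hecke z) (t # ys) f) v
      = left_hecke z t (hecke z s (foldr (left_hecke z) ys f)) v"
    using assms(1) by (simp, intro hecke_left_hecke) auto
  also have "\<dots> = left_hecke z t (foldr (left_hecke z) ys (hecke z s f)) v"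
    using Cons by (intro left_hecke_cong) auto
  finally show ?case by simp
qed simp

lemma foldr_hecke_left_hecke:
  assumes "set xs \<subseteq> S" "set ys \<subseteq> S" "v \<in> carrier G"
  shows "foldr (hecke z) xs (foldr (left_hecke z) ys f) v = foldr (left_hecke z) ys (foldr (hecke z) xs f) v"
  using assms(1,3)
proof (induction xs arbitrary: v)
  case (Cons s xs)
  then have "foldr (hecke z) (s # xs) (foldr (left_hecke z) ys f) v
      = hecke z s (foldr (left_hecke z) ys (foldr (hecke z) xs f)) v"
    by (simp, intro hecke_cong) auto
  also have "\<dots> = foldr (left_hecke z) ys (hecke z s (foldr (hecke z) xs f)) v"
    using Cons assms(2) by (intro hecke_foldr_left_hecke) auto
  finally show ?case by simp
qed simp

text \<open>Below \<open>w0\<close> the lengths fall exactly as those of \<open>x\<close> rise. A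
  length-additive word therefore meets descents only, no \<open>z\<close>-term arises, and the
  operator is a mere translation.\<close>

lemma foldr_hecke_w0:
  assumes "set xs \<subseteq> S" "x \<in> carrier G" "len (x \<otimes> word_prod G xs) = len x + length xs"
  shows "foldr (hecke z) xs f (w0 \<otimes> x) = f (w0 \<otimes> x \<otimes> word_prod G xs)"
  using assms
proof (induction xs arbitrary: x)
  case (Cons s xs)
  then have s: "s \<in> S" and xs: "set xs \<subseteq> S" by auto
  have "len (x \<otimes> s \<otimes> word_prod G xs) = len x + Suc (length xs)"
    using Cons.prems s xs by (simp add: m_assoc)
  moreover have "len (x \<otimes> s \<otimes> word_prod G xs) \<le> len (x \<otimes> s) + length xs"
    using len_mult_le[of "x \<otimes> s" "word_prod G xs"] len_le[OF xs] Cons.prems s xs by auto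
  ultimately have l: "len (x \<otimes> s) = len x + 1"
    using len_mult_simple[of x s] Cons.prems s by auto
  have "len (w0 \<otimes> x \<otimes> s) < len (w0 \<otimes> x)"
    using len_w0_mult[of x] len_w0_mult[of "x \<otimes> s"] l Cons.prems s by (simp add: m_assoc)
  then have "foldr (hecke z) (s # xs) f (w0 \<otimes> x) = foldr (hecke z) xs f (w0 \<otimes> (x \<otimes> s))"
    using Cons.prems s by (simp add: hecke_def m_assoc)
  also have "\<dots> = f (w0 \<otimes> (x \<otimes> s) \<otimes> word_prod G xs)"
    by (rule Cons.IH) (use Cons.prems s xs l in \<open>auto simp: m_assoc\<close>)
  finally show ?case using Cons.prems s xs by (simp add: m_assoc)
qed simp

lemma foldr_left_hecke_w0:
  assumes "set ys \<subseteq> S" "x \<in> carrier G" "len (word_prod G (rev ys) \<otimes> x) = length ys + len x"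
  shows "foldr (left_hecke z) ys f (x \<otimes> w0) = f (word_prod G (rev ys) \<otimes> x \<otimes> w0)"
  using assms
proof (induction ys arbitrary: x)
  case (Cons s ys)
  then have s: "s \<in> S" and ys: "set ys \<subseteq> S" by auto
  have ry: "word_prod G (rev ys) \<in> carrier G" using ys by auto
  have e: "word_prod G (rev (s # ys)) \<otimes> x = word_prod G (rev ys) \<otimes> (s \<otimes> x)"
    using Cons.prems s ys ry by (simp add: m_assoc word_append)
  have "len (word_prod G (rev ys) \<otimes> (s \<otimes> x)) = Suc (length ys) + len x"
    using Cons.prems e by simp
  moreover have "len (word_prod G (rev ys) \<otimes> (s \<otimes> x)) \<le> length ys + len (s \<otimes> x)"
    using len_mult_le[of "word_prod G (rev ys)" "s \<otimes> x"] len_le[of "rev ys"] Cons.prems s ys ry by simp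
  moreover have "len (s \<otimes> x) \<le> len x + 1"
    using len_mult_le[of s x] len_simple[OF s] Cons.prems s by simp
  ultimately have l: "len (s \<otimes> x) = len x + 1" by simp
  have "len (s \<otimes> (x \<otimes> w0)) < len (x \<otimes> w0)"
    using len_mult_w0[of x] len_mult_w0[of "s \<otimes> x"] l Cons.prems s by (simp add: m_assoc)
  then have "foldr (left_hecke z) (s # ys) f (x \<otimes> w0) = foldr (left_hecke z) ys f ((s \<otimes> x) \<otimes> w0)"
    using Cons.prems s by (simp add: left_hecke_def m_assoc)
  also have "\<dots> = f (word_prod G (rev ys) \<otimes> (s \<otimes> x) \<otimes> w0)"
    by (rule Cons.IH) (use Cons.prems s ys l e in auto)
  finally show ?case using e by simp
qed simp

text \<open>A reduced word of \<open>v \<otimes> w0\<close> leads from \<open>w0\<close> down to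
  \<open>v\<close>, and the left operators along it only translate.\<close>

lemma left_hecke_evaluation:
  assumes "v \<in> carrier G"
  obtains ys where "set ys \<subseteq> S" "\<And>f. foldr (left_hecke z) ys f w0 = f v"
proof -
  obtain xs where xs: "set xs \<subseteq> S" "length xs = len (v \<otimes> w0)" "word_prod G xs = v \<otimes> w0"
    using reduced_word_exists[of "v \<otimes> w0"] assms by auto
  have "foldr (left_hecke z) (rev xs) f (\<one> \<otimes> w0) = f (word_prod G (rev (rev xs)) \<otimes> \<one> \<otimes> w0)" for f
    by (rule foldr_left_hecke_w0) (use xs assms in simp_all)
  then show thesis using that[of "rev xs"] xs assms by (simp add: m_assoc)
qed

text \<open>At \<open>w0\<close> a reduced product merely evaluates at \<open>w0\<close> times the
  element, which does not depend on the word. Any other evaluation point is moved to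
  \<open>w0\<close> by left operators, and these commute with the product. All braid relations of
  the Hecke algebra are contained in this.\<close>

lemma foldr_hecke_reduced_cong:
  assumes "set xs \<subseteq> S" "set ys \<subseteq> S" "word_prod G xs = word_prod G ys"
    and "length xs = len (word_prod G xs)" "length ys = len (word_prod G ys)" "v \<in> carrier G"
  shows "foldr (hecke z) xs f v = foldr (hecke z) ys f v"
proof -
  obtain us where us: "set us \<subseteq> S" "\<And>f. foldr (left_hecke z) us f w0 = f v"
    using left_hecke_evaluation[OF assms(6)] by blast
  have "foldr (hecke z) xs f v = foldr (left_hecke z) us f (w0 \<otimes> word_prod G xs)"
    if "set xs \<subseteq> S" "length xs = len (word_prod G xs)" for xs
    using us foldr_hecke_left_hecke[of xs us w0 z f]
      foldr_hecke_w0[of xs \<one> z "foldr (left_hecke z) us f"] that by simp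
  then show ?thesis using assms by metis
qed

lemma hecke_commute:
  assumes "s \<in> S" "t \<in> S" "s \<otimes> t = t \<otimes> s" "v \<in> carrier G"
  shows "hecke z s (hecke z t f) v = hecke z t (hecke z s f) v"
proof (cases "s = t")
  case False
  have "len (s \<otimes> t) \<noteq> 0" using assms False len_eq_0[of "s \<otimes> t"] inv_equality[of s t] by auto
  then have "len (s \<otimes> t) = 2" using len_mult_simple[of s t] len_simple[of s] assms by auto
  then show ?thesis
    using foldr_hecke_reduced_cong[of "[s, t]" "[t, s]" v z f] assms by simp
qed simp

section \<open>The operator of the longest element\<close>

definition w0_word :: "'a list" where
  "w0_word = (SOME xs. set xs \<subseteq> S \<and> length xs = len w0 \<and> word_prod G xs = w0)"

lemma w0_word: "set w0_word \<subseteq> S" "length w0_word = len w0" "word_prod G w0_word = w0"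
proof -
  have "\<exists>xs. set xs \<subseteq> S \<and> length xs = len w0 \<and> word_prod G xs = w0"
    by (rule reduced_word_exists[of w0]) auto
  from someI_ex[OF this, folded w0_word_def]
  show "set w0_word \<subseteq> S" "length w0_word = len w0" "word_prod G w0_word = w0" by simp_all
qed

lemma foldr_hecke_w0_word:
  assumes "set xs \<subseteq> S" "length xs = len w0" "word_prod G xs = w0" "v \<in> carrier G"
  shows "foldr (hecke z) xs f v = foldr (hecke z) w0_word f v"
  using assms w0_word by (intro foldr_hecke_reduced_cong) auto

lemma w0_conj_simple: assumes "s \<in> S" shows "w0 \<otimes> s \<otimes> w0 \<in> S"
proof -
  have "len (w0 \<otimes> s \<otimes> w0) = 1"
    using len_mult_w0[of "w0 \<otimes> s"] len_w0_mult[of s] len_simple[of s] assms by simp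
  then obtain xs where "set xs \<subseteq> S" "length xs = 1" "word_prod G xs = w0 \<otimes> s \<otimes> w0"
    using reduced_word_exists[of "w0 \<otimes> s \<otimes> w0"] assms by auto
  then show ?thesis by (cases xs) auto
qed

text \<open>Both \<open>s\<close> followed by a reduced word of \<open>s \<otimes> w0\<close>, and
  that word followed by \<open>w0 \<otimes> s \<otimes> w0\<close>, are reduced words of
  \<open>w0\<close>.\<close>

lemma hecke_w0_word:
  assumes "s \<in> S" "v \<in> carrier G"
  shows "hecke z s (foldr (hecke z) w0_word f) v = foldr (hecke z) w0_word (hecke z (w0 \<otimes> s \<otimes> w0) f) v"
proof -
  let ?s = "w0 \<otimes> s \<otimes> w0"
  have sw: "s \<otimes> w0 \<in> carrier G" using assms by simp
  obtain ys where ys: "set ys \<subseteq> S" "length ys = len (s \<otimes> w0)" "word_prod G ys = s \<otimes> w0"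
    using reduced_word_exists[OF sw] .
  have l: "Suc (len (s \<otimes> w0)) = len w0" using len_mult_w0[of s] len_simple[of s] assms by simp
  have a: "s \<otimes> w0 \<otimes> (w0 \<otimes> s \<otimes> w0) = w0"
  proof -
    have "s \<otimes> w0 \<otimes> (w0 \<otimes> s \<otimes> w0) = s \<otimes> ((w0 \<otimes> w0) \<otimes> (s \<otimes> w0))" using assms
        by (simp only: m_assoc m_closed w0_carrier simple_carrier)
    then show ?thesis using assms by simp
  qed
  have "hecke z s (foldr (hecke z) w0_word f) v
      = hecke z s (foldr (hecke z) (ys @ [?s]) f) v"
    by (intro hecke_cong foldr_hecke_w0_word[symmetric])
      (use assms w0_conj_simple ys l a in \<open>auto simp: word_append\<close>)
  also have "\<dots> = foldr (hecke z) (s # ys) (hecke z ?s f) v" by simp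
  also have "\<dots> = foldr (hecke z) w0_word (hecke z ?s f) v"
    by (intro foldr_hecke_w0_word) (use assms ys l in auto)
  finally show ?thesis .
qed

lemma hecke_full_twist:
  assumes "s \<in> S" "v \<in> carrier G"
  shows "hecke z s (foldr (hecke z) (w0_word @ w0_word) f) v
      = foldr (hecke z) (w0_word @ w0_word) (hecke z s f) v"
proof -
  let ?s = "w0 \<otimes> s \<otimes> w0"
  have s: "?s \<in> S" using w0_conj_simple assms by blast
  have "w0 \<otimes> ?s \<otimes> w0 = (w0 \<otimes> w0) \<otimes> s \<otimes> (w0 \<otimes> w0)"
    using assms by (simp only: m_assoc m_closed w0_carrier simple_carrier)
  then have ss: "w0 \<otimes> ?s \<otimes> w0 = s" using assms by simp
  have "hecke z s (foldr (hecke z) w0_word (foldr (hecke z) w0_word f)) v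
      = foldr (hecke z) w0_word (hecke z ?s (foldr (hecke z) w0_word f)) v"
    using assms by (rule hecke_w0_word)
  also have "\<dots> = foldr (hecke z) w0_word (foldr (hecke z) w0_word (hecke z s f)) v"
    using hecke_w0_word[OF s] ss assms w0_word(1) by (intro foldr_hecke_cong) simp_all
  finally show ?thesis by simp
qed

subsection \<open>Expansion over distinguished subwords\<close>

lemma one_not_in_S [simp]: "\<one> \<notin> S" by (rule simple_not_one)

lemma subwords_Nil [simp]: "subwords G [] = {[]}"
  by (auto simp: subwords_def)

lemma subwords_Cons: "subwords G (s # ws) = (#) s ` subwords G ws \<union> (#) \<one> ` subwords G ws"
proof (rule Set.set_eqI)
  fix us
  show "us \<in> subwords G (s # ws) \<longleftrightarrow> us \<in> (#) s ` subwords G ws \<union> (#) \<one> ` subwords G ws"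
    by (cases us) (auto simp: subwords_def All_less_Suc2 image_iff)
qed

lemma finite_subwords [simp]: "finite (subwords G ws)"
  by (induction ws) (auto simp: subwords_Cons)

lemma subwords_closed:
  assumes "us \<in> subwords G ws" "set ws \<subseteq> S" shows "set us \<subseteq> carrier G"
proof
  fix u assume "u \<in> set us"
  then obtain i where "i < length us" "u = us ! i" by (auto simp: in_set_conv_nth)
  then show "u \<in> carrier G" using assms nth_mem[of i ws] by (fastforce simp: subwords_def)
qed

lemma word_prod_closed: "set us \<subseteq> carrier G \<Longrightarrow> word_prod G us \<in> carrier G"
  by (induction us) auto

lemma weak_le_refl: "x \<in> carrier G \<Longrightarrow> weak_le G S x x"
  by (simp add: weak_le_def)

lemma weak_le_simple: assumes "v \<in> carrier G" "s \<in> S" shows "weak_le G S v (v \<otimes> s) \<longleftrightarrow> len v < len (v \<otimes> s)"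
proof -
  have "inv v \<otimes> (v \<otimes> s) = s" using assms by (simp add: m_assoc[symmetric])
  then show ?thesis using len_mult_simple[OF assms] len_simple[OF assms(2)] by (auto simp: weak_le_def)
qed

lemma distinguished_Cons:
  assumes "v \<in> carrier G" "u \<in> carrier G" "set us \<subseteq> carrier G"
  shows "distinguished G S v (s # ws) (u # us) \<longleftrightarrow>
    weak_le G S (v \<otimes> u) (v \<otimes> s) \<and> distinguished G S (v \<otimes> u) ws us" 
proof -
  have "word_prod G (take i us) \<in> carrier G" for i
    using assms(3) by (intro word_prod_closed) (meson order_trans set_take_subset)
  then show ?thesis
    using assms unfolding distinguished_def by (simp add: All_less_Suc2 m_assoc)
qed

lemma skips_filter: "skips G us = length (filter (\<lambda>u. u = \<one>) us)"
  by (simp add: skips_def length_filter_conv_card)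

lemma foldr_hecke_expand:
  assumes "set ws \<subseteq> S" "v \<in> carrier G"
  shows "foldr (hecke z) ws f v =
    (\<Sum>us | us \<in> subwords G ws \<and> distinguished G S v ws us. z ^ skips G us * f (v \<otimes> word_prod G us))"
  using assms
proof (induction ws arbitrary: v)
  case Nil
  have "{us. us \<in> subwords G [] \<and> distinguished G S v [] us} = {[]}"
    by (auto simp: distinguished_def)
  then show ?case using Nil by (simp add: skips_filter)
next
  case (Cons s ws)
  then have s: "s \<in> S" and ws: "set ws \<subseteq> S" and v: "v \<in> carrier G" by auto
  then have s1: "s \<noteq> \<one>" by auto
  define D where "D v = {us. us \<in> subwords G ws \<and> distinguished G S v ws us}" for v
  have closed: "set us \<subseteq> carrier G" if "us \<in> D w" for us w
    using that subwords_closed[OF _ ws] by (auto simp: D_def)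
  have finD: "finite (D w)" for w by (simp add: D_def)
  \<comment> \<open>A taken letter satisfies its weak order condition by reflexivity. A skipped
    letter requires an ascent, which is exactly where \<open>hecke\<close> has its
    \<open>z\<close>-term.\<close>
  have split: "{us. us \<in> subwords G (s # ws) \<and> distinguished G S v (s # ws) us}
      = (#) s ` D (v \<otimes> s) \<union> (#) \<one> ` (if len v < len (v \<otimes> s) then D v else {})"
    using distinguished_Cons[of v _ _ s ws] subwords_closed[OF _ ws] s v weak_le_refl[of "v \<otimes> s"]
      weak_le_simple[OF v s]
    by (auto simp: subwords_Cons D_def)
  have "(\<Sum>us | us \<in> subwords G (s # ws)
      \<and> distinguished G S v (s # ws) us. z ^ skips G us * f (v \<otimes> word_prod G us))
    = (\<Sum>us\<in>D (v \<otimes> s). z ^ skips G us * f (v \<otimes> s \<otimes> word_prod G us))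
      + (if len v < len (v \<otimes> s) then z * (\<Sum>us\<in>D v. z ^ skips G us * f (v \<otimes> word_prod G us)) else 0)"
  proof -
    have "(\<Sum>us\<in>(#) s ` D (v \<otimes> s). z ^ skips G us * f (v \<otimes> word_prod G us))
        = (\<Sum>us\<in>D (v \<otimes> s). z ^ skips G us * f (v \<otimes> s \<otimes> word_prod G us))"
      using s1 s v closed word_prod_closed
          by (subst sum.reindex) (auto simp: skips_filter m_assoc intro!: sum.cong)
    moreover have "(\<Sum>us\<in>(#) \<one> ` D v. z ^ skips G us * f (v \<otimes> word_prod G us))
        = z * (\<Sum>us\<in>D v. z ^ skips G us * f (v \<otimes> word_prod G us))"
      using v closed word_prod_closed
      by (subst sum.reindex) (auto simp: skips_filter sum_distrib_left mult.assoc intro!: sum.cong)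
    ultimately show ?thesis
      unfolding split using s1 finD by (subst sum.union_disjoint) auto
  qed
  also have "\<dots> = foldr (hecke z) (s # ws) f v"
    using Cons.IH[OF ws, of "v \<otimes> s"] Cons.IH[OF ws v] s v
        by (simp add: hecke_def[of z s "foldr (hecke z) ws f"] D_def)
  finally show ?case by simp
qed

end

subsection \<open>Levels of the reflections along powers of a Coxeter word\<close>

text \<open>The Euler form of the orientation given by a word. It is invariant when the first letter is moved
  to the end of the word and both arguments are reflected in it.\<close>

fun (in coxeter_system) euler :: "'a list \<Rightarrow> ('a \<Rightarrow> real) \<Rightarrow> ('a \<Rightarrow> real) \<Rightarrow> real" where
  "euler [] x y = 0"
| "euler (s # w) x y = x s * y s + y s * (\<Sum>i\<leftarrow>w. x i * cartan i s) + euler w x y"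

context finite_coxeter_system
begin

lemma euler_cong:
  "\<lbrakk>\<And>s. s \<in> set w \<Longrightarrow> x s = x' s; \<And>s. s \<in> set w \<Longrightarrow> y s = y' s\<rbrakk> \<Longrightarrow> euler w x y = euler w x' y'"
proof (induction w)
  case (Cons a w)
  have "(\<Sum>i\<leftarrow>w. x i * cartan i a) = (\<Sum>i\<leftarrow>w. x' i * cartan i a)"
    using Cons.prems by (intro arg_cong[of _ _ sum_list] map_cong) auto
  then show ?case using Cons by simp
qed simp

lemma euler_snoc:
  "euler (w @ [s]) x y = euler w x y + x s * y s + x s * (\<Sum>j\<leftarrow>w. y j * cartan s j)"
  by (induction w) (simp_all add: algebra_simps)

lemma euler_scale: "euler w (\<lambda>t. a * x t) (\<lambda>t. b * y t) = a * b * euler w x y"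
proof (induction w)
  case (Cons s w)
  have "(\<Sum>i\<leftarrow>w. a * x i * cartan i s) = a * (\<Sum>i\<leftarrow>w. x i * cartan i s)"
    by (simp add: sum_list_const_mult mult.assoc)
  then show ?case using Cons by (simp add: algebra_simps)
qed simp

lemma pairing_sum_list:
  assumes "distinct (s # w)" "set (s # w) = S"
  shows "pairing x s = 2 * x s + (\<Sum>i\<leftarrow>w. x i * cartan i s)"
proof -
  have S: "S = insert s (set w)" and s: "s \<in> S" using assms by auto
  have "(\<Sum>i\<leftarrow>w. x i * cartan i s) = (\<Sum>i\<in>set w. x i * cartan i s)"
    using assms by (simp add: sum_list_distinct_conv_sum_set)
  moreover have "pairing x s = x s * cartan s s + (\<Sum>i\<in>set w. x i * cartan i s)"
  proof -
    have "(\<Sum>t\<in>insert s (set w). x t * cartan t s) = x s * cartan s s + (\<Sum>i\<in>set w. x i * cartan i s)"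
      using assms(1) by simp
    moreover have "pairing x s = (\<Sum>t\<in>insert s (set w). x t * cartan t s)"
      unfolding pairing_def using S by (intro sum.cong) auto
    ultimately show ?thesis by simp
  qed
  ultimately show ?thesis using s by simp
qed

lemma euler_rotate:
  assumes "distinct (s # w)" "set (s # w) = S"
  shows "euler (w @ [s]) (reflect s x) (reflect s y) = euler (s # w) x y"
proof -
  have s: "s \<in> S" and w: "set w \<subseteq> S" using assms by auto
  have e: "euler w (reflect s x) (reflect s y) = euler w x y"
    using assms by (intro euler_cong) (auto simp: reflect_apply)
  have "(\<Sum>j\<leftarrow>w. reflect s y j * cartan s j) = (\<Sum>j\<leftarrow>w. y j * cartan j s)"
    using assms by (intro arg_cong[of _ _ sum_list] map_cong) (auto simp: reflect_apply cartan_sym)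
  then have l: "(\<Sum>j\<leftarrow>w. reflect s y j * cartan s j) = pairing y s - 2 * y s"
    using pairing_sum_list[OF assms, of y] by simp
  have r: "(\<Sum>j\<leftarrow>w. x j * cartan j s) = pairing x s - 2 * x s"
    using pairing_sum_list[OF assms, of x] by simp
  show ?thesis
    unfolding euler_snoc e l by (simp add: r reflect_apply algebra_simps)
qed

lemma euler_simple_root:
  assumes "distinct (s # w)" shows "euler (s # w) (simple_root s) y = y s"
proof -
  have "euler w (simple_root s) y = euler w (\<lambda>t. 0 * y t) (\<lambda>t. 1 * y t)"
    using assms by (intro euler_cong) (auto simp: simple_root_def)
  then have "euler w (simple_root s) y = 0" unfolding euler_scale by simp
  moreover have "(\<Sum>i\<leftarrow>w. simple_root s i * cartan i s) = (\<Sum>i\<leftarrow>w. 0)"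
    using assms by (intro arg_cong[of _ _ sum_list] map_cong) (auto simp: simple_root_def)
  ultimately show ?thesis by (simp add: simple_root_def)
qed

lemma foldr_reflect_off: "u \<notin> set ws \<Longrightarrow> foldr reflect ws x u = x u"
  by (induction ws) (auto simp: reflect_apply)

text \<open>When the reflection in \<open>u\<close> is applied, coordinate \<open>u\<close> is still
  0, so the pairing with \<open>u\<close> has only nonpositive terms and the coordinate can only
  grow.\<close>

lemma foldr_reflect_simple_root:
  assumes "distinct ws" "set ws \<subseteq> S" "s \<in> S" "s \<notin> set ws"
  shows "nonneg (foldr reflect ws (simple_root s))"
  using assms(1,2,4)
proof (induction ws)
  case (Cons u ws)
  let ?x = "foldr reflect ws (simple_root s)"
  have nn: "nonneg ?x" using Cons by auto
  have 0: "?x u = 0" using foldr_reflect_off[of u ws "simple_root s"] Cons.prems by (auto simp: simple_root_def)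
  have "pairing ?x u \<le> 0"
    unfolding pairing_def
  proof (rule sum_nonpos)
    fix t assume t: "t \<in> S"
    show "?x t * cartan t u \<le> 0"
    proof (cases "t = u")
      case False
      then show ?thesis using nn cartan_nonpos[of t u] t Cons.prems by (auto intro: mult_nonneg_nonpos)
    qed (simp add: 0)
  qed
  then show ?case using nn by (auto simp: reflect_apply[of u ?x] 0)
qed (simp add: simple_root_def)

text \<open>The other letters leave the coordinate of the first letter alone, so that letter must
  itself preserve it and thus fix the vector; then the remaining letters fix it too.\<close>

lemma foldr_reflect_fixed:
  assumes "distinct ws" "set ws \<subseteq> S" "foldr reflect ws x = x" "s \<in> set ws"
  shows "reflect s x = x"
  using assms
proof (induction ws)
  case (Cons u ws)
  let ?y = "foldr reflect ws x"
  have y: "reflect u ?y = x" using Cons.prems by simp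
  have "reflect u (reflect u ?y) = reflect u x" by (simp only: y)
  then have yx: "?y = reflect u x" using Cons.prems(2) by (metis reflect_reflect list.set_intros(1) subsetD)
  have "?y u = x u" using Cons.prems by (intro foldr_reflect_off) auto
  then have fu: "reflect u x = x" using yx by (auto simp: reflect_apply fun_eq_iff)
  then show ?case using yx Cons by auto
qed simp

end

section \<open>The periodic word and its sequence of reflections\<close>

locale coxeter_word_system = finite_coxeter_system +
  fixes c :: "'a list"
  assumes distinct_c: "distinct c" and set_c: "set c = S" and irreducible: "coxeter_irreducible G S"
begin

definition letter :: "nat \<Rightarrow> 'a" where "letter i = c ! (i mod length c)"

definition prefix :: "nat \<Rightarrow> 'a" where "prefix i = word_prod G (map letter [0..<i])"

text \<open>The reflection by which \<open>prefix (Suc i)\<close> differs from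
  \<open>prefix i\<close> on the left.\<close>

definition refl_at :: "nat \<Rightarrow> 'a" where "refl_at i = prefix i \<otimes> letter i \<otimes> inv (prefix i)"

definition root_at :: "nat \<Rightarrow> 'a \<Rightarrow> real" where "root_at i = act (prefix i) (simple_root (letter i))"

definition hits :: "'a \<Rightarrow> nat \<Rightarrow> nat" where "hits t i = card {j. j < i \<and> refl_at j = t}"

text \<open>Level l is designed to collect, within the word c c c ..., the positions of the l-th
  copy of a reduced word of \<open>w0\<close>.\<close>

definition level :: "nat \<Rightarrow> nat" where "level i = hits (refl_at i) i"

lemma c_nonempty [simp]: "c \<noteq> []"
  using irreducible set_c by (auto simp: coxeter_irreducible_def)

lemma length_c_pos: "0 < length c"
  by simp

lemma letter_in_S [simp, intro]: "letter i \<in> S"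
  unfolding letter_def set_c[symmetric] by (intro nth_mem) simp

lemma letters_subset [simp, intro]: "letter ` A \<subseteq> S"
  by auto

lemma prefix_carrier [simp, intro]: "prefix i \<in> carrier G"
  by (simp add: prefix_def)

lemma prefix_0 [simp]: "prefix 0 = \<one>"
  by (simp add: prefix_def)

lemma prefix_Suc: "prefix (Suc i) = prefix i \<otimes> letter i"
  by (simp add: prefix_def word_append)

lemma refl_at_carrier [simp, intro]: "refl_at i \<in> carrier G"
  by (simp add: refl_at_def)

lemma letter_add_period [simp]: "letter (i + length c) = letter i" "letter (length c + i) = letter i"
  by (simp_all add: letter_def)

lemma letter_eq_iff: "letter i = letter j \<longleftrightarrow> i mod length c = j mod length c"
  unfolding letter_def using distinct_c by (simp add: nth_eq_iff_index_eq)

lemma letter_window: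
  assumes "letter i = letter j" "i \<le> j" "j < i + length c" shows "i = j"
proof -
  have "length c dvd j - i" using assms by (metis letter_eq_iff mod_eq_dvd_iff_nat)
  moreover have "j - i < length c" using assms by simp
  ultimately have "j - i = 0" by (metis nat_dvd_not_less neq0_conv)
  then show ?thesis using assms by simp
qed

lemma rotate_c: "\<exists>w. rotate i c = letter i # w"
proof -
  have "hd (rotate i c) = letter i" by (simp add: hd_rotate_conv_nth c_nonempty letter_def)
  moreover have "rotate i c \<noteq> []" using c_nonempty by simp
  ultimately show ?thesis by (metis list.collapse)
qed

lemma inv_prefix_Suc_act: "act (inv (prefix (Suc i))) x = reflect (letter i) (act (inv (prefix i)) x)"
  by (simp add: prefix_Suc inv_mult_group act_mult act_simple)

lemma euler_prefix:
  "euler (rotate i c) (act (inv (prefix i)) x) (act (inv (prefix i)) y) = euler c x y"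
proof (induction i)
  case (Suc i)
  obtain w where w: "rotate i c = letter i # w" using rotate_c by blast
  have d: "distinct (letter i # w)" "set (letter i # w) = S"
    using distinct_c set_c by (metis w distinct_rotate) (metis w set_c set_rotate)
  have "rotate (Suc i) c = w @ [letter i]" using w by simp
  then show ?case
    using euler_rotate[OF d] Suc w by (simp add: inv_prefix_Suc_act)
qed simp

text \<open>The functional \<open>euler c (root_at i)\<close> depends on the position \<open>i\<close> only through the root, and up to
  sign only through the reflection \<open>refl_at i\<close>.\<close>

lemma euler_root_at: "euler c (root_at i) y = act (inv (prefix i)) y (letter i)"
proof -
  obtain w where w: "rotate i c = letter i # w" using rotate_c by blast
  then have d: "distinct (letter i # w)" using distinct_c by (metis distinct_rotate)
  have "euler c (root_at i) y = euler (letter i # w) (simple_root (letter i)) (act (inv (prefix i)) y)"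
    using euler_prefix[of i "root_at i" y] w by (simp add: root_at_def)
  then show ?thesis using euler_simple_root[OF d] by simp
qed

lemma hits_Suc: "hits t (Suc i) = hits t i + (if refl_at i = t then 1 else 0)"
proof -
  have "{j. j < Suc i \<and> refl_at j = t} = {j. j < i \<and> refl_at j = t} \<union> (if refl_at i = t then {i} else {})"
    by (auto simp: less_Suc_eq)
  then show ?thesis unfolding hits_def by (auto simp: card_insert_if)
qed

lemma hits_0 [simp]: "hits t 0 = 0"
  by (simp add: hits_def)

lemma hits_mono: "i \<le> j \<Longrightarrow> hits t i \<le> hits t j"
  unfolding hits_def by (intro card_mono) auto

lemma nonneg_uminus_root: "\<lbrakk>w \<in> carrier G; s \<in> S\<rbrakk> \<Longrightarrow>
    nonpos (act w (simple_root s)) \<longleftrightarrow> \<not> nonneg (act w (simple_root s))"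
  using root_sign act_simple_root_not_both by blast

text \<open>A simple reflection changes the sign of its own root only. Seen through
  \<open>prefix i\<close>, this happens exactly when \<open>refl_at i\<close> is the reflection of
  the given root, so the parity of the hits counts the sign changes.\<close>

lemma root_sign_along:
  assumes "w \<in> carrier G" "s \<in> S"
  shows "nonneg (act (inv (prefix i)) (act w (simple_root s))) \<longleftrightarrow>
    (nonneg (act w (simple_root s)) \<longleftrightarrow> even (hits (w \<otimes> s \<otimes> inv w) i))"
proof (induction i)
  case (Suc i)
  let ?v = "inv (prefix i) \<otimes> w" and ?t = "letter i" and ?r = "w \<otimes> s \<otimes> inv w"
  let ?y = "act ?v (simple_root s)"
  have v: "?v \<in> carrier G" and tv: "?t \<otimes> ?v \<in> carrier G" using assms by simp_all
  have y: "act (inv (prefix i)) (act w (simple_root s)) = ?y" using assms by (simp add: act_mult)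
  have y': "act (inv (prefix (Suc i))) (act w (simple_root s)) = reflect ?t ?y"
    unfolding inv_prefix_Suc_act y ..
  have y'': "reflect ?t ?y = act (?t \<otimes> ?v) (simple_root s)"
    using v by (simp add: act_mult[of ?t ?v] act_simple)
  have conj: "refl_at i = ?r \<longleftrightarrow> ?v \<otimes> s \<otimes> inv ?v = ?t"
  proof -
    have "?v \<otimes> s \<otimes> inv ?v = inv (prefix i) \<otimes> ?r \<otimes> prefix i"
      using assms by (simp add: inv_mult_group m_assoc)
    moreover have "inv (prefix i) \<otimes> refl_at i \<otimes> prefix i = ?t"
      by (simp add: refl_at_def m_assoc)
        (simp add: m_assoc[symmetric])
    moreover have "refl_at i = prefix i \<otimes> ?t \<otimes> inv (prefix i)" by (simp add: refl_at_def)
    moreover have "prefix i \<otimes> (inv (prefix i) \<otimes> ?r \<otimes> prefix i) \<otimes> inv (prefix i) = ?r"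
    proof -
      have rc: "?r \<in> carrier G" using assms by simp
      have "prefix i \<otimes> (inv (prefix i) \<otimes> ?r \<otimes> prefix i) \<otimes> inv (prefix i)
        = (prefix i \<otimes> inv (prefix i)) \<otimes> ?r \<otimes> (prefix i \<otimes> inv (prefix i))"
        using rc by (simp only: m_assoc m_closed inv_closed prefix_carrier)
      then show ?thesis using rc by simp
    qed
    ultimately show ?thesis by metis
  qed
  show ?case
  proof (cases "refl_at i = ?r")
    case True
    then have "?v \<otimes> s \<otimes> inv ?v = \<one> \<otimes> ?t \<otimes> inv \<one>" using conj by simp
    then have "?y = act \<one> (simple_root ?t) \<or> ?y = (\<lambda>u. - act \<one> (simple_root ?t) u)"
      using reflection_eq_iff[of ?v \<one> s ?t] v assms by blast
    moreover have "reflect ?t (simple_root ?t) = (\<lambda>u. - simple_root ?t u)"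
      by (auto simp: reflect_simple_root)
    moreover from this have "reflect ?t (\<lambda>u. - simple_root ?t u) = simple_root ?t"
      by (metis reflect_reflect letter_in_S)
    ultimately have "(?y = simple_root ?t \<and> reflect ?t ?y = (\<lambda>u. - simple_root ?t u)) \<or>
      (?y = (\<lambda>u. - simple_root ?t u) \<and> reflect ?t ?y = simple_root ?t)" by auto
    moreover have "nonneg (simple_root ?t)" by (simp add: simple_root_def)
    moreover have "\<not> nonneg (\<lambda>u. - simple_root ?t u)"
      by (auto simp: simple_root_def intro!: exI[of _ ?t])
    ultimately have "nonneg (reflect ?t ?y) \<longleftrightarrow> \<not> nonneg ?y" by metis
    then show ?thesis using Suc True unfolding y' y hits_Suc by auto
  next
    case False
    have "nonneg (reflect ?t ?y) \<longleftrightarrow> nonneg ?y"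
    proof (rule ccontr)
      assume a: "\<not> ?thesis"
      have "?y = simple_root ?t \<or> reflect ?t ?y = simple_root ?t"
      proof (cases "nonneg ?y")
        case True
        then have "nonpos (reflect ?t ?y)" using a nonneg_uminus_root[OF tv assms(2)] y'' by simp
        then show ?thesis using root_flip[OF v _ assms(2) True] by simp
      next
        case False
        then have "nonneg (act (?t \<otimes> ?v) (simple_root s))" using a y'' by simp
        moreover have "nonpos (reflect ?t (act (?t \<otimes> ?v) (simple_root s)))"
          unfolding y''[symmetric] using False nonneg_uminus_root[OF v assms(2)] by simp
        ultimately show ?thesis using root_flip[OF tv _ assms(2), of ?t] y'' by simp
      qed
      then have "?y = simple_root ?t \<or> ?y = (\<lambda>u. - simple_root ?t u)"
      proof
        assume "reflect ?t ?y = simple_root ?t"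
        then have "reflect ?t (reflect ?t ?y) = reflect ?t (simple_root ?t)" by simp
        then show ?thesis by (auto simp: reflect_simple_root)
      qed simp
      then have "?y = act \<one> (simple_root ?t) \<or> ?y = (\<lambda>u. - act \<one> (simple_root ?t) u)" by simp
      then have "?v \<otimes> s \<otimes> inv ?v = \<one> \<otimes> ?t \<otimes> inv \<one>"
        using reflection_eq_iff[of ?v \<one> s ?t] v assms by blast
      then show False using conj False by simp
    qed
    then show ?thesis using Suc False unfolding y' y hits_Suc by auto
  qed
qed simp

definition reflection :: "'a \<Rightarrow> bool" where
  "reflection t \<longleftrightarrow> (\<exists>w\<in>carrier G. \<exists>s\<in>S. t = w \<otimes> s \<otimes> inv w)"

lemma reflection_refl_at [simp]: "reflection (refl_at i)"
  unfolding reflection_def refl_at_def by blast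

lemma positive_root_exists:
  assumes "reflection t"
  obtains w s where "w \<in> carrier G" "s \<in> S" "t = w \<otimes> s \<otimes> inv w" "nonneg (act w (simple_root s))"
proof -
  obtain w s where ws: "w \<in> carrier G" "s \<in> S" "t = w \<otimes> s \<otimes> inv w"
    using assms by (auto simp: reflection_def)
  show thesis
  proof (cases "nonneg (act w (simple_root s))")
    case False
    then have "nonneg (act (w \<otimes> s) (simple_root s))"
      using nonneg_uminus_root[of w s] ws by (simp add: act_mult_simple_root)
    moreover have "t = (w \<otimes> s) \<otimes> s \<otimes> inv (w \<otimes> s)" using ws by (simp add: inv_mult_group m_assoc)
    ultimately show thesis using that[of "w \<otimes> s" s] ws by blast
  qed (use that ws in blast)
qed

text \<open>Pulled back to position i, \<open>root_at i\<close> is a simple root and hence positive.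
  The sign changes undergone so far by the positive root of the same reflection number
  \<open>level i\<close>.\<close>

lemma root_at_sign:
  assumes "w \<in> carrier G" "s \<in> S" "refl_at i = w \<otimes> s \<otimes> inv w" "nonneg (act w (simple_root s))"
  shows "root_at i = (\<lambda>u. (if even (level i) then 1 else -1) * act w (simple_root s) u)"
proof -
  let ?y = "act w (simple_root s)" and ?a = "simple_root (letter i)"
  have "root_at i = ?y \<or> root_at i = (\<lambda>u. - ?y u)"
    unfolding root_at_def using assms(3)
    by (subst reflection_eq_iff[symmetric]) (use assms in \<open>simp_all add: refl_at_def\<close>)
  moreover have a: "act (inv (prefix i)) (root_at i) = ?a" by (simp add: root_at_def)
  have sg: "nonneg (act (inv (prefix i)) ?y) \<longleftrightarrow> even (level i)"
    using root_sign_along[of w s i] assms by (simp add: level_def)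
  have na: "nonneg ?a" "?a (letter i) = 1" by (simp_all add: simple_root_def)
  have "even (level i)" if "root_at i = ?y" using a sg na unfolding that by simp
  moreover have "odd (level i)" if r: "root_at i = (\<lambda>u. - ?y u)"
  proof
    assume "even (level i)"
    then have "0 \<le> act (inv (prefix i)) ?y (letter i)" using sg by blast
    moreover have "- act (inv (prefix i)) ?y (letter i) = 1"
      using fun_cong[OF a, of "letter i"] na(2) unfolding r by (simp add: act_uminus)
    ultimately show False by linarith
  qed
  ultimately show ?thesis by auto
qed

lemma previous_hit:
  assumes "level j \<noteq> 0"
  obtains l where "l < j" "refl_at l = refl_at j" "level j = Suc (level l)"
proof -
  let ?A = "{l. l < j \<and> refl_at l = refl_at j}"
  have A: "finite ?A" "?A \<noteq> {}" using assms by (auto simp: level_def hits_def)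
  define l where "l = Max ?A"
  have l: "l < j" "refl_at l = refl_at j" using Max_in[OF A] by (auto simp: l_def)
  have "?A = insert l {k. k < l \<and> refl_at k = refl_at l}"
    using l Max_ge[OF A(1)] by (auto simp: l_def[symmetric] le_less)
  then have "level j = Suc (level l)" by (simp add: level_def hits_def)
  then show thesis using that l by blast
qed

text \<open>Interleaving: from one occurrence of the reflection of \<open>k\<close> to the next, the
  parity of its level changes. Since the Euler value has a fixed sign, the parity of the hits of the
  reflection of \<open>i\<close> must change too, so that reflection occurs in between. By induction
  its hits keep up with the level.\<close>

lemma level_le_if_euler_nonzero:
  assumes "k < i" "euler c (root_at k) (root_at i) \<noteq> 0"
  shows "level k \<le> level i"
proof -
  obtain w s where w: "w \<in> carrier G" "s \<in> S" "refl_at k = w \<otimes> s \<otimes> inv w" "nonneg (act w (simple_root s))"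
    using positive_root_exists[of "refl_at k"] by auto
  obtain v t where v: "v \<in> carrier G" "t \<in> S" "refl_at i = v \<otimes> t \<otimes> inv v" "nonneg (act v (simple_root t))"
    using positive_root_exists[of "refl_at i"] by auto
  let ?x = "act w (simple_root s)" and ?y = "act v (simple_root t)"
  define e where "e = euler c ?x ?y"
  have "e \<noteq> 0"
    using assms(2) unfolding root_at_sign[OF w] root_at_sign[OF v] euler_scale e_def by auto
  \<comment> \<open>At an occurrence \<open>j\<close> of the first reflection, one coordinate of the
    pulled back \<open>?y\<close> is \<open>e\<close> with the sign given by \<open>level j\<close>.
    Its sign is also known from \<open>root_sign_along\<close>, through the hits of the second
    reflection.\<close>
  have parity: "(even (level j) \<longleftrightarrow> even (hits (refl_at i) j)) \<longleftrightarrow> e > 0" if "refl_at j = refl_at k" for j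
  proof -
    have "refl_at j = w \<otimes> s \<otimes> inv w" using that w by simp
    note j = root_at_sign[OF w(1,2) this w(4)]
    have co: "act (inv (prefix j)) ?y (letter j) = (if even (level j) then 1 else -1) * e"
      using euler_root_at[of j ?y] euler_scale[of c "if even (level j) then 1 else -1" ?x 1 ?y]
      unfolding j e_def by simp
    have sg: "nonneg (act (inv (prefix j)) ?y) \<longleftrightarrow> even (hits (refl_at i) j)"
      using root_sign_along[of v t j] v by simp
    have "\<not> even (hits (refl_at i) j) \<Longrightarrow> nonpos (act (inv (prefix j)) ?y)"
      using sg nonneg_uminus_root[of "inv (prefix j) \<otimes> v" t] v by (simp add: act_mult)
    then have "if even (hits (refl_at i) j) then act (inv (prefix j)) ?y (letter j) \<ge> 0
      else act (inv (prefix j)) ?y (letter j) \<le> 0"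
      using sg by auto
    then show ?thesis unfolding co using \<open>e \<noteq> 0\<close>
      by (cases "even (hits (refl_at i) j)"; cases "even (level j)") auto
  qed
  have "refl_at j = refl_at k \<Longrightarrow> level j \<le> hits (refl_at i) j" for j
  proof (induction j rule: less_induct)
    case (less j)
    show ?case
    proof (cases "level j = 0")
      case False
      then obtain l where l: "l < j" "refl_at l = refl_at j" "level j = Suc (level l)"
        using previous_hit by blast
      then have "level l \<le> hits (refl_at i) l" using less by auto
      moreover have "hits (refl_at i) l \<le> hits (refl_at i) j" using l by (intro hits_mono) simp
      moreover have "hits (refl_at i) l \<noteq> hits (refl_at i) j"
        using parity[of l] parity[of j] l less.prems by auto
      ultimately show ?thesis using l by simp
    qed simp
  qed
  then have "level k \<le> hits (refl_at i) k" by simp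
  also have "\<dots> \<le> level i" unfolding level_def using assms(1) by (intro hits_mono) simp
  finally show ?thesis .
qed

lemma act_prefix_diff:
  assumes "k \<le> i" shows "act (inv (prefix k)) (act (prefix i) x) = foldr reflect (map letter [k..<i]) x"
proof -
  have "[0..<i] = [0..<k] @ [k..<i]" using assms by (metis upt_add_eq_append le_add_diff_inverse zero_le)
  then have "prefix i = prefix k \<otimes> word_prod G (map letter [k..<i])"
    by (simp add: prefix_def word_append)
  then have "act (prefix i) x = act (prefix k) (foldr reflect (map letter [k..<i]) x)"
    by (simp add: act_mult act_word)
  then show ?thesis by simp
qed

text \<open>Within one copy of the word the Euler value is minus the pairing of a nonnegative vector
  with the simple root at \<open>k\<close>. All terms of that pairing are nonpositive, and the one
  at the letter of \<open>i\<close> has coefficient 1 and is strictly negative.\<close>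

lemma level_mono_near:
  assumes "k < i" "i < k + length c" "letter k \<otimes> letter i \<noteq> letter i \<otimes> letter k"
  shows "level k \<le> level i"
proof (rule level_le_if_euler_nonzero[OF assms(1)])
  let ?u = "letter k" and ?s = "letter i" and ?ws = "map letter [Suc k..<i]"
  let ?x = "foldr reflect ?ws (simple_root ?s)"
  have "inj_on letter {k..i}"
  proof (rule linorder_inj_onI)
    fix a b assume "a < b" "a \<in> {k..i}" "b \<in> {k..i}"
    then show "letter a \<noteq> letter b" using letter_window[of a b] assms(2) by auto
  qed auto
  then have inj: "\<And>a b. \<lbrakk>letter a = letter b; k \<le> a; a \<le> i; k \<le> b; b \<le> i\<rbrakk> \<Longrightarrow> a = b"
    by (auto simp: inj_on_def)
  have d: "distinct ?ws" by (auto simp: distinct_map intro!: inj_onI inj)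
  have s: "?s \<notin> set ?ws"
  proof
    assume "?s \<in> set ?ws"
    then obtain a where a: "letter i = letter a" "Suc k \<le> a" "a < i" by auto
    then have "i = a" using assms(1) by (intro inj) auto
    then show False using a by simp
  qed
  have u: "?u \<notin> set ?ws"
  proof
    assume "?u \<in> set ?ws"
    then obtain a where a: "letter k = letter a" "Suc k \<le> a" "a < i" by auto
    then have "k = a" using assms(1) by (intro inj) auto
    then show False using a by simp
  qed
  have us: "?u \<noteq> ?s" using assms(3) by auto
  have nn: "nonneg ?x" using d s by (intro foldr_reflect_simple_root) auto
  have xu: "?x u' = simple_root ?s u'" if "u' \<notin> set ?ws" for u' using that by (rule foldr_reflect_off)
  have "euler c (root_at k) (root_at i) = foldr reflect (map letter [k..<i]) (simple_root ?s) ?u"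
    unfolding euler_root_at unfolding root_at_def using act_prefix_diff assms(1) by simp
  also have "\<dots> = reflect ?u ?x ?u" using assms(1) by (simp add: upt_conv_Cons)
  also have "\<dots> = - pairing ?x ?u" using xu[OF u] us by (simp add: reflect_apply simple_root_def)
  finally have eq: "euler c (root_at k) (root_at i) = - pairing ?x ?u" .
  have terms: "?x t * cartan t ?u \<le> 0" if "t \<in> S" for t
  proof (cases "t = ?u")
    case True
    then show ?thesis using xu[OF u] us by (simp add: simple_root_def)
  next
    case False
    then show ?thesis using nn cartan_nonpos[of t ?u] that by (auto intro: mult_nonneg_nonpos)
  qed
  have "pairing ?x ?u = ?x ?s * cartan ?s ?u + (\<Sum>t\<in>S - {?s}. ?x t * cartan t ?u)"
    unfolding pairing_def by (rule sum.remove) auto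
  also have "\<dots> \<le> ?x ?s * cartan ?s ?u + 0" using terms by (intro add_left_mono sum_nonpos) auto
  also have "\<dots> = cartan ?s ?u" using xu[OF s] by (simp add: simple_root_def)
  also have "\<dots> < 0" using assms(3) by (intro cartan_neg) auto
  finally show "euler c (root_at k) (root_at i) \<noteq> 0" using eq by simp
qed

end

context coxeter_word_system
begin

lemma level_mono:
  assumes "k < i" "letter k \<otimes> letter i \<noteq> letter i \<otimes> letter k"
  shows "level k \<le> level i"
  using assms
proof (induction i rule: less_induct)
  case (less i)
  let ?r = "length c"
  show ?case
  proof (cases "i < k + ?r")
    case False
    then obtain j where i: "i = j + ?r" "k \<le> j"
        by (metis add.commute add_leD1 le_add_diff_inverse2 nat_add_left_cancel_le not_less)
    have "k \<noteq> j" using less.prems i by auto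
    then have kj: "k < j" using i by simp
    have "level k \<le> level j" using less.IH[of j] kj less.prems i length_c_pos by simp
    \<comment> \<open>The last position before \<open>i\<close> with the same letter as
      \<open>k\<close>. It lies strictly between \<open>j\<close> and \<open>i\<close>, so both
      remaining comparisons span less than one copy of \<open>c\<close>.\<close>
    define l where "l = i - (i - k) mod ?r"
    have "(i - k) mod ?r < ?r" "(i - k) mod ?r \<le> i - k" by simp_all
    then have l1: "i - l < ?r" "l \<le> i" unfolding l_def by linarith+
    have "l mod ?r = k mod ?r"
    proof -
      have "i - k = ?r * ((i - k) div ?r) + (i - k) mod ?r" by simp
      then have "l = k + ?r * ((i - k) div ?r)" using less.prems(1) unfolding l_def by linarith
      then show ?thesis by simp
    qed
    then have lk: "letter l = letter k" by (simp add: letter_eq_iff)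
    have "l \<noteq> i" using lk less.prems by auto
    then have l2: "l < i" "j < l" "l < j + ?r" "i < l + ?r" using l1 i by linarith+
    have "level j \<le> level l"
      using l2 less.prems i lk by (intro level_mono_near) auto
    moreover have "level l \<le> level i"
      using l2 less.prems lk by (intro level_mono_near) auto
    ultimately show ?thesis using \<open>level k \<le> level j\<close> by simp
  qed (use level_mono_near less.prems in blast)
qed

section \<open>Equal distribution of the reflections over one period\<close>

definition coxeter_elt :: 'a where "coxeter_elt = word_prod G c"

abbreviation coxeter_number :: nat where "coxeter_number \<equiv> ord coxeter_elt"

lemma coxeter_elt_carrier [simp, intro]: "coxeter_elt \<in> carrier G"
  using set_c by (auto simp: coxeter_elt_def)

lemma coxeter_number_pos: "coxeter_number > 0"
  using ord_ge_1[OF finite_carrier coxeter_elt_carrier] by simp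

lemma map_letter_first: "map letter [0..<length c] = c"
  by (rule nth_equalityI) (auto simp: letter_def)

lemma map_letter_add: "map letter [0..<length c + i] = c @ map letter [0..<i]"
proof (induction i)
  case 0
  then show ?case by (simp only: add_0_right map_letter_first) simp
next
  case (Suc i)
  then show ?case by simp
qed

lemma map_letter_word_power: "map letter [0..<length c * m] = word_power c m"
proof (induction m)
  case (Suc m)
  then show ?case using map_letter_add[of "length c * m"] by (simp add: word_power_def)
qed (simp add: word_power_def)

lemma prefix_add: "prefix (length c + i) = coxeter_elt \<otimes> prefix i"
  using set_c by (simp add: prefix_def map_letter_add word_append coxeter_elt_def)

lemma coxeter_elt_pow_Suc: "coxeter_elt [^] Suc m = coxeter_elt \<otimes> coxeter_elt [^] m"
  by (rule nat_pow_Suc2) simp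

lemma prefix_mult: "prefix (length c * m) = coxeter_elt [^] m"
proof (induction m)
  case (Suc m)
  then show ?case using prefix_add[of "length c * m"] unfolding coxeter_elt_pow_Suc by simp
qed simp

lemma refl_at_add: "refl_at (length c + i) = coxeter_elt \<otimes> refl_at i \<otimes> inv coxeter_elt"
  by (simp add: refl_at_def prefix_add inv_mult_group m_assoc)

definition period :: nat where "period = length c * coxeter_number"

lemma period_pos: "period > 0"
  using coxeter_number_pos by (simp add: period_def)

lemma prefix_add_mult: "prefix (length c * m + i) = coxeter_elt [^] m \<otimes> prefix i"
proof (induction m)
  case (Suc m)
  then show ?case using prefix_add[of "length c * m + i"] unfolding coxeter_elt_pow_Suc
    by (simp add: m_assoc add.assoc)
qed simp

lemma prefix_add_period [simp]: "prefix (period + i) = prefix i"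
  using prefix_add_mult[of coxeter_number i] pow_ord_eq_1[OF coxeter_elt_carrier] by (simp add: period_def)

lemma prefix_period: "prefix period = \<one>"
  using prefix_add_period[of 0] by simp

lemma letter_add_mult: "letter (length c * m + i) = letter i"
  by (simp add: letter_def)

lemma refl_at_add_period [simp]: "refl_at (period + i) = refl_at i"
  by (simp add: refl_at_def) (simp add: period_def letter_add_mult)

lemma hits_shift:
  assumes inj: "\<And>j. refl_at (n + j) = t' \<longleftrightarrow> refl_at j = t"
  shows "hits t' (n + i) = hits t' n + hits t i"
proof (induction i)
  case (Suc i)
  then show ?case using inj[of i] by (simp add: hits_Suc)
qed simp

lemma hits_add_period: "hits t (period + i) = hits t period + hits t i"
  by (rule hits_shift) simp

text \<open>Passing over one copy of \<open>c\<close> conjugates the sequence of reflections, and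
  the number of hits in a window of full period does not depend on where the window starts.\<close>

lemma hits_conj_coxeter:
  assumes "t \<in> carrier G"
  shows "hits (coxeter_elt \<otimes> t \<otimes> inv coxeter_elt) period = hits t period"
proof -
  let ?t = "coxeter_elt \<otimes> t \<otimes> inv coxeter_elt"
  have "refl_at (length c + j) = ?t \<longleftrightarrow> refl_at j = t" for j
    unfolding refl_at_add using assms by (metis conjugation_is_inj refl_at_carrier coxeter_elt_carrier)
  then have "hits ?t (length c + period) = hits ?t (length c) + hits t period" by (rule hits_shift)
  moreover have "hits ?t (length c + period) = hits ?t period + hits ?t (length c)"
    using hits_add_period[of ?t "length c"] by (simp add: add.commute)
  ultimately show ?thesis by simp
qed

lemma level_add_period: "level (period * b + i) = b * hits (refl_at i) period + level i"
proof (induction b)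
  case (Suc b)
  have "refl_at (period * b + i) = refl_at i"
    by (induction b) (simp_all add: add.assoc)
  then show ?case
    using Suc hits_add_period[of "refl_at i" "period * b + i"] refl_at_add_period[of "period * b + i"]
    by (simp add: level_def add.assoc)
qed simp

text \<open>By \<open>level_add_period\<close> the level grows linearly in the number of periods,
  with slope the hits per period. As \<open>level_mono\<close> holds at arbitrarily distant
  positions, a larger slope at \<open>k\<close> would violate it for large \<open>b\<close>. The
  shift by \<open>Suc k\<close> periods only ensures that the position of \<open>i\<close> is the
  later one.\<close>

lemma hits_period_le:
  assumes "letter k \<otimes> letter i \<noteq> letter i \<otimes> letter k"
  shows "hits (refl_at k) period \<le> hits (refl_at i) period"
proof (rule ccontr)
  assume "\<not> ?thesis"
  then have gt: "hits (refl_at k) period \<ge> hits (refl_at i) period + 1" by simp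
  have le: "b * hits (refl_at k) period + level k \<le> (b + Suc k) * hits (refl_at i) period + level i" for b
  proof -
    have "period * b + k < period * (b + Suc k) + i"
    proof -
      have "1 * Suc k \<le> period * Suc k" using period_pos by (intro mult_le_mono1) simp
      then show ?thesis by (simp add: algebra_simps)
    qed
    moreover have l: "letter (period * m + j) = letter j" for m j
      unfolding period_def mult.assoc by (rule letter_add_mult)
    ultimately have "level (period * b + k) \<le> level (period * (b + Suc k) + i)"
      using assms by (intro level_mono) (simp_all only: l not_False_eq_True)
    then show ?thesis unfolding level_add_period .
  qed
  define b where "b = Suc k * hits (refl_at i) period + level i + 1"
  have "b * (hits (refl_at i) period + 1) \<le> b * hits (refl_at k) period" using gt by (intro mult_le_mono2)
  then have "b * hits (refl_at i) period + b \<le> (b + Suc k) * hits (refl_at i) period + level i"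
    using le[of b] by simp
  then show False by (simp add: b_def algebra_simps)
qed

lemma hits_period_letter:
  assumes "letter k = letter i" shows "hits (refl_at k) period = hits (refl_at i) period"
proof -
  have step: "hits (refl_at (length c * m + i)) period = hits (refl_at i) period" for m i
  proof (induction m)
    case (Suc m)
    have "refl_at (length c * Suc m + i) = coxeter_elt \<otimes> refl_at (length c * m + i) \<otimes> inv coxeter_elt"
      using refl_at_add[of "length c * m + i"] by (simp add: add.assoc)
    then show ?case using Suc hits_conj_coxeter[of "refl_at (length c * m + i)"] by simp
  qed simp
  have "hits (refl_at j) period = hits (refl_at (j mod length c)) period" for j
    using step[of "j div length c" "j mod length c"] by simp
  then show ?thesis using assms by (metis letter_eq_iff)
qed

lemma letter_surj: "s \<in> S \<Longrightarrow> \<exists>i < length c. letter i = s"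
  unfolding set_c[symmetric] in_set_conv_nth letter_def by auto

text \<open>Noncommuting letters give the inequality in both directions, and the Coxeter graph is
  connected: this is where irreducibility enters.\<close>

lemma hits_period_const: "hits (refl_at k) period = hits (refl_at i) period"
proof -
  have "(letter k, letter i) \<in> (coxeter_graph G S)\<^sup>*"
    using irreducible by (simp add: coxeter_irreducible_def)
  then have "\<forall>j. letter j = letter i \<longrightarrow> hits (refl_at k) period = hits (refl_at j) period"
  proof (induction rule: rtrancl_induct)
    case base
    then show ?case using hits_period_letter by metis
  next
    case (step s t)
    have st: "s \<in> S" "t \<in> S" "s \<noteq> t" "coxeter_m G s t \<noteq> 2" using step by (auto simp: coxeter_graph_def)
    then have nc: "s \<otimes> t \<noteq> t \<otimes> s" using m_2_if_commute by blast
    obtain a where a: "letter a = s" using letter_surj st by blast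
    show ?case
    proof (intro allI impI)
      fix j assume j: "letter j = t"
      have "hits (refl_at a) period = hits (refl_at j) period"
        using hits_period_le[of a j] hits_period_le[of j a] a j nc by fastforce
      then show "hits (refl_at k) period = hits (refl_at j) period" using step.IH a by simp
    qed
  qed
  then show ?thesis by blast
qed

text \<open>This will be the number of copies of the longest element contained in the h-th power of
  \<open>c\<close>.\<close>

definition twists :: nat where "twists = hits (refl_at 0) period"

lemma hits_period: "hits (refl_at i) period = twists"
  unfolding twists_def by (rule hits_period_const)

lemma level_less_twists: assumes "i < period" shows "level i < twists"
proof -
  have "level i < hits (refl_at i) (Suc i)" by (simp add: level_def hits_Suc)
  also have "\<dots> \<le> hits (refl_at i) period" using assms by (intro hits_mono) simp
  finally show ?thesis by (simp add: hits_period)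
qed

lemma level_inj: assumes "refl_at i = refl_at j" "level i = level j" shows "i = j"
proof (rule ccontr)
  have less: "level i < level j" if "i < j" "refl_at i = refl_at j" for i j
  proof -
    have "level i < hits (refl_at i) (Suc i)" by (simp add: level_def hits_Suc)
    also have "\<dots> \<le> hits (refl_at i) j" using that by (intro hits_mono) simp
    finally show ?thesis using that by (simp add: level_def)
  qed
  assume "i \<noteq> j"
  then show False using less[of i j] less[of j i] assms by (metis less_irrefl linorder_neqE_nat)
qed

text \<open>The \<open>twists\<close> occurrences of a reflection in one period have distinct
  levels, all below \<open>twists\<close>.\<close>

lemma level_surj:
  assumes "m < twists" shows "\<exists>j < period. refl_at j = refl_at i \<and> level j = m"
proof -
  let ?A = "{j. j < period \<and> refl_at j = refl_at i}"
  have "card (level ` ?A) = card ?A" by (rule card_image) (auto intro!: inj_onI level_inj)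
  also have "\<dots> = twists" using hits_period[of i] by (simp add: hits_def)
  finally have "level ` ?A = {..<twists}"
    using level_less_twists by (intro card_subset_eq) auto
  then have "m \<in> level ` ?A" using assms by simp
  then show ?thesis by auto
qed

text \<open>Otherwise the sum over the orbit of a root under the Coxeter element would be a nonzero
  nonnegative vector fixed by the whole group, contradicting the longest element.\<close>

lemma reflection_occurs:
  assumes "reflection t" shows "\<exists>j < period. refl_at j = t"
proof (rule ccontr)
  assume no: "\<not> ?thesis"
  have "refl_at j \<noteq> t" for j
  proof -
    have "refl_at j = refl_at (j mod period)"
    proof -
      have "refl_at (period * m + i) = refl_at i" for m i
        by (induction m) (simp_all add: add.assoc)
      from this[of "j div period" "j mod period"] show ?thesis by simp
    qed
    then show ?thesis using no period_pos by (metis mod_less_divisor)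
  qed
  then have h0: "hits t i = 0" for i by (simp add: hits_def)
  obtain w s where w: "w \<in> carrier G" "s \<in> S" "t = w \<otimes> s \<otimes> inv w" "nonneg (act w (simple_root s))"
    using positive_root_exists[OF assms] by blast
  let ?y = "act w (simple_root s)" and ?h = coxeter_number and ?g = coxeter_elt
  have "nonneg (act (inv (prefix i)) ?y)" for i
    using root_sign_along[OF w(1,2), of i] w h0 by simp
  then have nn: "nonneg (act (inv (?g [^] m)) ?y)" for m :: nat
    using prefix_mult[of m] by metis
  define x where "x = (\<lambda>u. \<Sum>m<?h. 1 * act (inv (?g [^] m)) ?y u)"
  have nnx: "nonneg x" using nn by (auto simp: x_def intro!: sum_nonneg)
  have yx: "?y u \<le> x u" for u
  proof -
    have "act (inv (?g [^] (0::nat))) ?y u \<le> (\<Sum>m<?h. act (inv (?g [^] m)) ?y u)"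
      using coxeter_number_pos nn by (intro member_le_sum) auto
    then show ?thesis by (simp add: x_def)
  qed
  have sx: "supported x"
  proof -
    have "supported (act (inv (?g [^] m)) ?y)" for m :: nat
      using supported_act supported_simple_root w by simp
    then show ?thesis by (simp add: supported_def x_def)
  qed
  have "act (inv ?g) x = x"
  proof -
    have "act (inv ?g) x = (\<lambda>u. \<Sum>m<?h. 1 * act (inv ?g) (act (inv (?g [^] m)) ?y) u)"
      unfolding x_def by (rule act_sum) simp
    also have "\<dots> = (\<lambda>u. \<Sum>m<?h. act (inv (?g [^] Suc m)) ?y u)"
      by (simp add: act_mult inv_mult_group)
    also have "\<dots> = x"
    proof
      fix u
      let ?f = "\<lambda>m::nat. act (inv (?g [^] m)) ?y u"
      have "(\<Sum>m<?h. ?f (Suc m)) + ?f 0 = (\<Sum>m<?h. ?f m) + ?f ?h"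
        using sum.lessThan_Suc_shift[of ?f ?h] by simp
      moreover have "?f ?h = ?f 0" using pow_ord_eq_1[OF coxeter_elt_carrier] by simp
      ultimately show "(\<Sum>m<?h. act (inv (?g [^] Suc m)) ?y u) = x u" by (simp add: x_def)
    qed
    finally show ?thesis .
  qed
  then have "act ?g (act (inv ?g) x) = act ?g x" by simp
  then have gx: "foldr reflect c x = x"
    using set_c act_word[of c x] by (simp add: coxeter_elt_def[symmetric])
  have fix_s: "reflect s x = x" if "s \<in> S" for s
    using foldr_reflect_fixed[of c x s] distinct_c set_c gx that by simp
  have "foldr reflect xs x = x" if "set xs \<subseteq> S" for xs
    using that by (induction xs) (auto simp: fix_s)
  then have "act w0 x = x" using act_word[OF w0_word(1), of x] w0_word by simp
  then have "nonpos x" using longest_nonpos[OF longest_w0 sx nnx] by simp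
  then have "nonpos ?y" using yx order_trans by blast
  then show False using act_simple_root_not_both[OF w(1,4)] by blast
qed

subsection \<open>Sorting by level\<close>

text \<open>Words are represented by lists of positions, so that a letter keeps its level and its
  reflection while it is moved.\<close>

inductive swap :: "nat list \<Rightarrow> nat list \<Rightarrow> bool" where
  swap: "letter i \<otimes> letter j = letter j \<otimes> letter i \<Longrightarrow> swap (xs @ i # j # ys) (xs @ j # i # ys)"

lemma swap_append: "swap xs ys \<Longrightarrow> swap (us @ xs @ vs) (us @ ys @ vs)"
proof (induction rule: swap.induct)
  case (swap i j xs ys)
  then show ?case using swap.intros[of i j "us @ xs" "ys @ vs"] by simp
qed

lemma swaps_append: "swap\<^sup>*\<^sup>* xs ys \<Longrightarrow> swap\<^sup>*\<^sup>* (us @ xs @ vs) (us @ ys @ vs)"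
  by (induction rule: rtranclp_induct) (auto intro: swap_append rtranclp.rtrancl_into_rtrancl)

lemma swaps_move:
  "(\<And>y. y \<in> set A \<Longrightarrow> letter x \<otimes> letter y = letter y \<otimes> letter x) \<Longrightarrow> swap\<^sup>*\<^sup>* (x # A @ B) (A @ x # B)"
proof (induction A)
  case (Cons y A)
  have "swap (x # y # A @ B) (y # x # A @ B)" using swap.intros[of x y "[]" "A @ B"] Cons by simp
  moreover have "swap\<^sup>*\<^sup>* (y # x # A @ B) (y # A @ x # B)"
    using swaps_append[of "x # A @ B" "A @ x # B" "[y]" "[]"] Cons by simp
  ultimately show ?case by simp
qed simp

definition blocks :: "nat \<Rightarrow> nat list \<Rightarrow> nat list" where
  "blocks m xs = concat (map (\<lambda>l. filter (\<lambda>i. level i = l) xs) [0..<m])"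

text \<open>A stable insertion sort. A position has to pass only later positions of smaller level,
  and by \<open>level_mono\<close> their letters commute with its own.\<close>

lemma swaps_blocks:
  assumes "sorted_wrt (<) xs" "\<And>i. i \<in> set xs \<Longrightarrow> level i < m"
  shows "swap\<^sup>*\<^sup>* xs (blocks m xs)"
  using assms
proof (induction xs)
  case Nil
  have "blocks m [] = []" by (induction m) (simp_all add: blocks_def)
  then show ?case by simp
next
  case (Cons x xs)
  let ?l = "level x"
  let ?F = "\<lambda>xs l. filter (\<lambda>i. level i = l) xs"
  have l: "[0..<m] = [0..<?l] @ ?l # [Suc ?l..<m]"
    using Cons.prems(2)[of x] upt_add_eq_append[of 0 ?l "m - ?l"] upt_conv_Cons[of ?l m] by simp
  define A where "A = concat (map (?F xs) [0..<?l])"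
  define B where "B = concat (map (?F xs) [Suc ?l..<m])"
  have b: "blocks m xs = A @ ?F xs ?l @ B" by (simp add: blocks_def l A_def B_def)
  have eqA: "concat (map (?F (x # xs)) [0..<?l]) = A"
    unfolding A_def by (intro arg_cong[of _ _ concat] map_cong) auto
  have eqB: "concat (map (?F (x # xs)) [Suc ?l..<m]) = B"
    unfolding B_def by (intro arg_cong[of _ _ concat] map_cong) auto
  have b': "blocks m (x # xs) = A @ x # ?F xs ?l @ B"
    unfolding blocks_def l map_append concat_append eqA list.map concat.simps eqB by simp
  have "swap\<^sup>*\<^sup>* (x # xs) (x # blocks m xs)"
    using swaps_append[of xs "blocks m xs" "[x]" "[]"] Cons by simp
  also have "swap\<^sup>*\<^sup>* (x # blocks m xs) (blocks m (x # xs))"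
    unfolding b b'
  proof (rule swaps_move)
    fix y assume "y \<in> set A"
    then have y: "y \<in> set xs" "level y < ?l" by (auto simp: A_def)
    then have "x < y" using Cons.prems by simp
    then show "letter x \<otimes> letter y = letter y \<otimes> letter x" using level_mono[of x y] y(2) by linarith
  qed
  finally show ?case .
qed

text \<open>The invariant of the sorting: even after rearrangement, each letter contributes the
  reflection it had originally. Exchanging commuting neighbours does not disturb this.\<close>

fun labelled :: "'a \<Rightarrow> nat list \<Rightarrow> bool" where
  "labelled g [] \<longleftrightarrow> True"
| "labelled g (i # xs) \<longleftrightarrow> g \<otimes> letter i \<otimes> inv g = refl_at i \<and> labelled (g \<otimes> letter i) xs"

lemma labelled_append:
  "g \<in> carrier G \<Longrightarrow> labelled g (xs @ ys) \<longleftrightarrow> labelled g xs \<and> labelled (g \<otimes> word_prod G (map letter xs)) ys"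
  by (induction xs arbitrary: g) (auto simp: m_assoc)

lemma labelled_upt: "labelled \<one> [0..<n]"
  by (induction n) (auto simp: labelled_append refl_at_def prefix_def)

lemma swap_labelled: "swap xs ys \<Longrightarrow> g \<in> carrier G \<Longrightarrow> labelled g xs \<Longrightarrow> labelled g ys"
proof (induction rule: swap.induct)
  case (swap i j xs ys)
  define k where "k = g \<otimes> word_prod G (map letter xs)"
  have k: "k \<in> carrier G" using swap.prems by (simp add: k_def)
  have l: "labelled g xs" "labelled k (i # j # ys)"
    using swap.prems labelled_append[of g xs] by (simp_all add: k_def)
  have "k \<otimes> letter j \<otimes> inv k = (k \<otimes> letter i) \<otimes> letter j \<otimes> inv (k \<otimes> letter i)"
  proof -
    have "(k \<otimes> letter i) \<otimes> letter j \<otimes> inv (k \<otimes> letter i) = k \<otimes> (letter i \<otimes> letter j) \<otimes> letter i \<otimes> inv k"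
      using k by (simp add: inv_mult_group m_assoc)
    also have "\<dots> = k \<otimes> letter j \<otimes> inv k" unfolding swap.hyps using k by (simp add: m_assoc)
    finally show ?thesis by simp
  qed
  moreover have "k \<otimes> letter i \<otimes> inv k = (k \<otimes> letter j) \<otimes> letter i \<otimes> inv (k \<otimes> letter j)"
  proof -
    have "(k \<otimes> letter j) \<otimes> letter i \<otimes> inv (k \<otimes> letter j) = k \<otimes> (letter j \<otimes> letter i) \<otimes> letter j \<otimes> inv k"
      using k by (simp add: inv_mult_group m_assoc)
    also have "\<dots> = k \<otimes> letter i \<otimes> inv k" unfolding swap.hyps[symmetric] using k by (simp add: m_assoc)
    finally show ?thesis by simp
  qed
  moreover have "k \<otimes> letter i \<otimes> letter j = k \<otimes> letter j \<otimes> letter i"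
    using k swap.hyps by (simp add: m_assoc)
  ultimately have "labelled k (j # i # ys)" using l by simp
  then show ?case using l labelled_append[of g xs] swap.prems by (simp add: k_def)
qed

lemma swap_word_prod: "swap xs ys \<Longrightarrow> word_prod G (map letter xs) = word_prod G (map letter ys)"
proof (induction rule: swap.induct)
  case (swap i j xs ys)
  have "letter i \<otimes> (letter j \<otimes> word_prod G (map letter ys))
      = letter j \<otimes> (letter i \<otimes> word_prod G (map letter ys))"
    using swap by (simp add: m_assoc[symmetric])
  then show ?case by (simp add: word_append)
qed

lemma swap_hecke:
  "swap xs ys \<Longrightarrow> v \<in> carrier G \<Longrightarrow>
    foldr (hecke z) (map letter xs) f v = foldr (hecke z) (map letter ys) f v"
proof (induction rule: swap.induct)
  case (swap i j xs ys)
  have "foldr (hecke z) (map letter xs) (hecke z (letter i) (hecke z (letter j) (foldr (hecke z) (map letter ys) f))) v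
    = foldr (hecke z) (map letter xs) (hecke z (letter j) (hecke z (letter i) (foldr (hecke z) (map letter ys) f))) v"
    using swap by (intro foldr_hecke_cong hecke_commute) auto
  then show ?case by simp
qed

lemma swaps_labelled: "swap\<^sup>*\<^sup>* xs ys \<Longrightarrow> g \<in> carrier G \<Longrightarrow> labelled g xs \<Longrightarrow> labelled g ys"
  by (induction rule: rtranclp_induct) (auto intro: swap_labelled)

lemma swaps_word_prod: "swap\<^sup>*\<^sup>* xs ys \<Longrightarrow> word_prod G (map letter xs) = word_prod G (map letter ys)"
  by (induction rule: rtranclp_induct) (auto dest: swap_word_prod)

lemma swaps_hecke:
  "swap\<^sup>*\<^sup>* xs ys \<Longrightarrow> v \<in> carrier G \<Longrightarrow>
    foldr (hecke z) (map letter xs) f v = foldr (hecke z) (map letter ys) f v"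
  by (induction rule: rtranclp_induct) (auto dest: swap_hecke)

lemma labelled_split:
  assumes "g \<in> carrier G" "labelled g (A @ j # B)"
  shows "refl_at j = g \<otimes> (word_prod G (map letter A) \<otimes> letter j \<otimes> inv (word_prod G (map letter A))) \<otimes> inv g"
proof -
  have "refl_at j = (g \<otimes> word_prod G (map letter A)) \<otimes> letter j \<otimes> inv (g \<otimes> word_prod G (map letter A))"
    using assms by (simp add: labelled_append)
  then show ?thesis using assms by (simp add: inv_mult_group m_assoc)
qed

text \<open>If appending a letter shortened the product, the exchange condition would provide an
  earlier letter with the same reflection.\<close>

lemma labelled_reduced:
  assumes "g \<in> carrier G" "labelled g L" "distinct (map refl_at L)"
  shows "len (word_prod G (map letter L)) = length L"
  using assms(2,3)
proof (induction L rule: rev_induct)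
  case (snoc i L)
  let ?x = "word_prod G (map letter L)"
  have x: "?x \<in> carrier G" by simp
  have IH: "len ?x = length L" using snoc assms(1) by (simp add: labelled_append)
  have "\<not> len (?x \<otimes> letter i) < len ?x"
  proof
    assume d: "len (?x \<otimes> letter i) < len ?x"
    have nn: "nonneg (foldr reflect (rev (map letter L)) (act ?x (simple_root (letter i))))"
      using act_word[of "map letter L" "simple_root (letter i)"]
        foldr_reflect_rev[of "map letter L" "simple_root (letter i)"] by (simp add: simple_root_def)
    obtain as b bs where ab: "map letter L = as @ b # bs"
      "word_prod G as \<otimes> b \<otimes> inv (word_prod G as) = ?x \<otimes> letter i \<otimes> inv ?x"
      using exchange[of "map letter L" ?x "letter i"] descent_nonpos[OF x _ d] nn by auto
    then obtain A j B where L: "L = A @ j # B" "as = map letter A" "b = letter j"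
      by (auto simp: map_eq_append_conv Cons_eq_map_conv map_eq_Cons_conv)
    have "refl_at j = g \<otimes> (?x \<otimes> letter i \<otimes> inv ?x) \<otimes> inv g"
      using labelled_split[of g A j "B @ [i]"] snoc.prems(1) assms(1) L ab by simp
    moreover have "refl_at i = g \<otimes> (?x \<otimes> letter i \<otimes> inv ?x) \<otimes> inv g"
      using labelled_split[of g L i "[]"] snoc.prems(1) assms(1) by simp
    ultimately show False using snoc.prems(2) L by simp
  qed
  then show ?case using len_mult_simple[OF x, of "letter i"] IH by (auto simp: word_append)
qed simp

text \<open>For each simple \<open>s\<close> the reflection of \<open>s\<close> after the last
  letter is already carried by some letter of the list. Multiplying by \<open>s\<close> deletes that
  letter, so every \<open>s\<close> is a descent.\<close>

lemma labelled_longest: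
  assumes "g \<in> carrier G" "labelled g L" "distinct (map refl_at L)"
    and all: "\<And>t. reflection t \<Longrightarrow> t \<in> refl_at ` set L"
  shows "word_prod G (map letter L) = w0"
proof (rule longest_eq_w0)
  let ?x = "word_prod G (map letter L)"
  have x: "?x \<in> carrier G" by simp
  have lx: "len ?x = length L" using labelled_reduced assms by blast
  show "longest ?x" unfolding longest_def
  proof (intro conjI ballI x)
    fix s assume s: "s \<in> S"
    let ?t = "?x \<otimes> s \<otimes> inv ?x"
    have "reflection (g \<otimes> ?t \<otimes> inv g)"
      unfolding reflection_def
      by (rule bexI[of _ "g \<otimes> ?x"], rule bexI[of _ s]) (use assms(1) s in \<open>simp_all add: inv_mult_group m_assoc\<close>)
    then obtain j where j: "j \<in> set L" "refl_at j = g \<otimes> ?t \<otimes> inv g" using all by force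
    then obtain A B where L: "L = A @ j # B" by (meson split_list)
    let ?a = "word_prod G (map letter A)" and ?b = "word_prod G (map letter B)"
    have ab: "?a \<in> carrier G" "?b \<in> carrier G" by simp_all
    have "g \<otimes> (?a \<otimes> letter j \<otimes> inv ?a) \<otimes> inv g = g \<otimes> ?t \<otimes> inv g"
      using labelled_split[of g A j B] assms(1,2) L j by simp
    then have t: "?a \<otimes> letter j \<otimes> inv ?a = ?t"
      using assms(1) s by (metis conjugation_is_inj ab inv_closed letter_in_S m_closed simple_carrier x)
    have xL: "?x = ?a \<otimes> (letter j \<otimes> ?b)" by (simp add: L word_append)
    have "?x \<otimes> s = ?t \<otimes> ?x" using s by (simp add: m_assoc)
    also have "\<dots> = (?a \<otimes> letter j \<otimes> inv ?a) \<otimes> (?a \<otimes> (letter j \<otimes> ?b))" using t xL by simp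
    also have "\<dots> = ?a \<otimes> ((letter j \<otimes> (inv ?a \<otimes> ?a)) \<otimes> (letter j \<otimes> ?b))"
      using ab by (simp only: m_assoc m_closed inv_closed simple_carrier letter_in_S)
    also have "\<dots> = ?a \<otimes> ?b" using ab by simp
    finally have "?x \<otimes> s = word_prod G (map letter (A @ B))" by (simp add: word_append)
    then have "len (?x \<otimes> s) \<le> length (A @ B)" using len_le[of "map letter (A @ B)"] by simp
    then show "len (?x \<otimes> s) < len ?x" using lx L by simp
  qed
qed

text \<open>The letters at the positions of a fixed level spell a reduced word of the longest element.\<close>

definition block :: "nat \<Rightarrow> nat list" where "block l = filter (\<lambda>i. level i = l) [0..<period]"

lemma blocks_period: "blocks m [0..<period] = concat (map block [0..<m])"
  by (simp add: blocks_def block_def[abs_def])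

lemma swaps_period: "swap\<^sup>*\<^sup>* [0..<period] (concat (map block [0..<twists]))"
  using swaps_blocks[of "[0..<period]" twists] level_less_twists by (simp add: blocks_period sorted_wrt_upt)

lemma block_labelled:
  assumes "l < twists" obtains g where "g \<in> carrier G" "labelled g (block l)"
proof -
  let ?A = "concat (map block [0..<l])" and ?B = "concat (map block [Suc l..<twists])"
  have "[0..<twists] = [0..<l] @ l # [Suc l..<twists]"
    using assms upt_add_eq_append[of 0 l "twists - l"] upt_conv_Cons[of l twists] by simp
  then have "labelled \<one> (?A @ block l @ ?B)"
    using swaps_labelled[OF swaps_period one_closed labelled_upt] by simp
  then show thesis
    using that[of "word_prod G (map letter ?A)"] by (simp add: labelled_append)
qed

lemma block_w0:
  assumes "l < twists"
  shows "word_prod G (map letter (block l)) = w0" "length (block l) = len w0"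
proof -
  obtain g where g: "g \<in> carrier G" "labelled g (block l)" using block_labelled[OF assms] .
  have d: "distinct (map refl_at (block l))"
  proof -
    have "inj_on refl_at (set (block l))"
    proof (rule inj_onI)
      fix x y assume "x \<in> set (block l)" "y \<in> set (block l)" "refl_at x = refl_at y"
      then show "x = y" by (intro level_inj[of x y]) (simp_all add: block_def)
    qed
    then show ?thesis by (simp add: distinct_map block_def)
  qed
  have "t \<in> refl_at ` set (block l)" if t: "reflection t" for t
  proof -
    obtain i where i: "refl_at i = t" using reflection_occurs[OF t] by blast
    then obtain j where "j < period" "refl_at j = t" "level j = l" using level_surj[OF assms, of i] by blast
    then show ?thesis by (auto simp: block_def)
  qed
  then show w: "word_prod G (map letter (block l)) = w0" using labelled_longest[OF g d] by blast
  show "length (block l) = len w0" using labelled_reduced[OF g d] w by simp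
qed

text \<open>The product over a full period is 1, and it is also the \<open>twists\<close>-th power
  of the nontrivial involution \<open>w0\<close>.\<close>

lemma even_twists: "even twists"
proof -
  have "w0 \<noteq> \<one>"
  proof
    assume "w0 = \<one>"
    then have "len (\<one> \<otimes> letter 0) < len \<one>" using longest_w0 unfolding longest_def by (metis letter_in_S)
    then show False by simp
  qed
  have "word_prod G (map letter (concat (map block [0..<m]))) = (if even m then \<one> else w0)"
      if "m \<le> twists" for m
    using that
  proof (induction m)
    case (Suc m)
    then show ?case using block_w0(1)[of m] by (simp add: word_append)
  qed simp
  then have "word_prod G (map letter (concat (map block [0..<twists]))) = (if even twists then \<one> else w0)"
      by blast
  moreover have "word_prod G (map letter (concat (map block [0..<twists]))) = \<one>"
    using swaps_word_prod[OF swaps_period] prefix_period by (simp add: prefix_def)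
  ultimately show ?thesis using \<open>w0 \<noteq> \<one>\<close> by (auto split: if_splits)
qed

lemma hecke_coxeter_power:
  assumes "v \<in> carrier G"
  shows "foldr (hecke z) (word_power c coxeter_number) f v
    = foldr (hecke z) (concat (replicate twists w0_word)) f v"
proof -
  have blk: "foldr (hecke z) (map letter (concat (map block [0..<m]))) f v
      = foldr (hecke z) (concat (replicate m w0_word)) f v" if "m \<le> twists" "v \<in> carrier G" for m v f
    using that
  proof (induction m arbitrary: v f)
    case (Suc m)
    have "replicate (Suc m) w0_word = replicate m w0_word @ [w0_word]" by (simp add: replicate_append_same)
    then have rep: "concat (replicate (Suc m) w0_word) = concat (replicate m w0_word) @ w0_word" by simp
    have S: "set (concat (replicate m w0_word)) \<subseteq> S"
      using w0_word(1) by (auto simp: set_replicate_conv_if split: if_splits)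
    have "foldr (hecke z) (map letter (concat (map block [0..<Suc m]))) f v
      = foldr (hecke z) (map letter (concat (map block [0..<m]))) (foldr (hecke z) (map letter (block m)) f) v"
      by simp
    also have "\<dots> = foldr (hecke z) (concat (replicate m w0_word)) (foldr (hecke z) (map letter (block m)) f) v"
      using Suc by simp
    also have "\<dots> = foldr (hecke z) (concat (replicate m w0_word)) (foldr (hecke z) w0_word f) v"
    proof (rule foldr_hecke_cong[OF _ S Suc.prems(2)])
      fix u assume "u \<in> carrier G"
      then show "foldr (hecke z) (map letter (block m)) f u = foldr (hecke z) w0_word f u"
        using block_w0[of m] Suc.prems by (intro foldr_hecke_w0_word) auto
    qed
    also have "\<dots> = foldr (hecke z) (concat (replicate (Suc m) w0_word)) f v" unfolding rep by simp
    finally show ?case .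
  qed simp
  have "foldr (hecke z) (map letter [0..<period]) f v
      = foldr (hecke z) (map letter (concat (map block [0..<twists]))) f v"
    using swaps_hecke[OF swaps_period] assms by blast
  then show ?thesis using blk assms by (simp add: map_letter_word_power period_def)
qed

end

context finite_coxeter_system
begin

subsection \<open>Conjugacy of Coxeter elements\<close>

text \<open>Obtained by averaging over the group. In contrast to \<open>form\<close>, it is visibly
  positive definite on coordinates in \<open>S\<close>.\<close>

definition inner :: "('a \<Rightarrow> real) \<Rightarrow> ('a \<Rightarrow> real) \<Rightarrow> real" where
  "inner x y = (\<Sum>w\<in>carrier G. \<Sum>t\<in>S. act w x t * act w y t)"

lemma inner_act: assumes "g \<in> carrier G" shows "inner (act g x) (act g y) = inner x y"
proof -
  let ?f = "\<lambda>w. \<Sum>t\<in>S. act w x t * act w y t"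
  have "bij_betw (\<lambda>w. w \<otimes> g) (carrier G) (carrier G)"
    by (rule bij_betw_byWitness[of _ "\<lambda>w. w \<otimes> inv g"]) (use assms in \<open>auto simp: m_assoc\<close>)
  then have "(\<Sum>w\<in>carrier G. ?f (w \<otimes> g)) = (\<Sum>w\<in>carrier G. ?f w)" by (rule sum.reindex_bij_betw)
  moreover have "inner (act g x) (act g y) = (\<Sum>w\<in>carrier G. ?f (w \<otimes> g))"
    unfolding inner_def by (intro sum.cong HOL.refl) (simp_all add: act_mult assms)
  ultimately show ?thesis by (simp add: inner_def)
qed

lemma inner_sym: "inner x y = inner y x"
  by (simp add: inner_def mult.commute)

lemma inner_lin: "inner (\<lambda>t. a * x t + b * y t) z = a * inner x z + b * inner y z"
  unfolding inner_def sum_distrib_left sum.distrib[symmetric]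
  by (intro sum.cong HOL.refl) (simp_all add: act_lin algebra_simps)

lemma inner_sum: "inner (\<lambda>t. \<Sum>i\<in>A. c i * f i t) z = (\<Sum>i\<in>A. c i * inner (f i) z)"
proof -
  have "inner (\<lambda>t. \<Sum>i\<in>A. c i * f i t) z = (\<Sum>w\<in>carrier G. \<Sum>t\<in>S. \<Sum>i\<in>A. c i * (act w (f i) t * act w z t))"
    unfolding inner_def by (intro sum.cong HOL.refl) (simp_all add: act_sum sum_distrib_right mult.assoc)
  also have "\<dots> = (\<Sum>w\<in>carrier G. \<Sum>i\<in>A. \<Sum>t\<in>S. c i * (act w (f i) t * act w z t))"
    by (rule sum.cong[OF HOL.refl], rule sum.swap)
  also have "\<dots> = (\<Sum>i\<in>A. \<Sum>w\<in>carrier G. \<Sum>t\<in>S. c i * (act w (f i) t * act w z t))" by (rule sum.swap)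
  finally show ?thesis by (simp add: inner_def sum_distrib_left)
qed

lemma inner_pos: assumes "s \<in> S" "x s \<noteq> 0" shows "inner x x > 0"
proof -
  have nn: "0 \<le> (\<Sum>t\<in>S. act w x t * act w x t)" for w by (intro sum_nonneg) simp
  have "0 < x s * x s" using assms(2) by (metis not_real_square_gt_zero)
  also have "\<dots> \<le> (\<Sum>t\<in>S. x t * x t)" using assms(1) by (intro member_le_sum) auto
  also have "\<dots> = (\<Sum>t\<in>S. act \<one> x t * act \<one> x t)" by simp
  also have "\<dots> \<le> inner x x" unfolding inner_def using nn finite_carrier
    by (intro member_le_sum[where f = "\<lambda>w. \<Sum>t\<in>S. act w x t * act w x t"]) auto
  finally show ?thesis .
qed

text \<open>The reflection in \<open>s\<close> is orthogonal for \<open>inner\<close> and negates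
  the simple root, which forces \<open>pairing x s\<close> to be the usual quotient of inner
  products.\<close>

lemma inner_simple_root:
  assumes s: "s \<in> S"
  shows "2 * inner x (simple_root s) = pairing x s * inner (simple_root s) (simple_root s)"
proof -
  let ?a = "simple_root s"
  have r: "reflect s x = (\<lambda>t. 1 * x t + (- pairing x s) * ?a t)"
    by (auto simp: reflect_apply simple_root_def)
  have ra: "reflect s ?a = (\<lambda>t. (-1) * ?a t + 0 * ?a t)" using s by (auto simp: reflect_simple_root)
  have "inner x ?a = inner (reflect s x) (reflect s ?a)"
    using inner_act[of s x ?a] s by (simp add: act_simple)
  also have "\<dots> = - inner ?a (reflect s x)"
    unfolding ra inner_sym[of "reflect s x"] inner_lin by simp
  also have "inner ?a (reflect s x) = inner (reflect s x) ?a" by (rule inner_sym)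
  also have "\<dots> = inner x ?a - pairing x s * inner ?a ?a" unfolding r inner_lin by simp
  finally show ?thesis by linarith
qed

lemma cartan_le_minus_one:
  assumes "s \<in> S" "t \<in> S" "s \<otimes> t \<noteq> t \<otimes> s" shows "cartan s t \<le> -1"
proof -
  have ne: "s \<noteq> t" using assms by auto
  have "coxeter_m G s t \<noteq> 2" using commute_if_m_2 assms by blast
  then have m: "coxeter_m G s t \<ge> 3" using coxeter_m_ge_2[OF assms(1,2) ne] by simp
  then have "pi / real (coxeter_m G s t) \<le> pi / 3" by (intro divide_left_mono) auto
  then have "cos (pi / 3) \<le> cos (pi / real (coxeter_m G s t))"
    using m by (intro cos_monotone_0_pi_le) auto
  then show ?thesis by (simp add: cartan_def cos_60)
qed

text \<open>The Coxeter graph of a finite group is a forest. If each vertex in \<open>J\<close> had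
  two neighbours in \<open>J\<close>, each row sum of \<open>cartan\<close> over \<open>J\<close>
  would be at most 2 - 1 - 1, so the sum of the normalised simple roots would have norm at most
  0.\<close>

lemma leaf_exists:
  assumes J: "J \<subseteq> S" "J \<noteq> {}"
  shows "\<exists>s\<in>J. card {t \<in> J. s \<otimes> t \<noteq> t \<otimes> s} \<le> 1"
proof (rule ccontr)
  assume no: "\<not> ?thesis"
  have finJ: "finite J" using J finite_subset finite_S by blast
  define l where "l s = inner (simple_root s) (simple_root s)" for s
  have l: "l s > 0" if "s \<in> S" for s
    unfolding l_def by (rule inner_pos[OF that]) (simp add: simple_root_def)
  have ip: "2 * inner (simple_root t) (simple_root s) = cartan t s * l s" if "s \<in> S" "t \<in> S" for s t
    using inner_simple_root[OF that(1), of "simple_root t"] pairing_simple_root[OF that(2)] by (simp add: l_def)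
  \<comment> \<open>The averaged product may scale simple roots of different components differently,
    hence the normalisation. Roots with nonzero \<open>cartan\<close> have equal length by
    \<open>ll\<close>, so the normalised Gram matrix is half of \<open>cartan\<close>.\<close>
  define q where "q s = 1 / sqrt (l s)" for s
  have ll: "l s = l t" if st: "s \<in> S" "t \<in> S" "cartan t s \<noteq> 0" for s t
  proof -
    have "cartan t s * l s = cartan s t * l t"
      using ip[OF st(1,2)] ip[OF st(2,1)] inner_sym[of "simple_root t"] by simp
    then show ?thesis using st cartan_sym[OF st(1,2)] by simp
  qed
  have g: "q t * (q s * inner (simple_root t) (simple_root s)) = cartan t s / 2" if st: "s \<in> S" "t \<in> S" for s t
  proof (cases "cartan t s = 0")
    case True
    then show ?thesis using ip[OF st] by simp
  next
    case False
    have "q s * q s * l s = 1" using l[OF st(1)] by (simp add: q_def)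
    moreover have "q t = q s" using ll[OF st False] by (simp add: q_def)
    moreover have "inner (simple_root t) (simple_root s) = cartan t s * l s / 2" using ip[OF st] by simp
    ultimately show ?thesis by (simp add: algebra_simps)
  qed
  define x where "x = (\<lambda>v. \<Sum>s\<in>J. q s * simple_root s v)"
  have ix: "inner x y = (\<Sum>s\<in>J. q s * inner (simple_root s) y)" for y
    unfolding x_def by (rule inner_sum)
  have "inner x x = (\<Sum>t\<in>J. q t * inner x (simple_root t))"
    using ix[of x] unfolding inner_sym[of "simple_root t" x for t] .
  also have "\<dots> = (\<Sum>s\<in>J. \<Sum>t\<in>J. q t * (q s * inner (simple_root t) (simple_root s)))"
  proof (intro sum.cong HOL.refl)
    fix s assume "s \<in> J"
    show "q s * inner x (simple_root s) = (\<Sum>t\<in>J. q t * (q s * inner (simple_root t) (simple_root s)))"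
      unfolding ix by (simp add: sum_distrib_left algebra_simps)
  qed
  also have "\<dots> = (\<Sum>s\<in>J. (\<Sum>t\<in>J. cartan t s) / 2)"
    unfolding sum_divide_distrib by (intro sum.cong HOL.refl g) (use J in auto)
  also have "\<dots> \<le> 0"
  proof (intro sum_nonpos)
    fix s assume s: "s \<in> J"
    let ?N = "{t \<in> J. s \<otimes> t \<noteq> t \<otimes> s}"
    have finN: "finite ?N" using finJ by simp
    have "card ?N \<ge> 2" using no s by (metis not_less_eq_eq numeral_2_eq_2 One_nat_def)
    have sS: "s \<in> S" using s J by auto
    have "(\<Sum>t\<in>J. cartan t s) = cartan s s + (\<Sum>t\<in>J - {s}. cartan t s)"
      using finJ s by (rule sum.remove)
    also have "(\<Sum>t\<in>J - {s}. cartan t s) \<le> (\<Sum>t\<in>?N. cartan t s)"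
    proof -
      have "(\<Sum>t\<in>J - {s}. cartan t s) = (\<Sum>t\<in>?N. cartan t s) + (\<Sum>t\<in>J - {s} - ?N. cartan t s)"
        using finJ by (subst sum.subset_diff[of ?N "J - {s}"]) auto
      moreover have "(\<Sum>t\<in>J - {s} - ?N. cartan t s) \<le> 0"
        by (intro sum_nonpos cartan_nonpos) (use J sS in auto)
      ultimately show ?thesis by simp
    qed
    also have "(\<Sum>t\<in>?N. cartan t s) \<le> (\<Sum>t\<in>?N. -1)"
    proof (rule sum_mono)
      fix t assume "t \<in> ?N"
      then show "cartan t s \<le> -1" using J sS by (intro cartan_le_minus_one) auto
    qed
    also have "\<dots> = - real (card ?N)" by simp
    finally show "(\<Sum>t\<in>J. cartan t s) / 2 \<le> 0" using \<open>card ?N \<ge> 2\<close> sS by simp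
  qed
  finally have "inner x x \<le> 0" .
  obtain s where s: "s \<in> J" using J by blast
  have sS: "s \<in> S" using s J by auto
  have "x s = (\<Sum>t\<in>J. if t = s then q s else 0)"
    unfolding x_def by (intro sum.cong HOL.refl) (auto simp: simple_root_def)
  then have "x s = q s" using s finJ by simp
  then have "x s \<noteq> 0" using l[OF sS] by (simp add: q_def)
  then show False using inner_pos[OF sS] \<open>inner x x \<le> 0\<close> by force
qed

section \<open>Orderings up to commutations and rotations\<close>

inductive cyclic_equiv :: "'a list \<Rightarrow> 'a list \<Rightarrow> bool" for xs where
  cyclic_refl: "cyclic_equiv xs xs"
| cyclic_swap: "\<lbrakk>cyclic_equiv xs (u @ a # b # v); a \<otimes> b = b \<otimes> a\<rbrakk> \<Longrightarrow> cyclic_equiv xs (u @ b # a # v)"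
| cyclic_rotate: "cyclic_equiv xs (u @ v) \<Longrightarrow> cyclic_equiv xs (v @ u)"

lemma cyclic_trans: "\<lbrakk>cyclic_equiv ys zs; cyclic_equiv xs ys\<rbrakk> \<Longrightarrow> cyclic_equiv xs zs"
  by (induction rule: cyclic_equiv.induct) (auto intro: cyclic_equiv.intros)

lemma cyclic_sym: "cyclic_equiv xs ys \<Longrightarrow> cyclic_equiv ys xs"
proof (induction rule: cyclic_equiv.induct)
  case (cyclic_swap u a b v)
  have "cyclic_equiv (u @ b # a # v) (u @ a # b # v)"
    by (rule cyclic_equiv.cyclic_swap[OF cyclic_equiv.cyclic_refl]) (use cyclic_swap in simp)
  then show ?case using cyclic_trans cyclic_swap by blast
next
  case (cyclic_rotate u v)
  have "cyclic_equiv (v @ u) (u @ v)" by (rule cyclic_equiv.cyclic_rotate[OF cyclic_equiv.cyclic_refl])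
  then show ?case using cyclic_trans cyclic_rotate by blast
qed (rule cyclic_refl)

lemma cyclic_set: "cyclic_equiv xs ys \<Longrightarrow> set ys = set xs"
  by (induction rule: cyclic_equiv.induct) auto

lemma cyclic_move_left:
  "\<lbrakk>cyclic_equiv xs (p @ u @ s # v); \<And>b. b \<in> set u \<Longrightarrow> b \<otimes> s = s \<otimes> b\<rbrakk> \<Longrightarrow> cyclic_equiv xs (p @ s # u @ v)"
proof (induction u arbitrary: v rule: rev_induct)
  case (snoc b u)
  have "cyclic_equiv xs ((p @ u) @ b # s # v)" using snoc.prems by simp
  then have "cyclic_equiv xs ((p @ u) @ s # b # v)" by (rule cyclic_swap) (use snoc.prems(2)[of b] in simp)
  then show ?case using snoc.IH[of "b # v"] snoc.prems(2) by simp
qed simp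

lemma cyclic_conjugate:
  "\<lbrakk>cyclic_equiv xs ys; set xs \<subseteq> S\<rbrakk> \<Longrightarrow> \<exists>g\<in>carrier G. word_prod G ys = g \<otimes> word_prod G xs \<otimes> inv g"
proof (induction rule: cyclic_equiv.induct)
  case cyclic_refl
  then show ?case by (intro bexI[of _ \<one>]) auto
next
  case (cyclic_swap u a b v)
  have S: "set (u @ a # b # v) \<subseteq> S" using cyclic_set[OF cyclic_swap.hyps(1)] cyclic_swap.prems by simp
  have "a \<otimes> (b \<otimes> word_prod G v) = b \<otimes> (a \<otimes> word_prod G v)"
    using S cyclic_swap.hyps(2) by (simp add: m_assoc[symmetric])
  then have "word_prod G (u @ b # a # v) = word_prod G (u @ a # b # v)" using S by (simp add: word_append)
  then show ?case using cyclic_swap.IH cyclic_swap.prems by simp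
next
  case (cyclic_rotate u v)
  have S: "set u \<subseteq> S" "set v \<subseteq> S" using cyclic_set[OF cyclic_rotate.hyps(1)] cyclic_rotate.prems by auto
  obtain g where g: "g \<in> carrier G" "word_prod G (u @ v) = g \<otimes> word_prod G xs \<otimes> inv g"
    using cyclic_rotate.IH cyclic_rotate.prems by blast
  let ?u = "word_prod G u" and ?v = "word_prod G v" and ?x = "word_prod G xs"
  have c: "?u \<in> carrier G" "?v \<in> carrier G" "?x \<in> carrier G" using S cyclic_rotate.prems by auto
  have "word_prod G (v @ u) = inv ?u \<otimes> (?u \<otimes> ?v) \<otimes> ?u" using S c by (simp add: word_append m_assoc[symmetric])
  also have "?u \<otimes> ?v = g \<otimes> ?x \<otimes> inv g" using g S by (simp add: word_append)
  also have "inv ?u \<otimes> (g \<otimes> ?x \<otimes> inv g) \<otimes> ?u = (inv ?u \<otimes> g) \<otimes> ?x \<otimes> inv (inv ?u \<otimes> g)"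
    using c g(1) by (simp add: inv_mult_group m_assoc)
  finally show ?case using c g(1) by (intro bexI[of _ "inv ?u \<otimes> g"]) auto
qed

definition attach :: "'a \<Rightarrow> 'a \<Rightarrow> 'a list \<Rightarrow> 'a list" where
  "attach t s w = concat (map (\<lambda>x. if x = t then [t, s] else [x]) w)"

lemma attach_append [simp]: "attach t s (u @ v) = attach t s u @ attach t s v"
  by (simp add: attach_def)

lemma attach_other: "t \<notin> set u \<Longrightarrow> attach t s u = u"
  by (induction u) (auto simp: attach_def)

text \<open>A leaf \<open>s\<close> commutes with every letter but its neighbour \<open>t\<close>.
  Each move of the word without \<open>s\<close> therefore lifts to the word in which
  \<open>t\<close> drags \<open>s\<close> along behind it.\<close>

lemma cyclic_attach:
  "\<lbrakk>cyclic_equiv w w'; \<And>b. \<lbrakk>b \<in> set w; b \<noteq> t\<rbrakk> \<Longrightarrow> b \<otimes> s = s \<otimes> b\<rbrakk>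
    \<Longrightarrow> cyclic_equiv (attach t s w) (attach t s w')"
proof (induction rule: cyclic_equiv.induct)
  case cyclic_refl
  show ?case by (rule cyclic_equiv.cyclic_refl)
next
  case (cyclic_swap u a b v)
  have IH: "cyclic_equiv (attach t s w) (attach t s (u @ a # b # v))" using cyclic_swap by blast
  have in_w: "a \<in> set w" "b \<in> set w" using cyclic_set[OF cyclic_swap.hyps(1)] by auto
  have at: "attach t s (x # y) = (if x = t then [t, s] else [x]) @ attach t s y" for x y
    by (simp add: attach_def)
  consider "a = b" | "a \<noteq> t" "b \<noteq> t" | "a = t" "b \<noteq> t" | "a \<noteq> t" "b = t" by blast
  then show ?case
  proof cases
    case 1
    then show ?thesis using IH by simp
  next
    case 2
    then show ?thesis
      using IH cyclic_equiv.cyclic_swap[of _ "attach t s u" a b "attach t s v"] cyclic_swap.hyps(2)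
          by (simp add: at)
  next
    case 3
    have "cyclic_equiv (attach t s w) (attach t s u @ [t, s] @ b # attach t s v)" using IH 3 by (simp add: at)
    then have "cyclic_equiv (attach t s w) (attach t s u @ b # [t, s] @ attach t s v)"
      by (rule cyclic_move_left) (use 3 cyclic_swap.hyps(2) cyclic_swap.prems[of b] in_w in auto)
    then show ?thesis using 3 by (simp add: at)
  next
    case 4
    have as: "a \<otimes> s = s \<otimes> a" using cyclic_swap.prems[of a] in_w 4 by auto
    have "cyclic_equiv (attach t s w) (attach t s u @ a # t # s # attach t s v)" using IH 4 by (simp add: at)
    then have "cyclic_equiv (attach t s w) (attach t s u @ t # a # s # attach t s v)"
      by (rule cyclic_equiv.cyclic_swap) (use cyclic_swap.hyps(2) 4 in simp)
    then have "cyclic_equiv (attach t s w) ((attach t s u @ [t]) @ a # s # attach t s v)" by simp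
    then have "cyclic_equiv (attach t s w) ((attach t s u @ [t]) @ s # a # attach t s v)"
      by (rule cyclic_equiv.cyclic_swap) (rule as)
    then show ?thesis using 4 by (simp add: at)
  qed
next
  case (cyclic_rotate u v)
  then have "cyclic_equiv (attach t s w) (attach t s u @ attach t s v)" by simp
  then have "cyclic_equiv (attach t s w) (attach t s v @ attach t s u)" by (rule cyclic_equiv.cyclic_rotate)
  then show ?case by simp
qed

text \<open>Rotate \<open>t\<close> to the front; then \<open>s\<close> commutes with everything
  that separates it from \<open>t\<close>.\<close>

lemma cyclic_to_attach:
  assumes xs: "distinct xs" "t \<in> set xs" "s \<in> set xs" "s \<noteq> t"
    and comm: "\<And>b. \<lbrakk>b \<in> set xs; b \<noteq> t; b \<noteq> s\<rbrakk> \<Longrightarrow> b \<otimes> s = s \<otimes> b"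
  shows "\<exists>w. distinct w \<and> set w = set xs - {s} \<and> cyclic_equiv xs (attach t s w)"
proof -
  obtain p q where pq: "xs = p @ t # q" using xs(2) by (meson split_list)
  have "cyclic_equiv xs (p @ t # q)" unfolding pq by (rule cyclic_refl)
  then have 1: "cyclic_equiv xs ((t # q) @ p)" by (rule cyclic_rotate)
  have "s \<in> set (q @ p)" using xs pq by auto
  then obtain u v where uv: "q @ p = u @ s # v" by (meson split_list)
  have "distinct (t # (q @ p))" using xs(1) pq by auto
  then have d: "distinct (t # u @ s # v)" unfolding uv .
  have "set xs = set (t # (q @ p))" using pq by auto
  then have st: "set xs = set (t # u @ s # v)" unfolding uv .
  have "cyclic_equiv xs ([t] @ u @ s # v)" using 1 uv by simp
  then have "cyclic_equiv xs ([t] @ s # u @ v)"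
    by (rule cyclic_move_left) (use comm st d in auto)
  moreover have "attach t s (t # u @ v) = [t] @ s # u @ v"
    using d attach_other[of t u s] attach_other[of t v s] by (simp add: attach_def)
  ultimately have "cyclic_equiv xs (attach t s (t # u @ v))" by simp
  moreover have "distinct (t # u @ v)" "set (t # u @ v) = set xs - {s}" using d st by auto
  ultimately show ?thesis by blast
qed

text \<open>Induction by removing a leaf \<open>s\<close>: both orderings can be brought to the form
  where \<open>s\<close> directly follows a chosen \<open>t\<close>, namely its neighbour if it has
  one. The orderings of the rest are related by induction, and \<open>cyclic_attach\<close>
  reinserts \<open>s\<close>.\<close>

lemma cyclic_equiv_orderings:
  "\<lbrakk>distinct xs; distinct ys; set xs = set ys; set xs \<subseteq> S\<rbrakk> \<Longrightarrow> cyclic_equiv xs ys"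
proof (induction "card (set xs)" arbitrary: xs ys)
  case 0
  then show ?case by (auto intro: cyclic_refl)
next
  case (Suc n)
  let ?J = "set xs"
  have "?J \<noteq> {}" using Suc.hyps(2) by auto
  then obtain s where s: "s \<in> ?J" "card {t \<in> ?J. s \<otimes> t \<noteq> t \<otimes> s} \<le> 1"
    using leaf_exists[OF Suc.prems(4)] by blast
  show ?case
  proof (cases "?J = {s}")
    case True
    have one: "zs = [s]" if "distinct zs" "set zs = {s}" for zs
    proof -
      have "length zs = 1" using that distinct_card[of zs] by simp
      then obtain z where "zs = [z]" by (auto simp: length_Suc_conv)
      then show ?thesis using that by simp
    qed
    then show ?thesis using True Suc.prems cyclic_refl by metis
  next
    case False
    let ?N = "{t \<in> ?J. s \<otimes> t \<noteq> t \<otimes> s}"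
    obtain t where t: "t \<in> ?J" "t \<noteq> s" "?N \<subseteq> {t}"
    proof (cases "?N = {}")
      case True
      then show ?thesis using that False s(1) by blast
    next
      case False
      then obtain t where "t \<in> ?N" by blast
      then have tJ: "t \<in> ?J" "t \<noteq> s" by auto
      have "?N \<subseteq> {t}"
      proof
        fix t' assume t': "t' \<in> ?N"
        have "card ?N > 0" using False by (subst card_gt_0_iff) simp
        then have "card ?N = 1" using s(2) by linarith
        then obtain x where N: "?N = {x}" by (rule card_1_singletonE)
        have "t' \<in> {x}" using t' unfolding N .
        moreover have "t \<in> {x}" using \<open>t \<in> ?N\<close> unfolding N .
        ultimately show "t' \<in> {t}" by simp
      qed
      with tJ show ?thesis by (rule that)
    qed
    have comm: "b \<otimes> s = s \<otimes> b" if "b \<in> ?J" "b \<noteq> t" for b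
    proof (rule ccontr)
      assume "b \<otimes> s \<noteq> s \<otimes> b"
      then have "b \<in> ?N" using that(1) by simp
      then have "b \<in> {t}" using t(3) by (rule subsetD[rotated])
      then show False using that(2) by simp
    qed
    obtain w where w: "distinct w" "set w = set xs - {s}" "cyclic_equiv xs (attach t s w)"
      using cyclic_to_attach[of xs t s] Suc.prems t s comm by auto
    obtain w' where w': "distinct w'" "set w' = set ys - {s}" "cyclic_equiv ys (attach t s w')"
      using cyclic_to_attach[of ys t s] Suc.prems t s comm by auto
    have "cyclic_equiv w w'"
      by (rule Suc.hyps(1)) (use w w' Suc.prems Suc.hyps(2) s in auto)
    then have "cyclic_equiv (attach t s w) (attach t s w')"
      by (rule cyclic_attach) (use comm w in auto)
    then show ?thesis using w(3) cyclic_sym[OF w'(3)] cyclic_trans by blast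
  qed
qed

lemma conj_pow:
  assumes "g \<in> carrier G" "x \<in> carrier G"
  shows "(g \<otimes> x \<otimes> inv g) [^] (n::nat) = g \<otimes> x [^] n \<otimes> inv g"
proof (induction n)
  case 0
  then show ?case using assms by simp
next
  case (Suc n)
  have "(g \<otimes> x [^] n \<otimes> inv g) \<otimes> (g \<otimes> x \<otimes> inv g) = g \<otimes> (x [^] n \<otimes> ((inv g \<otimes> g) \<otimes> (x \<otimes> inv g)))"
    using assms by (simp only: m_assoc m_closed inv_closed nat_pow_closed)
  then show ?case using Suc assms by (simp add: m_assoc)
qed

lemma ord_conjugate:
  assumes "g \<in> carrier G" "x \<in> carrier G" shows "ord (g \<otimes> x \<otimes> inv g) = ord x"
proof -
  have "(g \<otimes> x \<otimes> inv g) [^] n = \<one> \<longleftrightarrow> x [^] n = \<one>" for n :: nat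
  proof
    assume "(g \<otimes> x \<otimes> inv g) [^] n = \<one>"
    then have "inv g \<otimes> (g \<otimes> x [^] n \<otimes> inv g) \<otimes> g = inv g \<otimes> \<one> \<otimes> g" using conj_pow[OF assms] by simp
    then show "x [^] n = \<one>" using assms by (simp add: m_assoc) (simp add: m_assoc[symmetric])
  qed (use conj_pow[OF assms] assms in simp)
  then have "ord x dvd n \<longleftrightarrow> ord (g \<otimes> x \<otimes> inv g) dvd n" for n
    using pow_eq_id[of x n] pow_eq_id[of "g \<otimes> x \<otimes> inv g" n] assms by simp
  then show ?thesis by (metis dvd_antisym dvd_refl)
qed

theorem coxeter_word_ord_eq:
  assumes "coxeter_word S c" "coxeter_word S c'"
  shows "ord (word_prod G c) = ord (word_prod G c')"
proof -
  have "cyclic_equiv c c'" using assms by (intro cyclic_equiv_orderings) (auto simp: coxeter_word_def)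
  then obtain g where "g \<in> carrier G" "word_prod G c' = g \<otimes> word_prod G c \<otimes> inv g"
    using cyclic_conjugate[of c c'] assms by (auto simp: coxeter_word_def)
  then show ?thesis using ord_conjugate[of g "word_prod G c"] assms by (auto simp: coxeter_word_def)
qed

end

subsection \<open>Traces and eigenvalues of products of matrices\<close>

definition mat_trace :: "'a :: comm_monoid_add mat \<Rightarrow> 'a" where
  "mat_trace A = (\<Sum>i<dim_row A. A $$ (i, i))"

definition mat_prod :: "nat \<Rightarrow> 'a :: comm_ring_1 mat list \<Rightarrow> 'a mat" where
  "mat_prod n Ms = foldr (*) Ms (1\<^sub>m n)"

lemma mat_prod_Nil [simp]: "mat_prod n [] = 1\<^sub>m n"
  by (simp add: mat_prod_def)

lemma mat_prod_Cons [simp]: "mat_prod n (M # Ms) = M * mat_prod n Ms"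
  by (simp add: mat_prod_def)

lemma mat_prod_carrier [simp]: "set Ms \<subseteq> carrier_mat n n \<Longrightarrow> mat_prod n Ms \<in> carrier_mat n n"
  by (induction Ms) auto

lemma mat_prod_append:
  "\<lbrakk>set Ms \<subseteq> carrier_mat n n; set Ns \<subseteq> carrier_mat n n\<rbrakk> \<Longrightarrow> mat_prod n (Ms @ Ns) = mat_prod n Ms * mat_prod n Ns"
proof (induction Ms)
  case Nil
  then show ?case by (simp add: left_mult_one_mat[of _ n n])
next
  case (Cons M Ms)
  then show ?case using assoc_mult_mat[of M n n "mat_prod n Ms" n "mat_prod n Ns" n] by simp
qed

lemma mat_prod_commute:
  assumes "N \<in> carrier_mat n n" "set Ms \<subseteq> carrier_mat n n" "\<And>M. M \<in> set Ms \<Longrightarrow> N * M = M * N"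
  shows "N * mat_prod n Ms = mat_prod n Ms * N"
  using assms(2,3)
proof (induction Ms)
  case Nil
  then show ?case using assms(1) by simp
next
  case (Cons M Ms)
  have c: "M \<in> carrier_mat n n" "mat_prod n Ms \<in> carrier_mat n n" using Cons.prems by auto
  have "N * (M * mat_prod n Ms) = (N * M) * mat_prod n Ms"
    using assms(1) c by (simp add: assoc_mult_mat[of _ n n _ n _ n])
  also have "\<dots> = M * (N * mat_prod n Ms)"
    using Cons.prems assms(1) c by (simp add: assoc_mult_mat[of _ n n _ n _ n])
  also have "\<dots> = M * (mat_prod n Ms * N)" using Cons by simp
  finally show ?case using assms(1) c by (simp add: assoc_mult_mat[of _ n n _ n _ n])
qed

lemma mat_prod_filter:
  assumes "\<And>x. F x \<in> carrier_mat n n" "\<And>x y. F x * F y = F y * F x"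
  shows "mat_prod n (map F xs) = mat_prod n (map F (filter R xs)) * mat_prod n (map F (filter (\<lambda>x. \<not> R x) xs))"
proof (induction xs)
  case Nil
  then show ?case by simp
next
  case (Cons x xs)
  let ?A = "mat_prod n (map F (filter R xs))" and ?B = "mat_prod n (map F (filter (\<lambda>x. \<not> R x) xs))"
  have s: "set (map F ys) \<subseteq> carrier_mat n n" for ys using assms(1) by auto
  have c: "?A \<in> carrier_mat n n" "?B \<in> carrier_mat n n" by (intro mat_prod_carrier s)+
  have "F x * ?A = ?A * F x" using assms s by (intro mat_prod_commute) auto
  then have "F x * (?A * ?B) = ?A * (F x * ?B)"
    using assoc_mult_mat[OF assms(1)[of x] c] assoc_mult_mat[OF c(1) assms(1)[of x] c(2)] by simp
  then show ?case using Cons c assms(1)[of x] by (simp add: assoc_mult_mat[of _ n n _ n _ n])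
qed

lemma pow_mat_commute:
  assumes "A \<in> carrier_mat n n" shows "A * A ^\<^sub>m k = A ^\<^sub>m k * A"
proof (induction k)
  case (Suc k)
  have "A ^\<^sub>m k \<in> carrier_mat n n" using assms by simp
  then show ?case using Suc assms assoc_mult_mat[of A n n "A ^\<^sub>m k" n A n] by simp
qed (use assms in simp)

lemma mat_prod_concat_replicate:
  assumes "set Ms \<subseteq> carrier_mat n n"
  shows "mat_prod n (concat (replicate k Ms)) = mat_prod n Ms ^\<^sub>m k"
proof (induction k)
  case 0
  then show ?case using mat_prod_carrier[OF assms] by auto
next
  case (Suc k)
  have "set (concat (replicate k Ms)) \<subseteq> carrier_mat n n" using assms by (induction k) auto
  then have "mat_prod n (concat (replicate (Suc k) Ms)) = mat_prod n Ms * mat_prod n Ms ^\<^sub>m k"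
    using assms Suc by (simp add: mat_prod_append)
  also have "\<dots> = mat_prod n Ms ^\<^sub>m Suc k"
    using pow_mat_commute[OF mat_prod_carrier[OF assms]] by simp
  finally show ?case .
qed

lemma trace_mult_commute:
  fixes A B :: "'a :: comm_ring_1 mat"
  assumes "A \<in> carrier_mat n n" "B \<in> carrier_mat n n"
  shows "mat_trace (A * B) = mat_trace (B * A)"
proof -
  have tr: "mat_trace (U * V) = (\<Sum>i<n. \<Sum>j<n. U $$ (i, j) * V $$ (j, i))"
    if "U \<in> carrier_mat n n" "V \<in> carrier_mat n n" for U V :: "'a mat"
    using that unfolding mat_trace_def
    by (auto simp: scalar_prod_def atLeast0LessThan intro!: sum.cong)
  show ?thesis unfolding tr[OF assms] tr[OF assms(2,1)]
    by (subst sum.swap) (simp add: mult.commute)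
qed

lemma upper_triangular_mult:
  fixes U V :: "'a :: comm_ring_1 mat"
  assumes "U \<in> carrier_mat n n" "V \<in> carrier_mat n n" "upper_triangular U" "upper_triangular V"
  shows "upper_triangular (U * V)" "i < n \<Longrightarrow> (U * V) $$ (i, i) = U $$ (i, i) * V $$ (i, i)"
proof -
  have e: "(U * V) $$ (i, j) = (\<Sum>k<n. U $$ (i, k) * V $$ (k, j))" if "i < n" "j < n" for i j
    using that assms by (auto simp: scalar_prod_def atLeast0LessThan intro!: sum.cong)
  have z: "U $$ (i, k) = 0" if "k < i" "i < n" for i k using that assms by auto
  have z': "V $$ (i, k) = 0" if "k < i" "i < n" for i k using that assms by auto
  show "upper_triangular (U * V)"
  proof
    fix i j assume ij: "j < i" "i < dim_row (U * V)"
    then have "i < n" "j < n" using assms by auto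
    then have "(U * V) $$ (i, j) = (\<Sum>k<n. U $$ (i, k) * V $$ (k, j))" by (rule e)
    also have "\<dots> = 0"
    proof (rule sum.neutral, intro ballI)
      fix k assume "k \<in> {..<n}"
      then show "U $$ (i, k) * V $$ (k, j) = 0"
        using z[of k i] z'[of j k] ij \<open>i < n\<close> by (cases "k < i") auto
    qed
    finally show "(U * V) $$ (i, j) = 0" .
  qed
  show "(U * V) $$ (i, i) = U $$ (i, i) * V $$ (i, i)" if "i < n"
  proof -
    have "(U * V) $$ (i, i) = (\<Sum>k<n. if k = i then U $$ (i, i) * V $$ (i, i) else 0)"
      unfolding e[OF that that]
    proof (intro sum.cong HOL.refl)
      fix k assume "k \<in> {..<n}"
      then show "U $$ (i, k) * V $$ (k, i) = (if k = i then U $$ (i, i) * V $$ (i, i) else 0)"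
        using z[of k i] z'[of i k] that by (cases "k < i"; cases "i < k") auto
    qed
    then show ?thesis using that by simp
  qed
qed

lemma upper_triangular_pow:
  fixes U :: "'a :: comm_ring_1 mat"
  assumes "U \<in> carrier_mat n n" "upper_triangular U"
  shows "upper_triangular (U ^\<^sub>m m) \<and> (\<forall>i<n. (U ^\<^sub>m m) $$ (i, i) = (U $$ (i, i)) ^ m)"
proof (induction m)
  case 0
  then show ?case using assms by auto
next
  case (Suc m)
  have "U ^\<^sub>m m \<in> carrier_mat n n" using assms by simp
  then show ?case using upper_triangular_mult[of "U ^\<^sub>m m" n U] Suc assms by auto
qed

text \<open>The triangular form of the Cayley-Hamilton theorem: the factor of the last diagonal
  entry acts first and clears one more coordinate of the vector from the end.\<close>

lemma upper_triangular_annihilate: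
  fixes B :: "'a :: comm_ring_1 mat"
  assumes B: "B \<in> carrier_mat n n" "upper_triangular B"
    and "k \<le> n" "v \<in> carrier_vec n" "\<And>i. \<lbrakk>k \<le> i; i < n\<rbrakk> \<Longrightarrow> v $ i = 0"
  shows "mat_prod n (map (\<lambda>e. B - e \<cdot>\<^sub>m 1\<^sub>m n) (take k (diag_mat B))) *\<^sub>v v = 0\<^sub>v n"
  using assms(3-5)
proof (induction k arbitrary: v)
  case 0
  then have "v = 0\<^sub>v n" by (intro eq_vecI) auto
  then show ?case by simp
next
  case (Suc k)
  let ?G = "\<lambda>e. B - e \<cdot>\<^sub>m 1\<^sub>m n" and ?b = "diag_mat B ! k"
  have len: "length (diag_mat B) = n" using B by (simp add: diag_mat_def)
  have b: "?b = B $$ (k, k)" using B Suc.prems by (simp add: diag_mat_def)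
  have G: "?G e \<in> carrier_mat n n" for e using B by auto
  then have s: "set (map ?G es) \<subseteq> carrier_mat n n" for es by auto
  let ?w = "?G ?b *\<^sub>v v"
  have w: "?w \<in> carrier_vec n" by (rule mult_mat_vec_carrier[OF G Suc.prems(2)])
  have "?w $ i = 0" if i: "k \<le> i" "i < n" for i
  proof -
    have "?w $ i = (\<Sum>j<n. (B $$ (i, j) - ?b * (if i = j then 1 else 0)) * v $ j)"
      using i B Suc.prems by (auto simp: scalar_prod_def atLeast0LessThan intro!: sum.cong)
    also have "\<dots> = 0"
    proof (rule sum.neutral, intro ballI)
      fix j assume j: "j \<in> {..<n}"
      show "(B $$ (i, j) - ?b * (if i = j then 1 else 0)) * v $ j = 0"
      proof (cases "k < j")
        case True
        then show ?thesis using Suc.prems(3)[of j] j by simp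
      next
        case False
        then show ?thesis using i j b B(2) upper_triangularD[OF B(2), of j i] B(1)
          by (cases "i = j") auto
      qed
    qed
    finally show ?thesis .
  qed
  then have "mat_prod n (map ?G (take k (diag_mat B))) *\<^sub>v ?w = 0\<^sub>v n"
    using Suc w by simp
  moreover have "take (Suc k) (diag_mat B) = take k (diag_mat B) @ [?b]"
    using Suc.prems len by (simp add: take_Suc_conv_app_nth)
  moreover have "mat_prod n (map ?G (take k (diag_mat B) @ [?b]))
      = mat_prod n (map ?G (take k (diag_mat B))) * ?G ?b"
    using mat_prod_append[OF s s, of "take k (diag_mat B)" "[?b]"] G[of ?b] by simp
  ultimately show ?case
    using assoc_mult_mat_vec[OF mat_prod_carrier[OF s] G Suc.prems(2)] by simp
qed

text \<open>Determinant, power traces and Cayley-Hamilton are read off one Schur triangularisation,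
  so that they all refer to the same list of eigenvalues with multiplicities.\<close>

lemma eigenvalue_list:
  fixes T :: "complex mat"
  assumes T: "T \<in> carrier_mat n n"
  obtains es where "length es = n" "det T = prod_list es"
    "\<And>m. mat_trace (T ^\<^sub>m m) = (\<Sum>e\<leftarrow>es. e ^ m)"
    "\<And>e. e \<in> set es \<longleftrightarrow> eigenvalue T e"
    "\<And>v. v \<in> carrier_vec n \<Longrightarrow> mat_prod n (map (\<lambda>e. T - e \<cdot>\<^sub>m 1\<^sub>m n) es) *\<^sub>v v = 0\<^sub>v n"
proof -
  obtain es where es: "char_poly T = (\<Prod>a\<leftarrow>es. [:- a, 1:])" "length es = n"
    using char_poly_factorized[OF T] by blast
  obtain B P Q where sd: "schur_decomposition T es = (B, P, Q)" by (cases "schur_decomposition T es")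
  from schur_decomposition[OF T es(1) sd]
  have wit: "similar_mat_wit T B P Q" and ut: "upper_triangular B" and d: "diag_mat B = es" by auto
  from similar_mat_witD2[OF T wit]
  have c: "B \<in> carrier_mat n n" "P \<in> carrier_mat n n" "Q \<in> carrier_mat n n"
    and inv: "P * Q = 1\<^sub>m n" "Q * P = 1\<^sub>m n" and XB: "T = P * B * Q" by auto
  have "det T = det B" using det_similar wit by (auto simp: similar_mat_def)
  also have "\<dots> = prod_list es" using det_upper_triangular[OF ut c(1)] d by simp
  finally have det: "det T = prod_list es" .
  have tr: "mat_trace (T ^\<^sub>m m) = (\<Sum>e\<leftarrow>es. e ^ m)" for m
  proof -
    have Bm: "B ^\<^sub>m m \<in> carrier_mat n n" using c by simp
    have Xm: "T ^\<^sub>m m = P * (B ^\<^sub>m m * Q)"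
      using similar_mat_wit_pow_id[OF wit, of m] c Bm by (simp add: assoc_mult_mat[of _ n n _ n _ n])
    have "mat_trace (T ^\<^sub>m m) = mat_trace (B ^\<^sub>m m * Q * P)"
      unfolding Xm by (rule trace_mult_commute[OF c(2)]) (use c Bm in auto)
    also have "B ^\<^sub>m m * Q * P = B ^\<^sub>m m"
      using assoc_mult_mat[OF Bm c(3,2)] inv right_mult_one_mat[OF Bm] by simp
    also have "mat_trace (B ^\<^sub>m m) = (\<Sum>i<n. (B $$ (i, i)) ^ m)"
      using upper_triangular_pow[OF c(1) ut, of m] c(1) by (simp add: mat_trace_def)
    also have "\<dots> = (\<Sum>e\<leftarrow>es. e ^ m)"
      unfolding d[symmetric] diag_mat_def using c(1)
      by (simp add: interv_sum_list_conv_sum_set_nat atLeast0LessThan comp_def)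
    finally show ?thesis .
  qed
  have ev: "e \<in> set es \<longleftrightarrow> eigenvalue T e" for e
    unfolding eigenvalue_root_char_poly[OF T] es(1) by (auto simp: poly_prod_list prod_list_zero_iff)
  let ?F = "\<lambda>e. T - e \<cdot>\<^sub>m 1\<^sub>m n" and ?G = "\<lambda>e. B - e \<cdot>\<^sub>m 1\<^sub>m n"
  have G: "?G e \<in> carrier_mat n n" for e using c by auto
  then have s: "set (map ?G es) \<subseteq> carrier_mat n n" for es by auto
  have FG: "?F e = P * ?G e * Q" for e
  proof -
    have "P * ?G e * Q = (P * B - P * (e \<cdot>\<^sub>m 1\<^sub>m n)) * Q"
      using c by (subst mult_minus_distrib_mat[of _ n n]) auto
    also have "\<dots> = P * B * Q - P * (e \<cdot>\<^sub>m 1\<^sub>m n) * Q"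
      using c by (subst minus_mult_distrib_mat[of _ n n]) auto
    also have "P * (e \<cdot>\<^sub>m 1\<^sub>m n) * Q = e \<cdot>\<^sub>m 1\<^sub>m n"
      using mult_smult_distrib[OF c(2) one_carrier_mat, of e] mult_smult_assoc_mat[OF c(2) c(3), of e]
        right_mult_one_mat[OF c(2)] inv by simp
    finally show ?thesis using XB by simp
  qed
  have prodF: "mat_prod n (map ?F es) = P * mat_prod n (map ?G es) * Q" for es
  proof (induction es)
    case Nil
    then show ?case using inv c by simp
  next
    case (Cons e es)
    have m: "mat_prod n (map ?G es) \<in> carrier_mat n n" using s by (rule mat_prod_carrier)
    let ?m = "mat_prod n (map ?G es)"
    have PG: "P * ?G e \<in> carrier_mat n n" and mQ: "?m * Q \<in> carrier_mat n n"
      and Gm: "?G e * ?m \<in> carrier_mat n n"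
      using c G[of e] m by (auto intro!: mult_carrier_mat)
    have "(P * ?G e * Q) * (P * ?m * Q) = P * ?G e * (Q * (P * (?m * Q)))"
      using assoc_mult_mat[OF PG c(3) mult_carrier_mat[OF c(2) mQ]] assoc_mult_mat[OF c(2) m c(3)] by simp
    also have "Q * (P * (?m * Q)) = ?m * Q"
      using assoc_mult_mat[OF c(3,2) mQ] inv left_mult_one_mat[OF mQ] by simp
    also have "P * ?G e * (?m * Q) = P * (?G e * ?m) * Q"
      using assoc_mult_mat[OF PG m c(3)] assoc_mult_mat[OF c(2) G m] by simp
    finally show ?case using Cons FG by simp
  qed
  have ann: "mat_prod n (map ?F es) *\<^sub>v v = 0\<^sub>v n" if v: "v \<in> carrier_vec n" for v
  proof -
    have m: "mat_prod n (map ?G es) \<in> carrier_mat n n" using s by (rule mat_prod_carrier)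
    have "mat_prod n (map ?G (take n (diag_mat B))) *\<^sub>v (Q *\<^sub>v v) = 0\<^sub>v n"
      using c v by (intro upper_triangular_annihilate ut) auto
    then have "mat_prod n (map ?G es) *\<^sub>v (Q *\<^sub>v v) = 0\<^sub>v n" using d es(2) by simp
    moreover have "P * mat_prod n (map ?G es) \<in> carrier_mat n n" using c m by (rule_tac mult_carrier_mat) auto
    moreover have "P *\<^sub>v 0\<^sub>v n = 0\<^sub>v n" using c by (intro eq_vecI) auto
    ultimately show ?thesis unfolding prodF using c m v
      by (simp add: assoc_mult_mat_vec[of _ n n _ n])
  qed
  show thesis using that[OF es(2) det tr ev ann] .
qed

lemma eigenvalue_witness:
  assumes "T \<in> carrier_mat n n" "eigenvalue T e"
  obtains v where "v \<in> carrier_vec n" "v \<noteq> 0\<^sub>v n" "T *\<^sub>v v = e \<cdot>\<^sub>v v"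
  using assms by (auto simp: eigenvalue_def eigenvector_def)

lemma eigenvalueI:
  assumes "T \<in> carrier_mat n n" "v \<in> carrier_vec n" "v \<noteq> 0\<^sub>v n" "T *\<^sub>v v = e \<cdot>\<^sub>v v"
  shows "eigenvalue T e"
  using assms by (auto simp: eigenvalue_def eigenvector_def)

section \<open>Real symmetric matrices and eigenprojections\<close>

definition vec_ip :: "complex vec \<Rightarrow> complex vec \<Rightarrow> complex" where
  "vec_ip u w = (\<Sum>i<dim_vec u. u $ i * cnj (w $ i))"

lemma vec_ip_self_eq_0:
  assumes "u \<in> carrier_vec n" "vec_ip u u = 0" shows "u = 0\<^sub>v n"
proof (rule eq_vecI)
  have "complex_of_real (\<Sum>i<n. (cmod (u $ i))\<^sup>2) = 0"
    using assms unfolding vec_ip_def by (simp only: complex_norm_square carrier_vecD of_real_sum)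
  then have "(\<Sum>i<n. (cmod (u $ i))\<^sup>2) = 0" by (simp only: of_real_eq_0_iff)
  then have "\<forall>i\<in>{..<n}. (cmod (u $ i))\<^sup>2 = 0" by (subst (asm) sum_nonneg_eq_0_iff) auto
  then show "u $ i = 0\<^sub>v n $ i" if "i < dim_vec (0\<^sub>v n)" for i using that by simp
qed (use assms in simp)

lemma vec_ip_self: "vec_ip u u = of_real (\<Sum>i<dim_vec u. (cmod (u $ i))\<^sup>2)"
  unfolding vec_ip_def of_real_sum by (simp only: complex_norm_square)

lemma vec_ip_zero: "u \<in> carrier_vec n \<Longrightarrow> vec_ip u (0\<^sub>v n) = 0"
  by (simp add: vec_ip_def)

definition real_symmetric :: "complex mat \<Rightarrow> bool" where
  "real_symmetric C \<longleftrightarrow> (\<forall>i<dim_row C. \<forall>j<dim_row C. C $$ (i, j) = C $$ (j, i) \<and> cnj (C $$ (i, j)) = C $$ (i, j))"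

lemma real_symmetric_ip:
  assumes C: "C \<in> carrier_mat n n" "real_symmetric C" and u: "u \<in> carrier_vec n" and w: "w \<in> carrier_vec n"
  shows "vec_ip (C *\<^sub>v u) w = vec_ip u (C *\<^sub>v w)"
proof -
  have mv: "(C *\<^sub>v x) $ i = (\<Sum>j<n. C $$ (i, j) * x $ j)" if "i < n" "x \<in> carrier_vec n" for i x
    using that C(1) by (auto simp: scalar_prod_def atLeast0LessThan intro!: sum.cong)
  have "vec_ip (C *\<^sub>v u) w = (\<Sum>i<n. \<Sum>j<n. C $$ (i, j) * u $ j * cnj (w $ i))"
    unfolding vec_ip_def using C(1) u mv by (simp add: sum_distrib_right)
  also have "\<dots> = (\<Sum>j<n. \<Sum>i<n. C $$ (i, j) * u $ j * cnj (w $ i))" by (rule sum.swap)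
  also have "\<dots> = (\<Sum>j<n. u $ j * cnj ((C *\<^sub>v w) $ j))"
  proof (intro sum.cong HOL.refl)
    fix j assume j: "j \<in> {..<n}"
    have "cnj ((C *\<^sub>v w) $ j) = (\<Sum>i<n. C $$ (i, j) * cnj (w $ i))"
      using mv[of j w] j w C by (auto simp: real_symmetric_def intro!: sum.cong)
    then show "(\<Sum>i<n. C $$ (i, j) * u $ j * cnj (w $ i)) = u $ j * cnj ((C *\<^sub>v w) $ j)"
      by (simp add: sum_distrib_left algebra_simps)
  qed
  also have "\<dots> = vec_ip u (C *\<^sub>v w)" unfolding vec_ip_def using u by simp
  finally show ?thesis .
qed

lemma real_symmetric_nilpotent:
  assumes H: "H \<in> carrier_mat n n" "real_symmetric H" and u: "u \<in> carrier_vec n"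
    and "mat_prod n (replicate k H) *\<^sub>v u = 0\<^sub>v n"
  shows "H *\<^sub>v u = 0\<^sub>v n"
  using assms(4)
proof (induction k)
  case 0
  then show ?case using u H by (auto intro!: eq_vecI simp: scalar_prod_def)
next
  case (Suc k)
  have s: "set (replicate j H) \<subseteq> carrier_mat n n" for j using H by auto
  show ?case
  proof (cases k)
    case 0
    then show ?thesis using Suc.prems H by simp
  next
    case (Suc j)
    let ?y = "mat_prod n (replicate j H) *\<^sub>v u"
    have m: "mat_prod n (replicate j H) \<in> carrier_mat n n" by (rule mat_prod_carrier[OF s])
    have y: "?y \<in> carrier_vec n" by (rule mult_mat_vec_carrier[OF m u])
    have Hy: "H *\<^sub>v ?y \<in> carrier_vec n" by (rule mult_mat_vec_carrier[OF H(1) y])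
    have "H * (H * mat_prod n (replicate j H)) *\<^sub>v u = H *\<^sub>v (H *\<^sub>v ?y)"
      using assoc_mult_mat_vec[OF H(1) mult_carrier_mat[OF H(1) m] u] assoc_mult_mat_vec[OF H(1) m u] by simp
    then have "H *\<^sub>v (H *\<^sub>v ?y) = 0\<^sub>v n" using Suc.prems Suc by simp
    then have "vec_ip (H *\<^sub>v ?y) (H *\<^sub>v ?y) = vec_ip ?y (0\<^sub>v n)"
      using real_symmetric_ip[OF H y Hy] by simp
    also have "\<dots> = 0" using y by (rule vec_ip_zero)
    finally have "H *\<^sub>v ?y = 0\<^sub>v n" by (rule vec_ip_self_eq_0[OF Hy])
    then have "mat_prod n (replicate k H) *\<^sub>v u = 0\<^sub>v n"
      using assoc_mult_mat_vec[OF H(1) m u] Suc by simp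
    then show ?thesis by (rule Suc.IH)
  qed
qed

lemma mat_zeroI:
  assumes "A \<in> carrier_mat n n" "\<And>v. v \<in> carrier_vec n \<Longrightarrow> A *\<^sub>v v = 0\<^sub>v n"
  shows "A = (0\<^sub>m n n :: 'a :: comm_ring_1 mat)"
proof (rule eq_matI)
  fix i j assume ij: "i < dim_row (0\<^sub>m n n :: 'a mat)" "j < dim_col (0\<^sub>m n n :: 'a mat)"
  have "(A *\<^sub>v unit_vec n j) $ i = A $$ (i, j)" using assms(1) ij by simp
  then show "A $$ (i, j) = 0\<^sub>m n n $$ (i, j)" using assms(2)[of "unit_vec n j"] ij by simp
qed (use assms in auto)

text \<open>The projection is the Lagrange interpolation polynomial of the eigenvalue, evaluated at \<open>T\<close>.\<close>

lemma eigenprojection: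
  fixes T :: "complex mat"
  assumes T: "T \<in> carrier_mat n n" "real_symmetric T" and ev: "eigenvalue T (of_real l)"
  obtains P where "P \<in> carrier_mat n n" "P * P = P" "T * P = of_real l \<cdot>\<^sub>m P"
    "\<exists>v. v \<in> carrier_vec n \<and> v \<noteq> 0\<^sub>v n \<and> P *\<^sub>v v = v"
    "\<And>M. \<lbrakk>M \<in> carrier_mat n n; M * T = T * M\<rbrakk> \<Longrightarrow> M * P = P * M"
proof -
  let ?l = "complex_of_real l"
  obtain es where es: "\<And>e. e \<in> set es \<longleftrightarrow> eigenvalue T e"
    and ann: "\<And>v. v \<in> carrier_vec n \<Longrightarrow> mat_prod n (map (\<lambda>e. T - e \<cdot>\<^sub>m 1\<^sub>m n) es) *\<^sub>v v = 0\<^sub>v n"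
    using eigenvalue_list[OF T(1)] by metis
  define F where "F e = T - e \<cdot>\<^sub>m 1\<^sub>m n" for e
  have F: "F e \<in> carrier_mat n n" for e using T(1) by (auto simp: F_def)
  have s: "set (map F xs) \<subseteq> carrier_mat n n" for xs using F by auto
  have commF: "M * F e = F e * M" if "M \<in> carrier_mat n n" "M * T = T * M" for M e
  proof -
    have "M * F e = M * T - M * (e \<cdot>\<^sub>m 1\<^sub>m n)"
      unfolding F_def using that T(1) by (intro mult_minus_distrib_mat[of _ n n]) auto
    also have "\<dots> = T * M - (e \<cdot>\<^sub>m 1\<^sub>m n) * M"
      using that mult_smult_distrib[OF that(1) one_carrier_mat, of e] mult_smult_assoc_mat[OF one_carrier_mat that(1), of e]
        right_mult_one_mat[OF that(1)] left_mult_one_mat[OF that(1)] by simp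
    also have "\<dots> = F e * M"
      unfolding F_def using that T(1) by (intro minus_mult_distrib_mat[symmetric, of _ n n]) auto
    finally show ?thesis .
  qed
  have FX: "F e * T = T * F e" for e using commF[OF T(1)] by simp
  have FF: "F x * F y = F y * F x" for x y using commF[OF F FX] by simp
  have Fv: "F e *\<^sub>v v = (m - e) \<cdot>\<^sub>v v" if "v \<in> carrier_vec n" "T *\<^sub>v v = m \<cdot>\<^sub>v v" for e m v
  proof -
    have "F e *\<^sub>v v = T *\<^sub>v v - (e \<cdot>\<^sub>m 1\<^sub>m n) *\<^sub>v v"
      unfolding F_def using that T(1) by (intro minus_mult_distrib_mat_vec[of _ n n]) auto
    also have "(e \<cdot>\<^sub>m 1\<^sub>m n) *\<^sub>v v = e \<cdot>\<^sub>v v" using that by (auto intro!: eq_vecI)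
    finally show ?thesis using that by (auto intro!: eq_vecI simp: algebra_simps)
  qed
  define fs where "fs = filter (\<lambda>e. e \<noteq> ?l) es"
  define R where "R = mat_prod n (map F fs)"
  have R: "R \<in> carrier_mat n n" unfolding R_def by (rule mat_prod_carrier[OF s])
  define k where "k = length (filter (\<lambda>e. e = ?l) es)"
  have repl: "map F (filter (\<lambda>e. e = ?l) es) = replicate k (F ?l)"
    unfolding k_def by (induction es) auto
  have total: "mat_prod n (map F es) = mat_prod n (replicate k (F ?l)) * R"
    using mat_prod_filter[where F = F and xs = es and R = "\<lambda>e. e = ?l", OF F FF] unfolding repl R_def fs_def
        by simp
  have rk: "mat_prod n (replicate k (F ?l)) \<in> carrier_mat n n"
    using mat_prod_carrier[OF s, of "replicate k ?l"] by simp
  have sym: "real_symmetric (F ?l)"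
    using T unfolding real_symmetric_def F_def by auto
  \<comment> \<open>Cayley-Hamilton gives this with a power of \<open>F ?l\<close> in front of
    \<open>R\<close>; symmetry reduces the power to a single factor.\<close>
  have FlR: "F ?l * R = 0\<^sub>m n n"
  proof (rule mat_zeroI)
    show "F ?l * R \<in> carrier_mat n n" using F R by (rule mult_carrier_mat)
    fix v :: "complex vec" assume v: "v \<in> carrier_vec n"
    have Rv: "R *\<^sub>v v \<in> carrier_vec n" using R v by (rule mult_mat_vec_carrier)
    have "mat_prod n (replicate k (F ?l)) *\<^sub>v (R *\<^sub>v v) = 0\<^sub>v n"
      using ann[OF v] total assoc_mult_mat_vec[OF rk R v] by (simp add: F_def[abs_def])
    then have "F ?l *\<^sub>v (R *\<^sub>v v) = 0\<^sub>v n" by (rule real_symmetric_nilpotent[OF F sym Rv])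
    then show "F ?l * R *\<^sub>v v = 0\<^sub>v n" using assoc_mult_mat_vec[OF F R v] by simp
  qed
  have XR: "T * R = ?l \<cdot>\<^sub>m R"
  proof -
    have "F ?l * R = T * R - (?l \<cdot>\<^sub>m 1\<^sub>m n) * R"
      unfolding F_def using T(1) R by (intro minus_mult_distrib_mat[of _ n n]) auto
    also have "(?l \<cdot>\<^sub>m 1\<^sub>m n) * R = ?l \<cdot>\<^sub>m R"
      using mult_smult_assoc_mat[OF one_carrier_mat R, of ?l] left_mult_one_mat[OF R] by simp
    finally have z: "T * R - ?l \<cdot>\<^sub>m R = 0\<^sub>m n n" using FlR by simp
    show ?thesis
    proof (rule eq_matI)
      fix i j assume "i < dim_row (?l \<cdot>\<^sub>m R)" "j < dim_col (?l \<cdot>\<^sub>m R)"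
      then have ij: "i < n" "j < n" using R by auto
      have "(T * R - ?l \<cdot>\<^sub>m R) $$ (i, j) = 0" unfolding z using ij by simp
      then show "(T * R) $$ (i, j) = (?l \<cdot>\<^sub>m R) $$ (i, j)" using ij R T(1) by simp
    qed (use R T(1) in auto)
  qed
  \<comment> \<open>The value at \<open>?l\<close> of the polynomial that defines \<open>R\<close>.
    It is nonzero because \<open>fs\<close> omits \<open>?l\<close>, and dividing by it makes
    \<open>R\<close> idempotent.\<close>
  define q where "q = prod_list (map (\<lambda>e. ?l - e) fs)"
  have q: "q \<noteq> 0" by (auto simp: q_def fs_def prod_list_zero_iff)
  have FR: "F e * R = (?l - e) \<cdot>\<^sub>m R" for e
  proof -
    have "F e * R = T * R - (e \<cdot>\<^sub>m 1\<^sub>m n) * R"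
      unfolding F_def using T(1) R by (intro minus_mult_distrib_mat[of _ n n]) auto
    also have "(e \<cdot>\<^sub>m 1\<^sub>m n) * R = e \<cdot>\<^sub>m R"
      using mult_smult_assoc_mat[OF one_carrier_mat R, of e] left_mult_one_mat[OF R] by simp
    finally show ?thesis unfolding XR using R by (auto intro!: eq_matI simp: algebra_simps)
  qed
  have prodR: "mat_prod n (map F xs) * R = prod_list (map (\<lambda>e. ?l - e) xs) \<cdot>\<^sub>m R" for xs
  proof (induction xs)
    case Nil
    then show ?case using R by (auto intro!: eq_matI)
  next
    case (Cons x xs)
    have "F x * mat_prod n (map F xs) * R = F x * (prod_list (map (\<lambda>e. ?l - e) xs) \<cdot>\<^sub>m R)"
      using assoc_mult_mat[OF F mat_prod_carrier[OF s] R] Cons by simp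
    also have "\<dots> = prod_list (map (\<lambda>e. ?l - e) xs) \<cdot>\<^sub>m ((?l - x) \<cdot>\<^sub>m R)"
      using mult_smult_distrib[OF F R] FR by simp
    finally show ?case using R by (auto intro!: eq_matI simp: algebra_simps)
  qed
  have RR: "R * R = q \<cdot>\<^sub>m R" using prodR[of fs] by (simp add: R_def q_def)
  define P where "P = (1 / q) \<cdot>\<^sub>m R"
  have P: "P \<in> carrier_mat n n" using R by (simp add: P_def)
  have PP: "P * P = P"
    unfolding P_def using mult_smult_distrib[of "(1 / q) \<cdot>\<^sub>m R" n n R n "1 / q"] mult_smult_assoc_mat[OF R R, of "1 / q"] R RR q
    by (auto intro!: eq_matI)
  have XP: "T * P = ?l \<cdot>\<^sub>m P"
    unfolding P_def using mult_smult_distrib[OF T(1) R] XR R by (auto intro!: eq_matI)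
  obtain v where v: "v \<in> carrier_vec n" "v \<noteq> 0\<^sub>v n" "T *\<^sub>v v = ?l \<cdot>\<^sub>v v"
    using eigenvalue_witness[OF T(1) ev] by metis
  have "R *\<^sub>v v = prod_list (map (\<lambda>e. ?l - e) fs) \<cdot>\<^sub>v v"
  proof -
    have "mat_prod n (map F xs) *\<^sub>v v = prod_list (map (\<lambda>e. ?l - e) xs) \<cdot>\<^sub>v v" for xs
    proof (induction xs)
      case (Cons x xs)
      have "F x * mat_prod n (map F xs) *\<^sub>v v = F x *\<^sub>v (prod_list (map (\<lambda>e. ?l - e) xs) \<cdot>\<^sub>v v)"
        using assoc_mult_mat_vec[OF F mat_prod_carrier[OF s] v(1)] Cons by simp
      also have "\<dots> = prod_list (map (\<lambda>e. ?l - e) xs) \<cdot>\<^sub>v ((?l - x) \<cdot>\<^sub>v v)"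
        using mult_mat_vec[OF F v(1)] Fv[OF v(1,3)] by simp
      finally show ?case by (simp add: smult_smult_assoc mult.commute)
    qed (use v in simp)
    then show ?thesis by (simp add: R_def)
  qed
  moreover have "P *\<^sub>v v = (1 / q) \<cdot>\<^sub>v (R *\<^sub>v v)"
    unfolding P_def using v R by (auto intro!: eq_vecI)
  ultimately have Pv: "P *\<^sub>v v = v"
    using q by (simp add: q_def[symmetric] smult_smult_assoc)
  have comm: "M * P = P * M" if M: "M \<in> carrier_mat n n" "M * T = T * M" for M
  proof -
    have "M * R = R * M"
      unfolding R_def using commF[OF M] s by (intro mat_prod_commute M) auto
    then show ?thesis
      unfolding P_def using mult_smult_distrib[OF M(1) R] mult_smult_assoc_mat[OF R M(1)] by simp
  qed
  show thesis using that[OF P PP XP _ comm] v Pv by blast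
qed

subsection \<open>Eigenvalues of products of Hecke generators\<close>

lemma cmod_prod_list_powr:
  assumes "Q > 0" "\<And>e. e \<in> set es \<Longrightarrow> \<exists>j::int. \<bar>j\<bar> \<le> int b \<and> cmod e = Q powr of_int j"
  shows "\<exists>j::int. \<bar>j\<bar> \<le> int (b * length es) \<and> cmod (prod_list es) = Q powr of_int j"
  using assms(2)
proof (induction es)
  case Nil
  then show ?case using assms(1) by (intro exI[of _ 0]) simp
next
  case (Cons e es)
  obtain j where j: "\<bar>j\<bar> \<le> int b" "cmod e = Q powr of_int j" using Cons.prems by auto
  obtain i where i: "\<bar>i\<bar> \<le> int (b * length es)" "cmod (prod_list es) = Q powr of_int i"
    using Cons by auto
  have "\<bar>j + i\<bar> \<le> int (b * length (e # es))" using j i by simp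
  moreover have "cmod (prod_list (e # es)) = Q powr of_int (j + i)"
    using j i by (simp add: norm_mult powr_add)
  ultimately show ?case by blast
qed

lemma det_mat_prod:
  assumes "set Ms \<subseteq> carrier_mat n n" shows "det (mat_prod n Ms) = prod_list (map det Ms)"
  using assms
proof (induction Ms)
  case (Cons M Ms)
  then show ?case using det_mult[of M n "mat_prod n Ms"] by simp
qed simp

lemma det_eigenvalues:
  fixes T :: "complex mat"
  assumes "T \<in> carrier_mat n n"
  shows "\<exists>es. length es = n \<and> det T = prod_list es \<and> (\<forall>e. e \<in> set es \<longleftrightarrow> eigenvalue T e)"
  by (rule eigenvalue_list[OF assms]) blast

locale eigenprojection_system =
  fixes n :: nat and P :: "complex mat"
  assumes P: "P \<in> carrier_mat n n" and PP: "P * P = P"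
begin

definition Z :: "complex mat" where "Z = 1\<^sub>m n - P"

lemma Z: "Z \<in> carrier_mat n n"
  using P unfolding Z_def by auto

lemma PZ: "P * Z = 0\<^sub>m n n"
proof -
  have "P * Z = P * 1\<^sub>m n - P * P" unfolding Z_def by (rule mult_minus_distrib_mat[OF P one_carrier_mat P])
  then show ?thesis using P PP by simp
qed

lemma ZP: "Z * P = 0\<^sub>m n n"
proof -
  have "Z * P = 1\<^sub>m n * P - P * P" unfolding Z_def by (rule minus_mult_distrib_mat[OF one_carrier_mat P P])
  then show ?thesis using P PP by simp
qed

lemma ZZ: "Z * Z = Z"
proof -
  have "Z * Z = 1\<^sub>m n * Z - P * Z" 
    by (subst (1) Z_def) (rule minus_mult_distrib_mat[OF one_carrier_mat P Z])
  then show ?thesis using Z PZ left_mult_one_mat[OF Z] by (auto intro!: eq_matI)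
qed

lemma Z_vec: "v \<in> carrier_vec n \<Longrightarrow> Z *\<^sub>v v = v - P *\<^sub>v v"
  unfolding Z_def using minus_mult_distrib_mat_vec[OF one_carrier_mat P, of v] by simp

text \<open>For \<open>M\<close> commuting with \<open>P\<close> this acts as \<open>M\<close> on
  the range of \<open>P\<close> and as the identity on the kernel. Its determinant is thus the
  determinant of the restriction to the range, without choosing a basis there.\<close>

definition Y :: "complex mat \<Rightarrow> complex mat" where "Y M = M * P + Z"

lemma Y_carrier: "M \<in> carrier_mat n n \<Longrightarrow> Y M \<in> carrier_mat n n"
  unfolding Y_def using Z P by (intro add_carrier_mat) auto

lemma Y_mult:
  assumes "M \<in> carrier_mat n n" "N \<in> carrier_mat n n" "N * P = P * N"
  shows "Y M * Y N = Y (M * N)"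
proof -
  have MP: "M * P \<in> carrier_mat n n" and NP: "N * P \<in> carrier_mat n n"
    using assms P by auto
  have a: "(M * P) * (N * P) = (M * N) * P"
  proof -
    have "(M * P) * (N * P) = M * (P * (P * N))" using assoc_mult_mat[OF assms(1) P NP] assms(3) by simp
    also have "P * (P * N) = N * P" using assoc_mult_mat[OF P P assms(2)] PP assms(3) by simp
    finally show ?thesis using assoc_mult_mat[OF assms(1,2) P] by simp
  qed
  have b: "(M * P) * Z = 0\<^sub>m n n"
    using assoc_mult_mat[OF assms(1) P Z] PZ assms(1) by simp
  have c: "Z * (N * P) = 0\<^sub>m n n"
    using assoc_mult_mat[OF Z P assms(2)] ZP assms(2,3) by simp
  have "Y M * Y N = (M * P) * Y N + Z * Y N"
    unfolding Y_def[of M] by (rule add_mult_distrib_mat[OF MP Z Y_carrier[OF assms(2)]])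
  also have "(M * P) * Y N = (M * P) * (N * P) + (M * P) * Z"
    unfolding Y_def by (rule mult_add_distrib_mat[OF MP NP Z])
  also have "Z * Y N = Z * (N * P) + Z * Z"
    unfolding Y_def by (rule mult_add_distrib_mat[OF Z NP Z])
  finally show ?thesis
    unfolding a b c ZZ Y_def using Z assms(1,2) P by (auto intro!: eq_matI)
qed

lemma mat_prod_Y:
  assumes "set Ms \<subseteq> carrier_mat n n" "\<And>M. M \<in> set Ms \<Longrightarrow> M * P = P * M"
  shows "mat_prod n (map Y Ms) = Y (mat_prod n Ms)"
  using assms
proof (induction Ms)
  case Nil
  then show ?case unfolding Y_def Z_def using P by (auto intro!: eq_matI)
next
  case (Cons M Ms)
  have "P * mat_prod n Ms = mat_prod n Ms * P"
    using Cons.prems by (intro mat_prod_commute P) auto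
  then show ?case using Cons Y_mult[of M "mat_prod n Ms"] by simp
qed

text \<open>Project an eigenvector to the range of \<open>P\<close>. If the projection vanishes, the
  vector lies in the kernel, where \<open>Y M\<close> is the identity.\<close>

lemma Y_eigenvalue:
  assumes M: "M \<in> carrier_mat n n" "M * P = P * M" and ev: "eigenvalue (Y M) e"
  shows "e = 1 \<or> (\<exists>w. w \<in> carrier_vec n \<and> w \<noteq> 0\<^sub>v n \<and> P *\<^sub>v w = w \<and> M *\<^sub>v w = e \<cdot>\<^sub>v w)"
proof -
  obtain v where v: "v \<in> carrier_vec n" "v \<noteq> 0\<^sub>v n" "Y M *\<^sub>v v = e \<cdot>\<^sub>v v"
    using eigenvalue_witness[OF Y_carrier[OF M(1)] ev] by metis
  let ?w = "P *\<^sub>v v"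
  have w: "?w \<in> carrier_vec n" by (rule mult_mat_vec_carrier[OF P v(1)])
  have Mw: "M *\<^sub>v ?w \<in> carrier_vec n" by (rule mult_mat_vec_carrier[OF M(1) w])
  have MP: "M * P \<in> carrier_mat n n" using M P by auto
  have Yv: "Y M *\<^sub>v v = M *\<^sub>v ?w + (v - ?w)"
    unfolding Y_def using add_mult_distrib_mat_vec[OF MP Z v(1)] Z_vec[OF v(1)] assoc_mult_mat_vec[OF M(1) P v(1)] by simp
  have PY: "P * Y M = M * P"
  proof -
    have "P * Y M = P * (M * P) + P * Z" unfolding Y_def by (rule mult_add_distrib_mat[OF P MP Z])
    also have "P * (M * P) = M * P"
      using assoc_mult_mat[OF P M(1) P] assoc_mult_mat[OF M(1) P P] M(2) PP by simp
    finally show ?thesis unfolding PZ using MP by simp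
  qed
  have Pw: "P *\<^sub>v ?w = ?w" using assoc_mult_mat_vec[OF P P v(1)] PP by simp
  have "M *\<^sub>v ?w = P *\<^sub>v (Y M *\<^sub>v v)"
    using assoc_mult_mat_vec[OF P Y_carrier[OF M(1)] v(1)] assoc_mult_mat_vec[OF M(1) P v(1)] PY by simp
  also have "\<dots> = e \<cdot>\<^sub>v ?w" unfolding v(3) by (rule mult_mat_vec[OF P v(1)])
  finally have Mw_eq: "M *\<^sub>v ?w = e \<cdot>\<^sub>v ?w" .
  show ?thesis
  proof (cases "?w = 0\<^sub>v n")
    case True
    have "e \<cdot>\<^sub>v v = v" using Yv v Mw_eq True by auto
    obtain i where i: "i < n" "v $ i \<noteq> 0"
    proof (rule ccontr)
      assume "\<not> thesis"
      then have "v = 0\<^sub>v n" using that v(1) by (intro eq_vecI) auto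
      then show False using v by simp
    qed
    have "(e \<cdot>\<^sub>v v) $ i = v $ i" using \<open>e \<cdot>\<^sub>v v = v\<close> by simp
    then show ?thesis using i v(1) by simp
  qed (use w Pw Mw_eq in blast)
qed

end

lemma smult_mat_mult_vec:
  fixes M :: "complex mat"
  assumes "M \<in> carrier_mat n n" "w \<in> carrier_vec n" shows "(k \<cdot>\<^sub>m M) *\<^sub>v w = k \<cdot>\<^sub>v (M *\<^sub>v w)"
  using assms by (auto intro!: eq_vecI)

lemma smult_vec_cancel:
  fixes v :: "complex vec"
  assumes "v \<in> carrier_vec n" "v \<noteq> 0\<^sub>v n" "a \<cdot>\<^sub>v v = b \<cdot>\<^sub>v v" shows "a = b"
proof -
  obtain i where i: "i < n" "v $ i \<noteq> 0"
  proof (rule ccontr)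
    assume "\<not> thesis"
    then have "v = 0\<^sub>v n" using that assms(1) by (intro eq_vecI) auto
    then show False using assms by simp
  qed
  have "(a \<cdot>\<^sub>v v) $ i = (b \<cdot>\<^sub>v v) $ i" using assms(3) by simp
  then show ?thesis using i assms(1) by simp
qed

lemma hecke_eigenvalue:
  fixes Q :: real and M :: "complex mat"
  assumes Q: "Q > 0" and M: "M \<in> carrier_mat n n"
    and quad: "M * M = 1\<^sub>m n + of_real (Q - 1 / Q) \<cdot>\<^sub>m M"
    and w: "w \<in> carrier_vec n" "w \<noteq> 0\<^sub>v n" "M *\<^sub>v w = e \<cdot>\<^sub>v w"
  shows "e = of_real Q \<or> e = - of_real (1 / Q)"
proof -
  let ?z = "complex_of_real (Q - 1 / Q)"
  have "(M * M) *\<^sub>v w = M *\<^sub>v (e \<cdot>\<^sub>v w)" using assoc_mult_mat_vec[OF M M w(1)] w by simp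
  also have "\<dots> = (e * e) \<cdot>\<^sub>v w" unfolding mult_mat_vec[OF M w(1)] w(3) by (simp add: smult_smult_assoc)
  finally have 1: "(M * M) *\<^sub>v w = (e * e) \<cdot>\<^sub>v w" .
  have zM: "?z \<cdot>\<^sub>m M \<in> carrier_mat n n" using M by simp
  have "(?z \<cdot>\<^sub>m M) *\<^sub>v w = ?z \<cdot>\<^sub>v (M *\<^sub>v w)" by (rule smult_mat_mult_vec[OF M w(1)])
  then have "(M * M) *\<^sub>v w = w + ?z \<cdot>\<^sub>v (e \<cdot>\<^sub>v w)"
    unfolding quad using add_mult_distrib_mat_vec[OF one_carrier_mat zM w(1)] w by simp
  also have "\<dots> = (1 + ?z * e) \<cdot>\<^sub>v w" using w(1) by (intro eq_vecI) (auto simp: algebra_simps)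
  finally have "e * e = 1 + ?z * e" using smult_vec_cancel[OF w(1,2)] 1 by metis
  moreover have "complex_of_real Q * of_real (1 / Q) = 1" using Q by (simp flip: of_real_mult)
  moreover have "(e - of_real Q) * (e + of_real (1 / Q)) = e * e - ?z * e - of_real Q * of_real (1 / Q)"
    unfolding of_real_diff by (simp only: algebra_simps)
  ultimately have "(e - of_real Q) * (e + of_real (1 / Q)) = 0" by simp
  then show ?thesis by (auto simp: eq_neg_iff_add_eq_0)
qed

text \<open>On the eigenspace of \<open>l\<close> the product is the scalar \<open>l\<close>, so its
  determinant there is a power of \<open>l\<close>. It is also the product of the determinants of
  the factors, whose eigenvalues have modulus \<open>Q\<close>, \<open>1 / Q\<close> or 1. The
  bounds on \<open>j\<close> and \<open>d\<close> do not involve \<open>Q\<close>; the later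
  finiteness argument depends on this.\<close>

lemma central_product_eigenvalue:
  fixes Q l :: real
  assumes Q: "Q > 0" and Ms: "set Ms \<subseteq> carrier_mat n n"
    and quad: "\<And>M. M \<in> set Ms \<Longrightarrow> M * M = 1\<^sub>m n + of_real (Q - 1 / Q) \<cdot>\<^sub>m M"
    and central: "\<And>M. M \<in> set Ms \<Longrightarrow> M * mat_prod n Ms = mat_prod n Ms * M"
    and sym: "real_symmetric (mat_prod n Ms)"
    and ev: "eigenvalue (mat_prod n Ms) (of_real l)" and l: "l \<ge> 0"
  shows "\<exists>(j::int) d. 1 \<le> d \<and> d \<le> n \<and> \<bar>j\<bar> \<le> int (n * length Ms) \<and> l = Q powr (of_int j / real d)"
proof -
  let ?T = "mat_prod n Ms" and ?l = "complex_of_real l"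
  have T: "?T \<in> carrier_mat n n" by (rule mat_prod_carrier[OF Ms])
  obtain P v where Pf: "P \<in> carrier_mat n n" "P * P = P" "?T * P = ?l \<cdot>\<^sub>m P"
    and v: "v \<in> carrier_vec n" "v \<noteq> 0\<^sub>v n" "P *\<^sub>v v = v"
    and comm: "\<And>M. \<lbrakk>M \<in> carrier_mat n n; M * ?T = ?T * M\<rbrakk> \<Longrightarrow> M * P = P * M"
    using eigenprojection[OF T sym ev] by metis
  interpret eigenprojection_system n P by unfold_locales (use Pf in auto)
  have MP: "M * P = P * M" if "M \<in> set Ms" for M using that Ms central comm by auto
  have XP: "?T * P = P * ?T" using comm[OF T] by simp
  have n: "n \<ge> 1"
  proof (rule ccontr)
    assume "\<not> n \<ge> 1"
    then have "v = 0\<^sub>v n" using v(1) by (intro eq_vecI) auto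
    then show False using v by simp
  qed
  have detY: "\<exists>j::int. \<bar>j\<bar> \<le> int n \<and> cmod (det (Y M)) = Q powr of_int j" if M: "M \<in> set Ms" for M
  proof -
    have Mc: "M \<in> carrier_mat n n" using M Ms by auto
    obtain es where es: "length es = n" "det (Y M) = prod_list es" "\<And>e. e \<in> set es \<longleftrightarrow> eigenvalue (Y M) e"
      using det_eigenvalues[OF Y_carrier[OF Mc]] by blast
    have "\<exists>j::int. \<bar>j\<bar> \<le> int 1 \<and> cmod e = Q powr of_int j" if "e \<in> set es" for e
    proof -
      have "e = 1 \<or> e = of_real Q \<or> e = - of_real (1 / Q)"
        using Y_eigenvalue[OF Mc MP[OF M], of e] es(3) that hecke_eigenvalue[OF Q Mc quad[OF M]] by blast
      then show ?thesis
      proof (elim disjE)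
        assume "e = 1"
        then show ?thesis using Q by (intro exI[of _ 0]) simp
      next
        assume "e = of_real Q"
        then show ?thesis using Q by (intro exI[of _ 1]) simp
      next
        assume "e = - of_real (1 / Q)"
        then show ?thesis using Q by (intro exI[of _ "-1"]) (simp add: powr_minus_divide norm_divide)
      qed
    qed
    then have "\<exists>j::int. \<bar>j\<bar> \<le> int (1 * length es) \<and> cmod (prod_list es) = Q powr of_int j"
      by (intro cmod_prod_list_powr Q) auto
    then show ?thesis using es by simp
  qed
  have "set (map Y Ms) \<subseteq> carrier_mat n n" using Ms Y_carrier by auto
  then have "det (Y ?T) = prod_list (map det (map Y Ms))"
    using mat_prod_Y[OF Ms MP] det_mat_prod by metis
  moreover have "\<exists>j::int. \<bar>j\<bar> \<le> int (n * length (map det (map Y Ms))) \<and>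
      cmod (prod_list (map det (map Y Ms))) = Q powr of_int j"
    using detY by (intro cmod_prod_list_powr Q) auto
  ultimately obtain j :: int where j: "\<bar>j\<bar> \<le> int (n * length Ms)" "cmod (det (Y ?T)) = Q powr of_int j"
    by auto
  obtain es where es: "length es = n" "det (Y ?T) = prod_list es" "\<And>e. e \<in> set es \<longleftrightarrow> eigenvalue (Y ?T) e"
    using det_eigenvalues[OF Y_carrier[OF T]] by blast
  have es1: "e = 1 \<or> e = ?l" if "e \<in> set es" for e
  proof -
    have "eigenvalue (Y ?T) e" using es(3) that by simp
    from Y_eigenvalue[OF T XP this]
    consider "e = 1" | w where "w \<in> carrier_vec n" "w \<noteq> 0\<^sub>v n" "P *\<^sub>v w = w" "?T *\<^sub>v w = e \<cdot>\<^sub>v w"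
      by blast
    then show ?thesis
    proof cases
      case 2
      have "?T *\<^sub>v w = (?T * P) *\<^sub>v w" using assoc_mult_mat_vec[OF T Pf(1) 2(1)] 2(3) by simp
      also have "\<dots> = ?l \<cdot>\<^sub>v (P *\<^sub>v w)" unfolding Pf(3) by (rule smult_mat_mult_vec[OF Pf(1) 2(1)])
      finally have "e \<cdot>\<^sub>v w = ?l \<cdot>\<^sub>v w" using 2(3,4) by simp
      from smult_vec_cancel[OF 2(1,2) this] show ?thesis by simp
    qed simp
  qed
  \<comment> \<open>The multiplicity of \<open>?l\<close>, except that for \<open>l = 1\<close> the
    kernel of \<open>P\<close> contributes as well; that case is settled by the exponent 0.\<close>
  define d where "d = length (filter (\<lambda>e. e = ?l) es)"
  have "prod_list xs = ?l ^ length (filter (\<lambda>e. e = ?l) xs)" if "\<And>e. e \<in> set xs \<Longrightarrow> e = 1 \<or> e = ?l" for xs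
    using that by (induction xs) auto
  then have "det (Y ?T) = ?l ^ d" using es1 es(2) by (simp add: d_def)
  then have ld: "l ^ d = Q powr of_int j" using j(2) l by (simp add: norm_power)
  have dn: "d \<le> n" unfolding d_def es(1)[symmetric] by (rule length_filter_le)
  show ?thesis
  proof (cases "l = 1")
    case True
    then show ?thesis using n Q by (intro exI[of _ 0] exI[of _ 1]) simp
  next
    case False
    have "eigenvalue (Y ?T) ?l"
    proof (rule eigenvalueI[OF Y_carrier[OF T] v(1,2)])
      have XPc: "?T * P \<in> carrier_mat n n" using T Pf(1) by auto
      have "Y ?T *\<^sub>v v = (?T * P) *\<^sub>v v + Z *\<^sub>v v"
        unfolding Y_def by (rule add_mult_distrib_mat_vec[OF XPc Z v(1)])
      also have "(?T * P) *\<^sub>v v = ?l \<cdot>\<^sub>v v"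
        unfolding Pf(3) using smult_mat_mult_vec[OF Pf(1) v(1), of ?l] v(3) by simp
      also have "Z *\<^sub>v v = v - v" using Z_vec[OF v(1)] v(3) by simp
      finally show "Y ?T *\<^sub>v v = ?l \<cdot>\<^sub>v v" using v(1) by simp
    qed
    then have "?l \<in> set (filter (\<lambda>e. e = ?l) es)" using es(3) by simp
    then have "0 < d" unfolding d_def by (rule length_pos_if_in_set)
    then have d1: "d \<ge> 1" by simp
    have "l \<noteq> 0"
    proof
      assume "l = 0"
      then have "l ^ d = 0" using d1 by (simp add: power_0_left)
      then show False using ld Q by simp
    qed
    then have lp: "l > 0" using l by simp
    then have "l = (l powr real d) powr (1 / real d)" using d1 by (simp add: powr_powr)
    also have "\<dots> = (Q powr of_int j) powr (1 / real d)" using lp ld by (simp add: powr_realpow)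
    also have "\<dots> = Q powr (of_int j / real d)" by (simp add: powr_powr)
    finally show ?thesis using d1 dn j(1) by blast
  qed
qed

lemma real_symmetric_square:
  assumes C: "C \<in> carrier_mat n n" "real_symmetric C" shows "real_symmetric (C * C)"
proof -
  have e: "(C * C) $$ (i, j) = (\<Sum>k<n. C $$ (i, k) * C $$ (k, j))" if "i < n" "j < n" for i j
    using that C(1) by (auto simp: scalar_prod_def atLeast0LessThan intro!: sum.cong)
  have s: "C $$ (i, j) = C $$ (j, i)" "cnj (C $$ (i, j)) = C $$ (i, j)" if "i < n" "j < n" for i j
    using C that unfolding real_symmetric_def by auto
  have "(C * C) $$ (i, j) = (C * C) $$ (j, i)" if "i < n" "j < n" for i j
    unfolding e[OF that] e[OF that(2,1)]
    by (intro sum.cong HOL.refl) (use that in \<open>simp add: s(1)[of i] s(1)[of j] mult.commute\<close>)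
  moreover have "cnj ((C * C) $$ (i, j)) = (C * C) $$ (i, j)" if "i < n" "j < n" for i j
    unfolding e[OF that] cnj_sum complex_cnj_mult
    by (intro sum.cong HOL.refl) (use that in \<open>simp add: s(2)\<close>)
  ultimately show ?thesis using C(1) unfolding real_symmetric_def by simp
qed

text \<open>For an eigenvector \<open>v\<close> the squared norm of \<open>C *\<^sub>v v\<close> is
  the conjugate of the eigenvalue times the squared norm of \<open>v\<close>. Nonnegativity matters
  because it lets \<open>l\<close> be recovered from a power of it.\<close>

lemma real_symmetric_square_eigenvalue:
  assumes C: "C \<in> carrier_mat n n" "real_symmetric C" and ev: "eigenvalue (C * C) e"
  shows "\<exists>l\<ge>0. e = of_real l"
proof -
  have CC: "C * C \<in> carrier_mat n n" using C by auto
  obtain v where v: "v \<in> carrier_vec n" "v \<noteq> 0\<^sub>v n" "(C * C) *\<^sub>v v = e \<cdot>\<^sub>v v"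
    using eigenvalue_witness[OF CC ev] by metis
  have Cv: "C *\<^sub>v v \<in> carrier_vec n" by (rule mult_mat_vec_carrier[OF C(1) v(1)])
  define a where "a = (\<Sum>i<n. (cmod ((C *\<^sub>v v) $ i))\<^sup>2)"
  define b where "b = (\<Sum>i<n. (cmod (v $ i))\<^sup>2)"
  have "complex_of_real a = vec_ip (C *\<^sub>v v) (C *\<^sub>v v)"
    unfolding vec_ip_self a_def carrier_vecD[OF Cv] ..
  also have "\<dots> = vec_ip v (C *\<^sub>v (C *\<^sub>v v))" by (rule real_symmetric_ip[OF C v(1) Cv])
  also have "C *\<^sub>v (C *\<^sub>v v) = e \<cdot>\<^sub>v v" using assoc_mult_mat_vec[OF C(1) C(1) v(1)] v(3) by simp
  also have "vec_ip v (e \<cdot>\<^sub>v v) = cnj e * vec_ip v v"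
    unfolding vec_ip_def sum_distrib_left by (intro sum.cong HOL.refl) simp
  also have "vec_ip v v = of_real b" unfolding vec_ip_self b_def carrier_vecD[OF v(1)] ..
  finally have eq: "complex_of_real a = cnj e * of_real b" .
  have "b \<noteq> 0"
  proof
    assume "b = 0"
    then have "vec_ip v v = 0" unfolding vec_ip_self using carrier_vecD[OF v(1)] b_def by simp
    then show False using vec_ip_self_eq_0[OF v(1)] v(2) by blast
  qed
  moreover have "a \<ge> 0" "b \<ge> 0" unfolding a_def b_def by (intro sum_nonneg; simp)+
  ultimately have "cnj e = of_real (a / b)" using eq by (simp add: field_simps)
  then have "e = of_real (a / b)" by (metis complex_cnj_cnj complex_cnj_complex_of_real)
  then show ?thesis using \<open>a \<ge> 0\<close> \<open>b \<ge> 0\<close> by (intro exI[of _ "a / b"]) auto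
qed

lemma pow_mat_eigenvalue:
  assumes "A \<in> carrier_mat n n" "eigenvalue A e" shows "eigenvalue (A ^\<^sub>m k) (e ^ k)"
proof -
  obtain v where v: "eigenvector A v e" using assms(2) by (auto simp: eigenvalue_def)
  then have "A ^\<^sub>m k *\<^sub>v v = e ^ k \<cdot>\<^sub>v v" using eigenvector_pow[OF assms(1)] by blast
  moreover have "v \<in> carrier_vec n" "v \<noteq> 0\<^sub>v n" using v assms(1) by (auto simp: eigenvector_def)
  ultimately show ?thesis using assms(1) by (intro eigenvalueI[of _ n v]) auto
qed

text \<open>The h-th power of an eigenvalue is an eigenvalue of the product along \<open>h\<close>
  copies of the list. That product is central and a symmetric square, so
  \<open>central_product_eigenvalue\<close> applies to the longer list.\<close>

lemma hecke_product_eigenvalues: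
  fixes Q :: real
  assumes Q: "Q > 0" and Ms: "set Ms \<subseteq> carrier_mat n n"
    and quad: "\<And>M. M \<in> set Ms \<Longrightarrow> M * M = 1\<^sub>m n + of_real (Q - 1 / Q) \<cdot>\<^sub>m M"
    and C: "C \<in> carrier_mat n n" "real_symmetric C"
    and pow: "mat_prod n Ms ^\<^sub>m h = C * C"
    and central: "\<And>M. M \<in> set Ms \<Longrightarrow> M * (C * C) = (C * C) * M"
  shows "\<exists>es. length es = n \<and> (\<forall>m. mat_trace (mat_prod n Ms ^\<^sub>m m) = (\<Sum>e\<leftarrow>es. e ^ m)) \<and>
    (\<forall>e\<in>set es. \<exists>(j::int) d. 1 \<le> d \<and> d \<le> n \<and> \<bar>j\<bar> \<le> int (n * (h * length Ms)) \<and>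
      e ^ h = of_real (Q powr (of_int j / real d)))"
proof -
  let ?A = "mat_prod n Ms" and ?Xs = "concat (replicate h Ms)"
  have A: "?A \<in> carrier_mat n n" by (rule mat_prod_carrier[OF Ms])
  have Xs: "set ?Xs \<subseteq> set Ms" by (induction h) auto
  have XC: "mat_prod n ?Xs = C * C" using mat_prod_concat_replicate[OF Ms] pow by simp
  have len: "length ?Xs = h * length Ms" by (induction h) auto
  have main: "\<exists>(j::int) d. 1 \<le> d \<and> d \<le> n \<and> \<bar>j\<bar> \<le> int (n * (h * length Ms)) \<and>
      e ^ h = of_real (Q powr (of_int j / real d))" if "eigenvalue ?A e" for e
  proof -
    have ev: "eigenvalue (C * C) (e ^ h)" using pow_mat_eigenvalue[OF A that, of h] pow by simp
    then obtain l where l: "l \<ge> 0" "e ^ h = of_real l"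
      using real_symmetric_square_eigenvalue[OF C] by blast
    have "\<exists>(j::int) d. 1 \<le> d \<and> d \<le> n \<and> \<bar>j\<bar> \<le> int (n * length ?Xs) \<and> l = Q powr (of_int j / real d)"
    proof (rule central_product_eigenvalue[OF Q])
      show "set ?Xs \<subseteq> carrier_mat n n" using Xs Ms by blast
      show "M * M = 1\<^sub>m n + of_real (Q - 1 / Q) \<cdot>\<^sub>m M" if "M \<in> set ?Xs" for M
        using quad that Xs by blast
      show "M * mat_prod n ?Xs = mat_prod n ?Xs * M" if "M \<in> set ?Xs" for M
        unfolding XC using central that Xs by blast
      show "real_symmetric (mat_prod n ?Xs)" unfolding XC by (rule real_symmetric_square[OF C])
      show "eigenvalue (mat_prod n ?Xs) (of_real l)" unfolding XC using ev l by simp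
    qed (rule l(1))
    then show ?thesis using l(2) len by auto
  qed
  show ?thesis by (rule eigenvalue_list[OF A]) (use main in blast)
qed

section \<open>Necklace congruences for sums over words\<close>

definition words :: "'e set \<Rightarrow> nat \<Rightarrow> 'e list set" where
  "words E m = {w. set w \<subseteq> E \<and> length w = m}"

lemma finite_words [simp]: "finite E \<Longrightarrow> finite (words E m)"
  unfolding words_def by (rule finite_lists_length_eq)

lemma words_0 [simp]: "words E 0 = {[]}"
  by (auto simp: words_def)

lemma words_Suc: "words E (Suc m) = (\<lambda>(e, w). e # w) ` (E \<times> words E m)"
proof -
  have "w \<in> words E (Suc m) \<longleftrightarrow> w \<in> (\<lambda>(e, w). e # w) ` (E \<times> words E m)" for w
    by (cases w) (auto simp: words_def image_iff)
  then show ?thesis by blast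
qed

lemma sum_words_Suc: "(\<Sum>w\<in>words E (Suc m). f w) = (\<Sum>e\<in>E. \<Sum>w\<in>words E m. f (e # w))"
  unfolding words_Suc
  by (subst sum.reindex) (auto simp: inj_on_def sum.cartesian_product intro!: sum.cong)

lemma funpow_closed: "\<lbrakk>\<And>y. y \<in> Y \<Longrightarrow> g y \<in> Y; y \<in> Y\<rbrakk> \<Longrightarrow> (g ^^ i) y \<in> Y"
  by (induction i) auto

lemma funpow_period_mult: "(g ^^ d) y = y \<Longrightarrow> (g ^^ (d * k)) y = y"
proof (induction k)
  case (Suc k)
  then show ?case by (simp add: funpow_add)
qed simp

text \<open>The least period divides \<open>l ^ Suc b\<close> but not \<open>l ^ b\<close>, so for a
  prime \<open>l\<close> it is exactly \<open>l ^ Suc b\<close>.\<close>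

lemma prime_power_period:
  assumes "Factorial_Ring.prime (l::nat)" and per: "(g ^^ (l ^ Suc b)) y = y" and "(g ^^ (l ^ b)) y \<noteq> y"
    and n: "(g ^^ n) y = y"
  shows "l ^ Suc b dvd n"
proof -
  define d where "d = (LEAST d. d > 0 \<and> (g ^^ d) y = y)"
  have pos: "l ^ Suc b > 0" using assms(1) prime_gt_0_nat by simp
  have d: "d > 0 \<and> (g ^^ d) y = y" unfolding d_def by (rule LeastI[of _ "l ^ Suc b"]) (use pos per in simp)
  have dvd: "d dvd k" if "(g ^^ k) y = y" for k
  proof (rule ccontr)
    assume nd: "\<not> d dvd k"
    have "(g ^^ (k mod d + d * (k div d))) y = (g ^^ (k mod d)) ((g ^^ (d * (k div d))) y)"
      by (simp only: funpow_add o_apply)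
    then have "(g ^^ (k mod d)) y = y" using funpow_period_mult[of d g y] d that by simp
    moreover have "k mod d > 0" using nd by (simp add: dvd_eq_mod_eq_0)
    ultimately have "d \<le> k mod d" unfolding d_def by (intro Least_le) simp
    then show False using d mod_less_divisor[of d k] by linarith
  qed
  have "d dvd l ^ Suc b" by (rule dvd[OF per])
  then obtain i where i: "i \<le> Suc b" "d = l ^ i"
    unfolding divides_primepow_nat[OF assms(1), of d "Suc b"] by blast
  have "\<not> i \<le> b"
  proof
    assume "i \<le> b"
    then have "l ^ b = d * l ^ (b - i)" using i by (simp add: power_add[symmetric])
    then have "(g ^^ (l ^ b)) y = y" using funpow_period_mult[of d g y] d by simp
    then show False using assms(3) by simp
  qed
  then have "d = l ^ Suc b" using i by (simp add: le_Suc_eq)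
  then show ?thesis using dvd[OF n] by simp
qed

lemma orbit_sum_dvd:
  fixes F :: "'a \<Rightarrow> int"
  assumes l: "Factorial_Ring.prime (l::nat)" and "finite Y"
    and "\<And>y. y \<in> Y \<Longrightarrow> g y \<in> Y" "\<And>y. y \<in> Y \<Longrightarrow> (g ^^ (l ^ Suc b)) y = y"
    "\<And>y. y \<in> Y \<Longrightarrow> (g ^^ (l ^ b)) y \<noteq> y" "\<And>y. y \<in> Y \<Longrightarrow> F (g y) = F y"
  shows "int (l ^ Suc b) dvd sum F Y"
  using assms(2-)
proof (induction Y rule: finite_psubset_induct)
  case (psubset Y)
  let ?P = "l ^ Suc b"
  have P0: "?P > 0" using l prime_gt_0_nat by simp
  show ?case
  proof (cases "Y = {}")
    case False
    then obtain y where y: "y \<in> Y" by blast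
    define O' where "O' = (\<lambda>i. (g ^^ i) y) ` {..<?P}"
    have inY: "(g ^^ i) z \<in> Y" if "z \<in> Y" for i z
      using funpow_closed[of Y g z i] psubset.prems(1) that by blast
    have sub: "O' \<subseteq> Y" using inY[OF y] by (auto simp: O'_def)
    have mod: "(g ^^ i) z = (g ^^ (i mod ?P)) z" if "z \<in> Y" for i z
    proof -
      have "(g ^^ (i mod ?P + ?P * (i div ?P))) z = (g ^^ (i mod ?P)) ((g ^^ (?P * (i div ?P))) z)"
        by (simp only: funpow_add o_apply)
      then show ?thesis
        using funpow_period_mult[OF psubset.prems(2)[OF that], of "i div ?P"] by (simp only: mod_mult_div_eq)
    qed
    have inO: "(g ^^ i) y \<in> O'" for i
      using mod[OF y, of i] P0 by (auto simp: O'_def)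
    have less_neq: "(g ^^ i) y \<noteq> (g ^^ j) y" if "i < j" "j < ?P" for i j
    proof
      assume eq: "(g ^^ i) y = (g ^^ j) y"
      have "(g ^^ (?P - i + j)) y = (g ^^ (?P - i + i)) y"
        by (simp only: funpow_add o_apply eq)
      then have "(g ^^ (?P - i + j)) y = y" using psubset.prems(2)[OF y] that by simp
      then have "?P dvd ?P - i + j"
        using prime_power_period[OF l psubset.prems(2)[OF y] psubset.prems(3)[OF y]] by blast
      moreover have "?P - i + j = ?P + (j - i)" using that by simp
      ultimately have "?P dvd j - i" by (metis dvd_add_right_iff dvd_refl)
      then show False using that by (auto dest: dvd_imp_le)
    qed
    have inj: "inj_on (\<lambda>i. (g ^^ i) y) {..<?P}"
      by (rule linorder_inj_onI) (use less_neq in auto)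
    have Fi: "F ((g ^^ i) y) = F y" for i
    proof (induction i)
      case (Suc i)
      then show ?case using psubset.prems(4)[OF inY[OF y, of i]] by simp
    qed simp
    have "sum F O' = (\<Sum>i<?P. F ((g ^^ i) y))" unfolding O'_def using inj by (simp add: sum.reindex)
    then have sO: "sum F O' = int ?P * F y" by (simp only: Fi sum_constant card_lessThan of_nat_id)
    have ne: "Y - O' \<subset> Y" using y inO[of 0] by auto
    have cl: "g z \<in> Y - O'" if z: "z \<in> Y - O'" for z
    proof -
      have "g z \<notin> O'"
      proof
        assume "g z \<in> O'"
        then obtain i where i: "g z = (g ^^ i) y" by (auto simp: O'_def)
        have "z = (g ^^ ?P) z" using psubset.prems(2)[of z] z by simp
        also have "\<dots> = (g ^^ (?P - 1)) (g z)" using P0 by (metis Suc_diff_1 funpow_Suc_right o_apply)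
        also have "\<dots> = (g ^^ (?P - 1 + i)) y" unfolding i by (simp only: funpow_add o_apply)
        finally show False using inO z by auto
      qed
      then show ?thesis using psubset.prems(1) z by blast
    qed
    have "int ?P dvd sum F (Y - O')"
      by (rule psubset.IH[OF ne]) (use psubset.prems cl in auto)
    moreover have "sum F Y = sum F (Y - O') + sum F O'"
      using sum.subset_diff[OF sub psubset.hyps] by simp
    ultimately show ?thesis using sO by simp
  qed simp
qed

lemma rotate_fixed:
  assumes "length w = d * Suc q" "rotate d w = w"
  shows "w = concat (replicate (Suc q) (take d w))"
proof -
  define y z where "y = take d w" and "z = drop d w"
  have ly: "length y = d" and lz: "length z = d * q" and w: "w = y @ z"
    using assms(1) by (simp_all add: y_def z_def)
  have "rotate d w = z @ y" using w ly by (metis rotate_append)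
  then have comm: "z @ y = y @ z" using assms(2) w by simp
  have "z = concat (replicate q y)" using lz comm
  proof (induction q arbitrary: z)
    case (Suc q)
    then have "length y \<le> length z" using ly by simp
    then obtain z' where z': "z = y @ z'"
      using Suc.prems(2) by (metis append_eq_append_conv_if append_take_drop_id)
    have "length z' = d * q" using Suc.prems(1) z' ly by simp
    moreover have "z' @ y = y @ z'" using Suc.prems(2) z' by simp
    ultimately show ?case using Suc.IH z' by simp
  qed simp
  moreover have "take d w = y" by (simp add: y_def)
  ultimately show ?thesis using w by simp
qed

lemma rotate_concat_replicate: "rotate (length y) (concat (replicate k y)) = concat (replicate k y)"
proof (cases k)
  case (Suc j)
  have "replicate j y @ [y] = y # replicate j y" by (rule replicate_append_same)
  then have "concat (replicate j y) @ y = y @ concat (replicate j y)"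
    by (metis concat.simps(1) concat.simps(2) concat_append append_Nil2)
  then show ?thesis using Suc by (simp add: rotate_append)
qed simp

text \<open>Let rotation by \<open>m\<close> act on the words. Those not fixed by its
  \<open>l ^ b\<close>-th iterate form orbits of size exactly \<open>l ^ Suc b\<close>, on which
  \<open>F\<close> is constant. The fixed ones are the \<open>l\<close>-fold repetitions.\<close>

lemma gauss_congruence_words:
  fixes F :: "'e list \<Rightarrow> int"
  assumes l: "Factorial_Ring.prime (l::nat)" and E: "finite E" and rot: "\<And>w. F (rotate1 w) = F w"
  shows "int (l ^ Suc b) dvd (\<Sum>w\<in>words E (l ^ Suc b * m). F w) - (\<Sum>y\<in>words E (l ^ b
      * m). F (concat (replicate l y)))"
proof -
  let ?V = "words E (l ^ Suc b * m)" and ?d = "l ^ b * m"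
  let ?Y = "{w \<in> ?V. rotate ?d w \<noteq> w}" and ?Z = "{w \<in> ?V. rotate ?d w = w}"
  obtain q where q: "l = Suc q" using prime_gt_0_nat[OF l] by (cases l) auto
  have Frot: "F (rotate k w) = F w" for k w by (induction k) (simp_all add: rot)
  have pw: "(rotate m ^^ k) w = rotate (k * m) w" for k and w :: "'e list"
  proof (induction k)
    case (Suc k)
    then show ?case by (simp add: rotate_rotate add.commute)
  qed simp
  have dvdY: "int (l ^ Suc b) dvd sum F ?Y"
  proof (rule orbit_sum_dvd[OF l, where g = "rotate m"])
    show "finite ?Y" using E by simp
    fix y assume y: "y \<in> ?Y"
    show "(rotate m ^^ (l ^ Suc b)) y = y" unfolding pw using y by (simp add: words_def)
    show "(rotate m ^^ (l ^ b)) y \<noteq> y" unfolding pw using y by simp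
    show "F (rotate m y) = F y" by (rule Frot)
    have "rotate ?d (rotate m y) \<noteq> rotate m y"
    proof
      assume a: "rotate ?d (rotate m y) = rotate m y"
      let ?k = "(l ^ Suc b - 1) * m"
      have "l ^ Suc b > 0" using prime_gt_0_nat[OF l] by simp
      then have "?k + m = l ^ Suc b * m" by (cases "l ^ Suc b") simp_all
      then have len: "?k + m = length y" using y by (simp add: words_def)
      have "rotate (?k + m) y = y" unfolding len by simp
      then have e: "rotate ?k (rotate m y) = y" by (simp only: rotate_rotate)
      have "rotate ?k (rotate ?d (rotate m y)) = rotate ?d (rotate ?k (rotate m y))"
        unfolding rotate_rotate by (simp only: ac_simps)
      then have "y = rotate ?d y" unfolding a e .
      then show False using y by simp
    qed
    then show "rotate m y \<in> ?Y" using y by (simp add: words_def)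
  qed
  have Z: "?Z = (\<lambda>y. concat (replicate l y)) ` words E ?d"
  proof (intro equalityI subsetI)
    fix w assume w: "w \<in> ?Z"
    then have "w = concat (replicate l (take ?d w))"
      using rotate_fixed[of w ?d q] q by (simp add: words_def algebra_simps)
    moreover have "take ?d w \<in> words E ?d"
      using w q set_take_subset[of ?d w] by (auto simp: words_def)
    ultimately show "w \<in> (\<lambda>y. concat (replicate l y)) ` words E ?d" by blast
  next
    fix w assume "w \<in> (\<lambda>y. concat (replicate l y)) ` words E ?d"
    then obtain y where y: "w = concat (replicate l y)" "set y \<subseteq> E" "length y = ?d" by (auto simp: words_def)
    have "length (concat (replicate k y)) = k * length y" for k by (induction k) simp_all
    then have "length w = l * ?d" using y by simp
    moreover have "set w \<subseteq> E" using y by (auto simp: set_replicate_conv_if split: if_splits)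
    moreover have "rotate ?d w = w" using rotate_concat_replicate[of y l] y by simp
    ultimately show "w \<in> ?Z" by (simp add: words_def mult.assoc)
  qed
  have inj: "inj_on (\<lambda>y. concat (replicate l y)) (words E ?d)"
  proof (rule inj_onI)
    fix x y assume "x \<in> words E ?d" "y \<in> words E ?d" "concat (replicate l x) = concat (replicate l y)"
    then show "x = y" using q by (simp add: words_def)
  qed
  have "sum F ?V = sum F ?Y + sum F ?Z"
    using E by (subst sum.union_disjoint[symmetric]) (auto intro!: sum.cong)
  then show ?thesis using dvdY unfolding Z sum.reindex[OF inj] by (simp add: o_def)
qed

subsection \<open>Closed walks in a signed weighted graph\<close>

fun path :: "('e \<Rightarrow> nat) \<Rightarrow> ('e \<Rightarrow> nat) \<Rightarrow> nat \<Rightarrow> 'e list \<Rightarrow> nat \<Rightarrow> bool" where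
  "path src tgt i [] j \<longleftrightarrow> i = j"
| "path src tgt i (e # w) j \<longleftrightarrow> src e = i \<and> path src tgt (tgt e) w j"

lemma path_append: "path src tgt i (u @ w) j \<longleftrightarrow> (\<exists>k. path src tgt i u k \<and> path src tgt k w j)"
  by (induction u arbitrary: i) auto

lemma path_hd: "\<lbrakk>path src tgt i w j; w \<noteq> []\<rbrakk> \<Longrightarrow> i = src (hd w)"
  by (cases w) auto

fun mat_power :: "nat \<Rightarrow> (nat \<Rightarrow> nat \<Rightarrow> 'a :: comm_ring_1) \<Rightarrow> nat \<Rightarrow> nat \<Rightarrow> nat \<Rightarrow> 'a" where
  "mat_power n M 0 i j = (if i = j then 1 else 0)"
| "mat_power n M (Suc m) i j = (\<Sum>k<n. M i k * mat_power n M m k j)"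

text \<open>Each monomial of a matrix entry becomes an edge of its own with sign 1 or -1, and a
  coefficient of larger size becomes parallel edges. Then the sign of a walk equals its odd powers,
  which makes the congruence below exact for coefficients.\<close>

locale signed_graph =
  fixes n :: nat and E :: "'e set" and src tgt :: "'e \<Rightarrow> nat" and sg ex :: "'e \<Rightarrow> int"
  assumes finite_E: "finite E" and src_less: "e \<in> E \<Longrightarrow> src e < n" and tgt_less: "e \<in> E \<Longrightarrow> tgt e < n"
    and sg: "e \<in> E \<Longrightarrow> sg e = 1 \<or> sg e = -1"
begin

definition entry :: "real \<Rightarrow> nat \<Rightarrow> nat \<Rightarrow> real" where
  "entry x i j = (\<Sum>e\<in>E. if src e = i \<and> tgt e = j then of_int (sg e) * exp (of_int (ex e) * x) else 0)"

definition sign :: "'e list \<Rightarrow> int" where "sign w = prod_list (map sg w)"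

definition expo :: "'e list \<Rightarrow> int" where "expo w = sum_list (map ex w)"

definition weight :: "real \<Rightarrow> 'e list \<Rightarrow> real" where "weight x w = of_int (sign w) * exp (of_int (expo w) * x)"

text \<open>The empty word is excluded: it has no starting vertex of its own and would count once
  for every vertex.\<close>

definition closed :: "'e list \<Rightarrow> bool" where "closed w \<longleftrightarrow> w \<noteq> [] \<and> path src tgt (src (hd w)) w (src (hd w))"

definition trace_coeff :: "nat \<Rightarrow> int \<Rightarrow> int" where
  "trace_coeff m k = (\<Sum>w\<in>words E m. if closed w \<and> expo w = k then sign w else 0)"

lemma weight_Cons: "weight x (e # w) = of_int (sg e) * exp (of_int (ex e) * x) * weight x w"
  by (simp add: weight_def sign_def expo_def exp_add algebra_simps)

lemma mat_power_entry:
  assumes "i < n" "j < n"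
  shows "mat_power n (entry x) m i j = (\<Sum>w\<in>words E m. if path src tgt i w j then weight x w else 0)"
  using assms(1)
proof (induction m arbitrary: i)
  case 0
  then show ?case by (simp add: weight_def sign_def expo_def)
next
  case (Suc m)
  let ?f = "\<lambda>e. of_int (sg e) * exp (of_int (ex e) * x)"
  let ?p = "\<lambda>k. \<Sum>w\<in>words E m. if path src tgt k w j then weight x w else 0"
  have "mat_power n (entry x) (Suc m) i j = (\<Sum>k<n. entry x i k * ?p k)"
    unfolding mat_power.simps by (intro sum.cong HOL.refl) (simp add: Suc.IH)
  also have "\<dots> = (\<Sum>k<n. \<Sum>e\<in>E. (if src e = i \<and> tgt e = k then ?f e else 0) * ?p k)"
    unfolding entry_def by (simp only: sum_distrib_right)
  also have "\<dots> = (\<Sum>e\<in>E. \<Sum>k<n. (if src e = i \<and> tgt e = k then ?f e else 0) * ?p k)" by (rule sum.swap)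
  also have "\<dots> = (\<Sum>e\<in>E. if src e = i then ?f e * ?p (tgt e) else 0)"
  proof (intro sum.cong HOL.refl)
    fix e assume e: "e \<in> E"
    have "(\<Sum>k<n. (if src e = i \<and> tgt e = k then ?f e else 0) * ?p k)
        = (\<Sum>k<n. if k = tgt e then (if src e = i then ?f e * ?p (tgt e) else 0) else 0)"
      by (intro sum.cong HOL.refl) auto
    then show "(\<Sum>k<n. (if src e = i \<and> tgt e = k then ?f e else 0) * ?p k)
        = (if src e = i then ?f e * ?p (tgt e) else 0)" using tgt_less[OF e] by simp
  qed
  also have "\<dots> = (\<Sum>w\<in>words E (Suc m). if path src tgt i w j then weight x w else 0)"
    unfolding sum_words_Suc
    by (intro sum.cong HOL.refl) (auto simp: weight_Cons sum_distrib_left intro!: sum.cong)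
  finally show ?case .
qed

lemma trace_mat_power:
  assumes "m > 0"
  shows "(\<Sum>i<n. mat_power n (entry x) m i i) = (\<Sum>w\<in>words E m. if closed w then weight x w else 0)"
proof -
  have "(\<Sum>i<n. mat_power n (entry x) m i i)
      = (\<Sum>i<n. \<Sum>w\<in>words E m. if path src tgt i w i then weight x w else 0)"
    by (intro sum.cong HOL.refl) (simp add: mat_power_entry)
  also have "\<dots> = (\<Sum>w\<in>words E m. \<Sum>i<n. if path src tgt i w i then weight x w else 0)" by (rule sum.swap)
  also have "\<dots> = (\<Sum>w\<in>words E m. if closed w then weight x w else 0)"
  proof (intro sum.cong HOL.refl)
    fix w assume "w \<in> words E m"
    then have w: "w \<noteq> []" "set w \<subseteq> E" using assms by (auto simp: words_def)
    then have s: "src (hd w) < n" using src_less[of "hd w"] hd_in_set[of w] by blast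
    have "(\<Sum>i<n. if path src tgt i w i then weight x w else 0)
        = (\<Sum>i<n. if i = src (hd w) then (if closed w then weight x w else 0) else 0)"
      by (intro sum.cong HOL.refl) (use w path_hd[of src tgt _ w] in \<open>auto simp: closed_def\<close>)
    then show "(\<Sum>i<n. if path src tgt i w i then weight x w else 0) = (if closed w then weight x w else 0)"
      using s by simp
  qed
  finally show ?thesis .
qed

definition expos :: "nat \<Rightarrow> int set" where "expos m = expo ` words E m"

lemma finite_expos [simp]: "finite (expos m)"
  using finite_E by (simp add: expos_def)

lemma trace_coeff_outside: "k \<notin> expos m \<Longrightarrow> trace_coeff m k = 0"
  unfolding trace_coeff_def expos_def by (intro sum.neutral) auto

lemma trace_expansion:
  assumes "m > 0"
  shows "(\<Sum>i<n. mat_power n (entry x) m i i) = (\<Sum>k\<in>expos m. of_int (trace_coeff m k) * exp (of_int k * x))"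
proof -
  have "(\<Sum>k\<in>expos m. of_int (trace_coeff m k) * exp (of_int k * x))
      = (\<Sum>k\<in>expos m. \<Sum>w\<in>words E m. if closed w \<and> expo w = k then weight x w else 0)"
    unfolding trace_coeff_def of_int_sum sum_distrib_right
    by (intro sum.cong HOL.refl) (auto simp: weight_def)
  also have "\<dots> = (\<Sum>w\<in>words E m. \<Sum>k\<in>expos m. if closed w \<and> expo w = k then weight x w else 0)" by (rule sum.swap)
  also have "\<dots> = (\<Sum>w\<in>words E m. if closed w then weight x w else 0)"
  proof (intro sum.cong HOL.refl)
    fix w assume w: "w \<in> words E m"
    have "(\<Sum>k\<in>expos m. if closed w \<and> expo w = k then weight x w else 0)
        = (\<Sum>k\<in>expos m. if k = expo w then (if closed w then weight x w else 0) else 0)"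
      by (intro sum.cong HOL.refl) auto
    then show "(\<Sum>k\<in>expos m. if closed w \<and> expo w = k then weight x w else 0)
        = (if closed w then weight x w else 0)"
      using w finite_E by (simp add: expos_def)
  qed
  finally show ?thesis unfolding trace_mat_power[OF assms] by simp
qed

lemma closed_rotate1: "closed (rotate1 w) \<longleftrightarrow> closed w"
proof (cases w)
  case (Cons e u)
  show ?thesis
  proof (cases "u = []")
    case False
    then have h: "hd (u @ [e]) = hd u" by simp
    have "closed (u @ [e]) \<longleftrightarrow> path src tgt (src (hd u)) u (src e) \<and> tgt e = src (hd u)"
      unfolding closed_def h path_append by auto
    also have "\<dots> \<longleftrightarrow> path src tgt (tgt e) u (src e)" using path_hd[OF _ False] by metis
    finally show ?thesis using Cons by (simp add: closed_def)
  qed (simp add: Cons)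
qed simp

lemma sign_rotate1: "sign (rotate1 w) = sign w" and expo_rotate1: "expo (rotate1 w) = expo w"
  by (cases w; simp add: sign_def expo_def)+

lemma closed_concat_replicate:
  assumes "l > 0" shows "closed (concat (replicate l y)) \<longleftrightarrow> closed y"
proof (cases "y = []")
  case False
  let ?s = "src (hd y)"
  have hd: "hd (concat (replicate (Suc k) y)) = hd y" for k using False by simp
  have ne: "concat (replicate (Suc k) y) \<noteq> []" for k using False by simp
  have "path src tgt ?s (concat (replicate (Suc k) y)) ?s \<longleftrightarrow> path src tgt ?s y ?s" for k
  proof (induction k)
    case (Suc k)
    have "path src tgt ?s (concat (replicate (Suc (Suc k)) y)) ?s \<longleftrightarrow>
      (\<exists>j. path src tgt ?s y j \<and> path src tgt j (concat (replicate (Suc k) y)) ?s)"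
      by (simp only: replicate_Suc concat.simps path_append)
    also have "\<dots> \<longleftrightarrow> path src tgt ?s y ?s \<and> path src tgt ?s (concat (replicate (Suc k) y)) ?s"
    proof -
      have "j = ?s" if "path src tgt j (concat (replicate (Suc k) y)) ?s" for j
        using path_hd[OF that ne] unfolding hd .
      then show ?thesis by blast
    qed
    finally show ?case using Suc by blast
  qed simp
  then show ?thesis using assms ne hd False unfolding closed_def by (cases l) (simp_all only:)
qed (simp add: closed_def)

lemma expo_concat_replicate: "expo (concat (replicate l y)) = int l * expo y"
  by (induction l) (simp_all add: expo_def algebra_simps)

lemma sign_concat_replicate: "sign (concat (replicate l y)) = sign y ^ l"
  by (induction l) (simp_all add: sign_def)

lemma sign_cases: "set w \<subseteq> E \<Longrightarrow> sign w = 1 \<or> sign w = -1"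
proof (induction w)
  case (Cons e w)
  then show ?case using sg[of e] by (auto simp: sign_def)
qed (simp add: sign_def)

text \<open>Closedness, exponent and sign are invariant under rotation. An \<open>l\<close>-fold
  repetition multiplies the exponent by \<open>l\<close> and, as \<open>l\<close> is odd, keeps the
  sign.\<close>

lemma trace_coeff_congruence:
  assumes l: "Factorial_Ring.prime (l::nat)" "odd l"
  shows "int (l ^ Suc b) dvd trace_coeff (l ^ Suc b * m) k -
    (if int l dvd k then trace_coeff (l ^ b * m) (k div int l) else 0)"
proof -
  let ?F = "\<lambda>w. if closed w \<and> expo w = k then sign w else 0"
  have l0: "l > 0" using l prime_gt_0_nat by blast
  have "?F (rotate1 w) = ?F w" for w by (simp add: closed_rotate1 sign_rotate1 expo_rotate1)
  from gauss_congruence_words[where F = ?F, OF l(1) finite_E this]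
  have "int (l ^ Suc b) dvd trace_coeff (l ^ Suc b * m) k - (\<Sum>y\<in>words E (l ^ b
      * m). ?F (concat (replicate l y)))"
    unfolding trace_coeff_def .
  moreover have "(\<Sum>y\<in>words E (l ^ b * m). ?F (concat (replicate l y)))
      = (if int l dvd k then trace_coeff (l ^ b * m) (k div int l) else 0)"
  proof -
    have "?F (concat (replicate l y)) = (if int l dvd k then (if closed y \<and> expo y
        = k div int l then sign y else 0) else 0)"
      if "y \<in> words E (l ^ b * m)" for y
    proof -
      have "sign y ^ l = sign y" using sign_cases[of y] that l(2) by (auto simp: words_def)
      moreover have "int l * expo y = k \<longleftrightarrow> int l dvd k \<and> expo y = k div int l" using l0 by auto
      ultimately show ?thesis
        by (simp add: closed_concat_replicate[OF l0] expo_concat_replicate sign_concat_replicate)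
    qed
    then show ?thesis unfolding trace_coeff_def by (cases "int l dvd k") (auto intro!: sum.cong)
  qed
  ultimately show ?thesis by simp
qed

end

subsection \<open>Galois invariance of the trace coefficients\<close>

text \<open>Divide by the exponential with the largest exponent that has a nonzero coefficient:
  along the unbounded set \<open>V\<close> all other terms tend to 0.\<close>

lemma exp_sum_zero:
  fixes c :: "real \<Rightarrow> complex"
  assumes K: "finite K" and V: "infinite (V :: nat set)"
    and zero: "\<And>x. x \<in> V \<Longrightarrow> (\<Sum>k\<in>K. c k * of_real (exp (k * real x))) = 0"
    and k: "k \<in> K"
  shows "c k = 0"
proof (rule ccontr)
  assume ck: "c k \<noteq> 0"
  define K' where "K' = {k \<in> K. c k \<noteq> 0}"
  have K': "finite K'" "K' \<noteq> {}" using K k ck by (auto simp: K'_def)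
  define m where "m = Max K'"
  have m: "m \<in> K'" unfolding m_def using K' by (rule Max_in)
  then have cm: "c m \<noteq> 0" by (simp add: K'_def)
  define g where "g x = (\<Sum>k\<in>K' - {m}. c k * of_real (exp ((k - m) * real x)))" for x
  have "(\<lambda>x. c k * of_real (exp ((k - m) * real x))) \<longlonglongrightarrow> 0" if "k \<in> K' - {m}" for k
  proof -
    have "k < m" using that Max_ge[OF K'(1), of k] by (auto simp: m_def)
    then have "filterlim (\<lambda>x. (k - m) * real x) at_bot sequentially"
      by (intro filterlim_tendsto_neg_mult_at_bot[OF tendsto_const] filterlim_real_sequentially) simp
    then have "(\<lambda>x. exp ((k - m) * real x)) \<longlonglongrightarrow> 0"
      by (rule filterlim_compose[OF exp_at_bot])
    then have "(\<lambda>x. complex_of_real (exp ((k - m) * real x))) \<longlonglongrightarrow> of_real 0" by (rule tendsto_of_real)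
    then show ?thesis using tendsto_mult_right_zero by fastforce
  qed
  then have "g \<longlonglongrightarrow> 0" unfolding g_def by (rule tendsto_null_sum)
  then have "eventually (\<lambda>x. cmod (g x) < cmod (c m)) sequentially"
    using cm by (auto simp: tendsto_iff dist_norm)
  then obtain N where N: "\<And>x. x \<ge> N \<Longrightarrow> cmod (g x) < cmod (c m)"
    by (auto simp: eventually_sequentially)
  obtain x where x: "x \<in> V" "x \<ge> N" using V by (metis infinite_nat_iff_unbounded_le)
  have "0 = (\<Sum>k\<in>K. c k * of_real (exp (k * real x)))" using zero x by simp
  also have "\<dots> = (\<Sum>k\<in>K'. c k * of_real (exp (k * real x)))"
    by (rule sum.mono_neutral_right) (use K in \<open>auto simp: K'_def\<close>)
  also have "\<dots> = (\<Sum>k\<in>K'. of_real (exp (m * real x)) * (c k * of_real (exp ((k - m) * real x))))"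
  proof (intro sum.cong HOL.refl)
    fix k
    have "exp (k * real x) = exp (m * real x) * exp ((k - m) * real x)"
      by (simp add: exp_add[symmetric] algebra_simps)
    then show "c k * of_real (exp (k * real x))
        = of_real (exp (m * real x)) * (c k * of_real (exp ((k - m) * real x)))"
      by simp
  qed
  also have "\<dots> = of_real (exp (m * real x)) * (\<Sum>k\<in>K'. c k * of_real (exp ((k - m) * real x)))"
    by (rule sum_distrib_left[symmetric])
  also have "(\<Sum>k\<in>K'. c k * of_real (exp ((k - m) * real x))) = c m + g x"
    unfolding g_def using K'(1) m by (simp add: sum.remove)
  finally have "c m + g x = 0" by simp
  then have "cmod (g x) = cmod (c m)" by (metis add_eq_0_iff norm_minus_cancel)
  then show False using N[OF x(2)] by simp
qed

lemma int_eq_if_prime_power_dvd: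
  fixes u v :: int
  assumes "l \<ge> 2" "f > 0" "\<And>B. int (l ^ Suc (f * B)) dvd u - v" shows "u = v"
proof (rule ccontr)
  assume ne: "u \<noteq> v"
  define B where "B = nat \<bar>u - v\<bar>"
  have "int (l ^ Suc (f * B)) \<le> \<bar>u - v\<bar>" using ne assms(3)[of B] by (intro zdvd_imp_le) auto
  moreover have "B < l ^ Suc (f * B)"
  proof -
    have "B < 2 ^ B" by (rule less_exp)
    also have "(2::nat) ^ B \<le> l ^ B" using assms(1) by (rule power_mono) simp
    also have "\<dots> \<le> l ^ Suc (f * B)" using assms(1,2) by (intro power_increasing) (auto intro: le_SucI)
    finally show ?thesis .
  qed
  ultimately show False unfolding B_def by linarith
qed

text \<open>Coefficient functions \<open>t \<kappa> m = \<Sum> \<omega> ^ m\<close>, the sum over eigenvalue data \<open>(\<omega>, \<kappa>)\<close>: integrality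
  and the Gauss congruences of the traces make \<open>t \<kappa>\<close> invariant under the Galois action
  \<open>\<omega> \<mapsto> \<omega> ^ p\<close>.\<close>

locale eigenvalue_data =
  fixes a :: "nat \<Rightarrow> int \<Rightarrow> int" and h :: nat and D :: "(complex \<times> real) list" and V :: "nat set"
    and supp :: "nat \<Rightarrow> int set"
  assumes h: "h > 0" and D: "\<And>w k. (w, k) \<in> set D \<Longrightarrow> w ^ h = 1" and V: "infinite V"
    and supp: "finite (supp m)" "k \<notin> supp m \<Longrightarrow> a m k = 0"
    and expansion: "\<And>x m. \<lbrakk>x \<in> V; m > 0\<rbrakk> \<Longrightarrow>
      (\<Sum>k\<in>supp m. of_int (a m k) * complex_of_real (exp (of_int k * real x)))
        = (\<Sum>(w, k)\<leftarrow>D. w ^ m * of_real (exp (k * real m * real x)))"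
    and congruence: "\<And>l b m k. \<lbrakk>Factorial_Ring.prime (l::nat); odd l\<rbrakk> \<Longrightarrow>
      int (l ^ Suc b) dvd a (l ^ Suc b * m) k - (if int l dvd k then a (l ^ b * m) (k div int l) else 0)"
begin

definition t :: "real \<Rightarrow> nat \<Rightarrow> complex" where
  "t k m = (\<Sum>(w, k')\<leftarrow>D. if k' = k then w ^ m else 0)"

lemma t_add_period: "t k (m + h) = t k m"
proof -
  have "(\<Sum>(w, k')\<leftarrow>D'. if k' = k then w ^ (m + h) else 0) = (\<Sum>(w, k')\<leftarrow>D'. if k' = k then w ^ m else 0)"
    if "set D' \<subseteq> set D" for D'
    using that
  proof (induction D')
    case (Cons d D')
    obtain w k' where d: "d = (w, k')" by (cases d)
    then have "w ^ h = 1" using D Cons.prems by auto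
    then show ?case using Cons d by (simp add: power_add)
  qed simp
  then show ?thesis unfolding t_def by blast
qed

lemma t_mod: "t k m = t k (m mod h)"
proof -
  have "t k (r + h * q) = t k r" for r q
  proof (induction q)
    case (Suc q)
    have "t k (r + h * Suc q) = t k ((r + h * q) + h)" by (simp add: algebra_simps)
    then show ?case using Suc t_add_period by simp
  qed simp
  from this[of "m mod h" "m div h"] show ?thesis by simp
qed

lemma t_cong: "[m = m'] (mod h) \<Longrightarrow> t k m = t k m'"
  using t_mod by (metis cong_def)

definition kappas :: "real set" where "kappas = snd ` set D"

lemma finite_kappas [simp]: "finite kappas"
  by (simp add: kappas_def)

lemma expansion_t:
  assumes "finite K" "kappas \<subseteq> K"
  shows "(\<Sum>(w, k)\<leftarrow>D. w ^ m * of_real (exp (k * real m * real x)))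
      = (\<Sum>k\<in>K. t k m * of_real (exp (k * real m * real x)))"
proof -
  have "(\<Sum>(w, k)\<leftarrow>D'. w ^ m * of_real (exp (k * real m * real x)))
      = (\<Sum>k\<in>K. (\<Sum>(w, k')\<leftarrow>D'. if k' = k then w ^ m else 0) * of_real (exp (k * real m * real x)))"
    if "set D' \<subseteq> set D" for D'
    using that
  proof (induction D')
    case (Cons d D')
    obtain w k' where d: "d = (w, k')" by (cases d)
    have "k' \<in> K" using Cons.prems assms(2) d by (force simp: kappas_def)
    then have "(\<Sum>k\<in>K. (if k' = k then w ^ m else 0) * complex_of_real (exp (k * real m * real x)))
        = w ^ m * of_real (exp (k' * real m * real x))"
      using assms(1) by (simp add: if_distrib[where f = "\<lambda>y. y * _"] cong: if_cong)
    then show ?case using Cons d by (simp add: distrib_right sum.distrib)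
  qed simp
  then show ?thesis unfolding t_def by blast
qed

text \<open>Comparison of the coefficients of \<open>exp (y * x)\<close> for real \<open>y\<close>.
  It shows that \<open>t\<close> takes integer values at positive arguments, and that fractional
  exponents cancel.\<close>

lemma coefficient_eq:
  assumes m: "m > 0"
  shows "(if y \<in> \<int> then of_int (a m \<lfloor>y\<rfloor>) else 0) = t (y / real m) m"
proof -
  \<comment> \<open>All exponents from either side, together with \<open>y\<close> itself, so that
    the coefficient at \<open>y\<close> can be read off even if it is absent from both.\<close>
  define K where "K = real_of_int ` supp m \<union> (\<lambda>k. k * real m) ` kappas \<union> {y}"
  have finK: "finite K" using supp(1) by (simp add: K_def)
  define c where "c y = (if y \<in> \<int> then of_int (a m \<lfloor>y\<rfloor>) else 0) - t (y / real m) m" for y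
  have "(\<Sum>y\<in>K. c y * of_real (exp (y * real x))) = 0" if x: "x \<in> V" for x
  proof -
    have "(\<Sum>y\<in>K. (if y \<in> \<int> then of_int (a m \<lfloor>y\<rfloor>) else 0) * complex_of_real (exp (y * real x)))
        = (\<Sum>y\<in>real_of_int ` supp m. (if y \<in> \<int> then of_int (a m \<lfloor>y\<rfloor>) else 0) * of_real (exp (y * real x)))"
    proof (rule sum.mono_neutral_right[OF finK])
      show "real_of_int ` supp m \<subseteq> K" by (auto simp: K_def)
      show "\<forall>y\<in>K - real_of_int ` supp m. (if y \<in> \<int> then of_int (a m \<lfloor>y\<rfloor>) else 0) * complex_of_real (exp (y
          * real x)) = 0"
      proof
        fix y assume y: "y \<in> K - real_of_int ` supp m"
        have "a m \<lfloor>y\<rfloor> = 0" if Z: "y \<in> \<int>"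
        proof -
          obtain z where z: "y = of_int z" using Z by (rule Ints_cases)
          then have "z \<notin> supp m" using y by blast
          then show ?thesis using z supp(2) by simp
        qed
        then show "(if y \<in> \<int> then of_int (a m \<lfloor>y\<rfloor>) else 0) * complex_of_real (exp (y * real x)) = 0" by simp
      qed
    qed
    also have "\<dots> = (\<Sum>k\<in>supp m. of_int (a m k) * complex_of_real (exp (of_int k * real x)))"
      by (subst sum.reindex) (auto simp: inj_on_def)
    also have "\<dots> = (\<Sum>(w, k)\<leftarrow>D. w ^ m * of_real (exp (k * real m * real x)))" by (rule expansion[OF x m])
    also have "\<dots> = (\<Sum>k\<in>(\<lambda>y. y / real m) ` K. t k m * of_real (exp (k * real m * real x)))"
    proof (rule expansion_t)
      show "kappas \<subseteq> (\<lambda>y. y / real m) ` K"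
      proof
        fix k assume "k \<in> kappas"
        then have "k * real m \<in> K" by (auto simp: K_def)
        then show "k \<in> (\<lambda>y. y / real m) ` K" using m by (intro image_eqI[of _ _ "k * real m"]) auto
      qed
    qed (use finK in simp)
    also have "\<dots> = (\<Sum>y\<in>K. t (y / real m) m * of_real (exp (y * real x)))"
      using m by (subst sum.reindex) (auto simp: inj_on_def)
    finally show ?thesis unfolding c_def by (simp add: left_diff_distrib sum_subtractf)
  qed
  moreover have "y \<in> K" by (simp add: K_def)
  ultimately have "c y = 0" by (rule exp_sum_zero[OF finK V, where c = c])
  then show ?thesis by (simp add: c_def)
qed

definition ti :: "real \<Rightarrow> nat \<Rightarrow> int" where
  "ti k m = (if k * real m \<in> \<int> then a m \<lfloor>k * real m\<rfloor> else 0)"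

lemma t_eq_ti: "m > 0 \<Longrightarrow> t k m = of_int (ti k m)"
  using coefficient_eq[of m "k * real m"] by (simp add: ti_def split: if_splits)

text \<open>Dividing the exponent by \<open>l\<close> along with the power of the trace leaves
  \<kappa> unchanged, so the two coefficients in the congruence belong to the same
  \<open>k\<close>.\<close>

lemma ti_congruence:
  assumes l: "Factorial_Ring.prime (l::nat)" "odd l" and m: "m > 0"
  shows "int (l ^ Suc b) dvd ti k (l ^ Suc b * m) - ti k (l ^ b * m)"
proof -
  have l0: "l > 0" using l(1) prime_gt_0_nat by blast
  let ?M = "l ^ b * m"
  have r: "k * real (l ^ Suc b * m) = real l * (k * real ?M)" by simp
  show ?thesis
  proof (cases "k * real (l ^ Suc b * m) \<in> \<int>")
    case False
    then have "k * real ?M \<notin> \<int>" unfolding r by (metis Ints_mult Ints_of_nat)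
    then show ?thesis using False by (simp add: ti_def)
  next
    case True
    then obtain j where j: "k * real (l ^ Suc b * m) = of_int j" by (auto elim: Ints_cases)
    then have t1: "ti k (l ^ Suc b * m) = a (l ^ Suc b * m) j"
        by (simp add: ti_def del: of_nat_mult of_nat_power)
    have "ti k ?M = (if int l dvd j then a ?M (j div int l) else 0)"
    proof (cases "int l dvd j")
      case True
      then obtain i where i: "j = int l * i" by (auto elim: dvdE)
      have "real l * (k * real ?M) = real l * of_int i" using j r i by simp
      then have "k * real ?M = of_int i" using l0 by (metis mult_left_cancel of_nat_0_eq_iff less_irrefl)
      then show ?thesis using i l0 by (simp add: ti_def del: of_nat_mult of_nat_power)
    next
      case False
      have "k * real ?M \<notin> \<int>"
      proof
        assume "k * real ?M \<in> \<int>"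
        then obtain i where "k * real ?M = of_int i" by (auto elim: Ints_cases)
        then have "real_of_int j = real_of_int (int l * i)" using j r by simp
        then have "j = int l * i" by (simp only: of_int_eq_iff)
        then show False using False by simp
      qed
      then show ?thesis using False by (simp add: ti_def del: of_nat_mult of_nat_power)
    qed
    then show ?thesis using congruence[OF l, of b m j] t1 by simp
  qed
qed

text \<open>By Euler's theorem the powers of \<open>l\<close> with exponent a multiple of
  \<open>totient h\<close> are 1 modulo \<open>h\<close>. Periodicity keeps both values fixed along
  these powers while the modulus of the congruence grows, so the difference is 0.\<close>

lemma t_prime_mult:
  assumes l: "Factorial_Ring.prime (l::nat)" "odd l" "coprime l h" and m: "m > 0"
  shows "t k (l * m) = t k m"
proof -
  let ?f = "totient h"
  have l0: "l > 0" using l(1) prime_gt_0_nat by blast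
  have "[l ^ ?f = 1] (mod h)" using euler_theorem l(3) by blast
  then have c1: "[l ^ (?f * B) = 1] (mod h)" for B
    using cong_pow[of "l ^ ?f" 1 h B] by (simp add: power_mult)
  have e1: "t k (l ^ (?f * B) * m) = t k m" for B
    using cong_mult[OF c1[of B] cong_refl[of m]] by (intro t_cong) simp
  have e2: "t k (l ^ Suc (?f * B) * m) = t k (l * m)" for B
    using cong_mult[OF c1[of B] cong_refl[of "l * m"]] by (intro t_cong) (simp add: ac_simps)
  have "ti k (l * m) = ti k m"
  proof (rule int_eq_if_prime_power_dvd)
    show "2 \<le> l" using l(1) prime_ge_2_nat by blast
    show "0 < ?f" using h by simp
    fix B
    have "complex_of_int (ti k (l ^ (?f * B) * m)) = of_int (ti k m)"
      using e1[of B] t_eq_ti[of "l ^ (?f * B) * m" k] t_eq_ti[OF m, of k] l0 m by simp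
    moreover have "complex_of_int (ti k (l ^ Suc (?f * B) * m)) = of_int (ti k (l * m))"
      using e2[of B] t_eq_ti[of "l ^ Suc (?f * B) * m" k] t_eq_ti[of "l * m" k] l0 m by simp
    ultimately show "int (l ^ Suc (?f * B)) dvd ti k (l * m) - ti k m"
      using ti_congruence[OF l(1,2) m, of "?f * B" k] by (simp only: of_int_eq_iff)
  qed
  then show ?thesis using t_eq_ti[of "l * m" k] t_eq_ti[OF m, of k] l0 m by simp
qed

lemma t_odd_coprime: "\<lbrakk>p > 0; odd p; coprime p h\<rbrakk> \<Longrightarrow> t k p = t k 1"
proof (induction p rule: less_induct)
  case (less p)
  show ?case
  proof (cases "p = 1")
    case False
    then obtain l where l: "Factorial_Ring.prime l" "l dvd p" using prime_factor_nat by blast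
    then obtain q where q: "p = l * q" by (auto elim: dvdE)
    have "q > 0" "odd l" "odd q" using less.prems q by auto
    moreover have "coprime l h" "coprime q h" using less.prems q by auto
    moreover have "q < p" using q l(1) \<open>q > 0\<close> prime_gt_1_nat[of l] by simp
    ultimately show ?thesis using t_prime_mult[of l q k] less.IH[of q] l q by simp
  qed simp
qed

text \<open>The congruences are available for odd primes only. If \<open>p\<close> is even then
  \<open>h\<close> is odd, and \<open>p + h\<close> is an odd number coprime to \<open>h\<close>
  with the same value of \<open>t\<close>.\<close>

lemma t_coprime:
  assumes "p > 0" "coprime p h" shows "t k p = t k 1"
proof (cases "odd p")
  case False
  then have "odd (p + h)" using assms(2) by (auto dest: coprime_common_divisor[of p h 2])
  moreover have "coprime (p + h) h" using assms(2) by (simp only: coprime_iff_gcd_eq_1 gcd_add1)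
  ultimately have "t k (p + h) = t k 1" using assms(1) by (intro t_odd_coprime) simp_all
  then show ?thesis using t_add_period by simp
qed (use t_odd_coprime assms in blast)

text \<open>The coefficient at exponent \<open>k\<close> of the p-th trace and the one at
  \<open>k / p\<close> of the first trace are values of the same function \<open>t\<close>, with
  \<kappa> equal to \<open>k / p\<close>.\<close>

theorem coefficient_coprime:
  assumes "p > 0" "coprime p h"
  shows "a p k = (if int p dvd k then a 1 (k div int p) else 0)"
proof -
  have "complex_of_int (a p k) = t (of_int k / real p) p" using coefficient_eq[OF assms(1), of "of_int k"]
      by simp
  also have "\<dots> = t (of_int k / real p) 1" by (rule t_coprime[OF assms])
  also have "\<dots> = of_int (if int p dvd k then a 1 (k div int p) else 0)"
  proof -
    have "real_of_int k / real p \<in> \<int> \<longleftrightarrow> int p dvd k"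
    proof
      assume "real_of_int k / real p \<in> \<int>"
      then obtain z where "real_of_int k / real p = of_int z" by (rule Ints_cases)
      then have "real_of_int k = real_of_int (int p * z)" using assms(1) by (simp add: field_simps)
      then have "k = int p * z" by (simp only: of_int_eq_iff)
      then show "int p dvd k" by simp
    next
      assume "int p dvd k"
      then obtain z where "k = int p * z" by (rule dvdE)
      then have "real_of_int k / real p = of_int z" using assms(1) by simp
      then show "real_of_int k / real p \<in> \<int>" by simp
    qed
    moreover have "\<lfloor>real_of_int k / real p\<rfloor> = k div int p"
      by (metis floor_divide_of_int_eq of_int_of_nat_eq)
    ultimately show ?thesis using coefficient_eq[of 1 "of_int k / real p"] by (simp split: if_splits)
  qed
  finally show ?thesis by (simp only: of_int_eq_iff)
qed

end

subsection \<open>Matrices of the Hecke operators\<close>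

context finite_coxeter_system
begin

definition gsize :: nat where "gsize = card (carrier G)"

definition enum :: "nat \<Rightarrow> 'a" where "enum = (SOME h. bij_betw h {..<gsize} (carrier G))"

lemma enum: "bij_betw enum {..<gsize} (carrier G)"
proof -
  have "\<exists>h. bij_betw h {..<gsize} (carrier G)"
    using ex_bij_betw_nat_finite[OF finite_carrier] by (simp add: gsize_def atLeast0LessThan)
  then show ?thesis unfolding enum_def by (rule someI_ex)
qed

lemma enum_carrier [simp, intro]: "i < gsize \<Longrightarrow> enum i \<in> carrier G"
  using enum bij_betwE by blast

lemma enum_eq_iff: "\<lbrakk>i < gsize; j < gsize\<rbrakk> \<Longrightarrow> enum i = enum j \<longleftrightarrow> i = j"
  using enum by (auto simp: bij_betw_def inj_on_def)

lemma enum_surj: assumes "v \<in> carrier G" shows "\<exists>i<gsize. enum i = v"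
proof -
  have "v \<in> enum ` {..<gsize}" using enum assms by (simp add: bij_betw_def)
  then show ?thesis by auto
qed

lemma sum_enum: "(\<Sum>i<gsize. f (enum i)) = (\<Sum>v\<in>carrier G. f v)"
  using enum by (rule sum.reindex_bij_betw)

definition fun_vec :: "('a \<Rightarrow> complex) \<Rightarrow> complex vec" where
  "fun_vec f = vec gsize (\<lambda>i. f (enum i))"

definition hecke_mat :: "complex \<Rightarrow> 'a \<Rightarrow> complex mat" where
  "hecke_mat z s = mat gsize gsize (\<lambda>(i, j). (if enum j = enum i \<otimes> s then 1 else 0) +
     (if i = j \<and> len (enum i) < len (enum i \<otimes> s) then z else 0))"

lemma fun_vec_carrier [simp]: "fun_vec f \<in> carrier_vec gsize"
  by (simp add: fun_vec_def)

lemma hecke_mat_carrier [simp]: "hecke_mat z s \<in> carrier_mat gsize gsize"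
  by (simp add: hecke_mat_def)

lemma dim_fun_vec [simp]: "dim_vec (fun_vec f) = gsize"
  by (simp add: fun_vec_def)

lemma fun_vec_index [simp]: "i < gsize \<Longrightarrow> fun_vec f $ i = f (enum i)"
  by (simp add: fun_vec_def)

lemma dim_hecke_mat [simp]: "dim_row (hecke_mat z s) = gsize" "dim_col (hecke_mat z s) = gsize"
  by (simp_all add: hecke_mat_def)

lemma fun_vec_cong: "(\<And>v. v \<in> carrier G \<Longrightarrow> f v = g v) \<Longrightarrow> fun_vec f = fun_vec g"
  unfolding fun_vec_def by (rule eq_vecI) auto

lemma hecke_mat_vec:
  assumes s: "s \<in> S" shows "hecke_mat z s *\<^sub>v fun_vec f = fun_vec (hecke z s f)"
proof (rule eq_vecI)
  fix i assume "i < dim_vec (fun_vec (hecke z s f))"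
  then have i: "i < gsize" by (simp add: fun_vec_def)
  let ?c = "len (enum i) < len (enum i \<otimes> s)"
  have "enum i \<otimes> s \<in> carrier G" using i s by simp
  from enum_surj[OF this] obtain k where k: "k < gsize" "enum k = enum i \<otimes> s" by (elim exE conjE)
  have "(hecke_mat z s *\<^sub>v fun_vec f) $ i = row (hecke_mat z s) i \<bullet> fun_vec f"
    by (rule index_mult_mat_vec) (simp add: i)
  also have "\<dots> = (\<Sum>j<gsize. hecke_mat z s $$ (i, j) * f (enum j))"
    unfolding scalar_prod_def dim_fun_vec atLeast0LessThan
    by (rule sum.cong[OF HOL.refl]) (simp add: i)
  also have "\<dots> = (\<Sum>j<gsize. (if j = k then f (enum k) else 0) + (if j
      = i then (if ?c then z * f (enum i) else 0) else 0))"
  proof (intro sum.cong HOL.refl)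
    fix j assume j: "j \<in> {..<gsize}"
    have "enum j = enum i \<otimes> s \<longleftrightarrow> j = k" using enum_eq_iff[of j k] j k by simp
    then show "hecke_mat z s $$ (i, j) * f (enum j)
        = (if j = k then f (enum k) else 0) + (if j = i then (if ?c then z * f (enum i) else 0) else 0)"
      using i j by (auto simp: hecke_mat_def algebra_simps)
  qed
  also have "\<dots> = f (enum k) + (if ?c then z * f (enum i) else 0)" using i k by (simp add: sum.distrib)
  also have "\<dots> = fun_vec (hecke z s f) $ i" using i k by (simp add: fun_vec_def hecke_def)
  finally show "(hecke_mat z s *\<^sub>v fun_vec f) $ i = fun_vec (hecke z s f) $ i" .
qed (simp add: fun_vec_def hecke_mat_def)

definition hecke_word :: "complex \<Rightarrow> 'a list \<Rightarrow> complex mat" where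
  "hecke_word z xs = mat_prod gsize (map (hecke_mat z) xs)"

lemma hecke_mats [simp]: "set (map (hecke_mat z) xs) \<subseteq> carrier_mat gsize gsize"
  by auto

lemma hecke_word_carrier [simp]: "hecke_word z xs \<in> carrier_mat gsize gsize"
  unfolding hecke_word_def by (rule mat_prod_carrier) (rule hecke_mats)

lemma dim_hecke_word [simp]: "dim_row (hecke_word z xs) = gsize" "dim_col (hecke_word z xs) = gsize"
  by (rule carrier_matD[OF hecke_word_carrier])+

lemma hecke_word_append: "hecke_word z (xs @ ys) = hecke_word z xs * hecke_word z ys"
  unfolding hecke_word_def map_append by (rule mat_prod_append) auto

lemma hecke_word_vec:
  "set xs \<subseteq> S \<Longrightarrow> hecke_word z xs *\<^sub>v fun_vec f = fun_vec (foldr (hecke z) xs f)"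
proof (induction xs)
  case Nil
  then show ?case by (simp add: hecke_word_def)
next
  case (Cons s xs)
  have "hecke_word z (s # xs) *\<^sub>v fun_vec f = hecke_mat z s * hecke_word z xs *\<^sub>v fun_vec f"
    by (simp add: hecke_word_def)
  also have "\<dots> = hecke_mat z s *\<^sub>v (hecke_word z xs *\<^sub>v fun_vec f)"
    by (rule assoc_mult_mat_vec[OF hecke_mat_carrier hecke_word_carrier fun_vec_carrier])
  also have "\<dots> = hecke_mat z s *\<^sub>v fun_vec (foldr (hecke z) xs f)" using Cons by simp
  also have "\<dots> = fun_vec (hecke z s (foldr (hecke z) xs f))" by (rule hecke_mat_vec) (use Cons in simp)
  finally show ?case by simp
qed

definition delta :: "'a \<Rightarrow> 'a \<Rightarrow> 'c :: comm_ring_1" where "delta w v = (if v = w then 1 else 0)"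

lemma fun_vec_delta: "j < gsize \<Longrightarrow> fun_vec (delta (enum j)) = unit_vec gsize j"
  unfolding fun_vec_def delta_def by (rule eq_vecI) (auto simp: enum_eq_iff unit_vec_def)

lemma mat_unit_entry:
  fixes A :: "complex mat"
  assumes "A \<in> carrier_mat n n" "i < n" "j < n" shows "(A *\<^sub>v unit_vec n j) $ i = A $$ (i, j)"
  using assms by simp

lemma hecke_word_entry:
  assumes "set xs \<subseteq> S" "i < gsize" "j < gsize"
  shows "hecke_word z xs $$ (i, j) = foldr (hecke z) xs (delta (enum j)) (enum i)"
proof -
  have "hecke_word z xs $$ (i, j) = (hecke_word z xs *\<^sub>v fun_vec (delta (enum j))) $ i"
    using mat_unit_entry[OF hecke_word_carrier assms(2,3)] fun_vec_delta[OF assms(3)] by simp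
  then show ?thesis unfolding hecke_word_vec[OF assms(1)] using assms(2) by (simp add: fun_vec_def)
qed

lemma mat_eqI_fun_vec:
  assumes "A \<in> carrier_mat gsize gsize" "B \<in> carrier_mat gsize gsize"
    and "\<And>f. A *\<^sub>v fun_vec f = B *\<^sub>v fun_vec f"
  shows "A = B"
proof (rule eq_matI)
  fix i j assume "i < dim_row B" "j < dim_col B"
  then have ij: "i < gsize" "j < gsize" using assms(2) by auto
  show "A $$ (i, j) = B $$ (i, j)"
    using mat_unit_entry[OF assms(1) ij] mat_unit_entry[OF assms(2) ij] assms(3)[of "delta (enum j)"]
    unfolding fun_vec_delta[OF ij(2)] by simp
qed (use assms in auto)

lemma hecke_word_eqI:
  assumes "set xs \<subseteq> S" "set ys \<subseteq> S"
    and "\<And>f v. v \<in> carrier G \<Longrightarrow> foldr (hecke z) xs f v = foldr (hecke z) ys f v"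
  shows "hecke_word z xs = hecke_word z ys"
  by (rule mat_eqI_fun_vec)
    (use assms in \<open>simp_all add: hecke_word_vec fun_vec_cong[of "foldr (hecke z) xs f" "foldr (hecke z) ys f" for f]\<close>)

lemma hecke_mat_quadratic:
  assumes "s \<in> S"
  shows "hecke_mat z s * hecke_mat z s = 1\<^sub>m gsize + z \<cdot>\<^sub>m hecke_mat z s"
proof (rule mat_eqI_fun_vec)
  fix f
  have "hecke_mat z s * hecke_mat z s *\<^sub>v fun_vec f = fun_vec (hecke z s (hecke z s f))"
    using assoc_mult_mat_vec[OF hecke_mat_carrier hecke_mat_carrier fun_vec_carrier, of z s z s f]
      hecke_mat_vec[OF assms] by simp
  also have "\<dots> = fun_vec (\<lambda>v. f v + z * hecke z s f v)"
    by (rule fun_vec_cong) (rule hecke_quadratic[OF assms])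
  also have "\<dots> = fun_vec f + z \<cdot>\<^sub>v (hecke_mat z s *\<^sub>v fun_vec f)"
    unfolding hecke_mat_vec[OF assms] by (rule eq_vecI) simp_all
  also have "z \<cdot>\<^sub>v (hecke_mat z s *\<^sub>v fun_vec f) = (z \<cdot>\<^sub>m hecke_mat z s) *\<^sub>v fun_vec f"
    by (rule smult_mat_mult_vec[symmetric, OF hecke_mat_carrier fun_vec_carrier])
  also have "fun_vec f + (z \<cdot>\<^sub>m hecke_mat z s) *\<^sub>v fun_vec f = (1\<^sub>m gsize + z \<cdot>\<^sub>m hecke_mat z s) *\<^sub>v fun_vec f"
    by (subst add_mult_distrib_mat_vec[of _ gsize gsize]) simp_all
  finally show "hecke_mat z s * hecke_mat z s *\<^sub>v fun_vec f = (1\<^sub>m gsize + z \<cdot>\<^sub>m hecke_mat z s) *\<^sub>v fun_vec f" .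
qed (auto intro!: mult_carrier_mat)

lemma hecke_mat_transpose:
  assumes "s \<in> S" shows "transpose_mat (hecke_mat z s) = hecke_mat z s"
proof (rule eq_matI)
  fix i j assume "i < dim_row (hecke_mat z s)" "j < dim_col (hecke_mat z s)"
  then have ij: "i < gsize" "j < gsize" by (auto simp: hecke_mat_def)
  have "enum i = enum j \<otimes> s \<longleftrightarrow> enum j = enum i \<otimes> s" using ij assms by auto
  then show "transpose_mat (hecke_mat z s) $$ (i, j) = hecke_mat z s $$ (i, j)"
    using ij by (auto simp: hecke_mat_def)
qed (auto simp: hecke_mat_def)

lemma hecke_word_transpose: "set xs \<subseteq> S \<Longrightarrow> transpose_mat (hecke_word z xs) = hecke_word z (rev xs)"
proof (induction xs)
  case Nil
  then show ?case by (simp add: hecke_word_def)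
next
  case (Cons s xs)
  have "hecke_word z (s # xs) = hecke_mat z s * hecke_word z xs" by (simp add: hecke_word_def)
  then have "transpose_mat (hecke_word z (s # xs))
      = transpose_mat (hecke_word z xs) * transpose_mat (hecke_mat z s)"
    by (simp add: transpose_mult[OF hecke_mat_carrier hecke_word_carrier])
  also have "\<dots> = hecke_word z (rev xs) * hecke_word z [s]"
    using Cons hecke_mat_transpose[of s] right_mult_one_mat[OF hecke_mat_carrier] by (simp add: hecke_word_def)
  finally show ?case by (simp add: hecke_word_append)
qed

lemma foldr_hecke_of_real:
  fixes f :: "'a \<Rightarrow> real"
  shows "foldr (hecke (complex_of_real z)) xs (\<lambda>v. of_real (f v)) v = of_real (foldr (hecke z) xs f v)"
proof (induction xs arbitrary: v)
  case (Cons s xs)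
  have "foldr (hecke (complex_of_real z)) xs (\<lambda>v. of_real (f v)) = (\<lambda>v. of_real (foldr (hecke z) xs f v))"
    by (rule ext) (rule Cons)
  then show ?case unfolding foldr.simps o_apply hecke_def[of _ s] by simp
qed simp

lemma delta_of_real: "delta w = (\<lambda>v. complex_of_real (delta w v))"
  by (auto simp: delta_def)

lemma hecke_word_entry_real:
  assumes "set xs \<subseteq> S" "i < gsize" "j < gsize"
  shows "hecke_word (of_real z) xs $$ (i, j) = of_real (foldr (hecke z) xs (delta (enum j)) (enum i))"
  using hecke_word_entry[OF assms, of "of_real z"] foldr_hecke_of_real[of z xs "delta (enum j)" "enum i"]
  by (simp only: delta_of_real[symmetric])

text \<open>The operator of \<open>w0\<close> is the image of the half twist of the braid group;
  here its k-th power.\<close>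

definition half_twist :: "complex \<Rightarrow> nat \<Rightarrow> complex mat" where
  "half_twist z k = hecke_word z (concat (replicate k w0_word))"

lemma w0_words [simp]: "set (concat (replicate k w0_word)) \<subseteq> S"
  using w0_word(1) by (auto simp: set_replicate_conv_if split: if_splits)

lemma half_twist_carrier [simp]: "half_twist z k \<in> carrier_mat gsize gsize"
  by (simp add: half_twist_def)

lemma foldr_hecke_rev_w0:
  "v \<in> carrier G \<Longrightarrow> foldr (hecke z) (concat (replicate k (rev w0_word))) f v
    = foldr (hecke z) (concat (replicate k w0_word)) f v"
proof (induction k arbitrary: v)
  case (Suc k)
  have r: "set (rev w0_word) \<subseteq> S" "length (rev w0_word) = len w0" "word_prod G (rev w0_word) = w0"
    using w0_word word_rev[OF w0_word(1)] by simp_all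
  have "foldr (hecke z) (concat (replicate (Suc k) (rev w0_word))) f v
      = foldr (hecke z) (rev w0_word) (foldr (hecke z) (concat (replicate k (rev w0_word))) f) v" by simp
  also have "\<dots> = foldr (hecke z) (rev w0_word) (foldr (hecke z) (concat (replicate k w0_word)) f) v"
    by (rule foldr_hecke_cong[OF Suc.IH r(1) Suc.prems])
  also have "\<dots> = foldr (hecke z) w0_word (foldr (hecke z) (concat (replicate k w0_word)) f) v"
    by (rule foldr_hecke_w0_word[OF r Suc.prems])
  finally show ?case by simp
qed simp

text \<open>Transposition reverses the word, since each generator is symmetric, and the reverse of a
  reduced word of \<open>w0\<close> is again a reduced word of \<open>w0\<close>.\<close>

lemma half_twist_symmetric: "real_symmetric (half_twist (of_real z) k)"
proof -
  let ?H = "half_twist (of_real z) k" and ?w = "concat (replicate k w0_word)"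
  have rev: "rev ?w = concat (replicate k (rev w0_word))" by (simp add: rev_concat)
  have "hecke_word (of_real z) (rev ?w) = hecke_word (of_real z) ?w"
  proof (rule hecke_word_eqI)
    show "set (rev ?w) \<subseteq> S" using w0_words[of k] by (simp only: set_rev)
    fix f :: "'a \<Rightarrow> complex" and v assume "v \<in> carrier G"
    then show "foldr (hecke (of_real z)) (rev ?w) f v = foldr (hecke (of_real z)) ?w f v"
      unfolding rev by (rule foldr_hecke_rev_w0)
  qed (rule w0_words)
  then have t: "transpose_mat ?H = ?H" unfolding half_twist_def using hecke_word_transpose[OF w0_words] by simp
  have "?H $$ (i, j) = ?H $$ (j, i)" if "i < gsize" "j < gsize" for i j
    using arg_cong[OF t, of "\<lambda>M. M $$ (j, i)"] that half_twist_carrier[of "of_real z" k] by simp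
  moreover have "cnj (?H $$ (i, j)) = ?H $$ (i, j)" if "i < gsize" "j < gsize" for i j
    unfolding half_twist_def hecke_word_entry_real[OF w0_words that] by simp
  moreover have "dim_row ?H = gsize" by (rule carrier_matD(1)[OF half_twist_carrier])
  ultimately show ?thesis unfolding real_symmetric_def by simp
qed

lemma foldr_hecke_twists_commute:
  assumes "s \<in> S" "v \<in> carrier G"
  shows "hecke z s (foldr (hecke z) (concat (replicate k (w0_word @ w0_word))) f) v
    = foldr (hecke z) (concat (replicate k (w0_word @ w0_word))) (hecke z s f) v"
  using assms(2)
proof (induction k arbitrary: v)
  case (Suc k)
  let ?w = "w0_word @ w0_word" and ?R = "foldr (hecke z) (concat (replicate k (w0_word @ w0_word)))"
  have w: "set ?w \<subseteq> S" using w0_word(1) by simp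
  have "hecke z s (foldr (hecke z) (concat (replicate (Suc k) ?w)) f) v
      = hecke z s (foldr (hecke z) ?w (?R f)) v" by simp
  also have "\<dots> = foldr (hecke z) ?w (hecke z s (?R f)) v" by (rule hecke_full_twist[OF assms(1) Suc.prems])
  also have "\<dots> = foldr (hecke z) ?w (?R (hecke z s f)) v" by (rule foldr_hecke_cong[OF Suc.IH w Suc.prems])
  finally show ?case by simp
qed simp

lemma half_twist_square_word: "half_twist z k * half_twist z k
    = hecke_word z (concat (replicate (2 * k) w0_word))"
  unfolding half_twist_def hecke_word_append[symmetric] concat_append[symmetric] replicate_add[symmetric]
  by (simp add: mult_2)

lemma half_twist_central:
  assumes "s \<in> S"
  shows "hecke_mat z s * (half_twist z k * half_twist z k) = (half_twist z k * half_twist z k) * hecke_mat z s"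
proof -
  let ?w = "concat (replicate (2 * k) w0_word)"
  have c: "?w = concat (replicate k (w0_word @ w0_word))" by (induction k) simp_all
  have m: "hecke_word z [s] = hecke_mat z s"
    using right_mult_one_mat[OF hecke_mat_carrier] by (simp add: hecke_word_def)
  have "hecke_word z ([s] @ ?w) = hecke_word z (?w @ [s])"
  proof (rule hecke_word_eqI)
    show "set ([s] @ ?w) \<subseteq> S" "set (?w @ [s]) \<subseteq> S" using assms w0_words[of "2 * k"] by simp_all
    fix f :: "'a \<Rightarrow> complex" and v assume "v \<in> carrier G"
    then show "foldr (hecke z) ([s] @ ?w) f v = foldr (hecke z) (?w @ [s]) f v"
      unfolding c using foldr_hecke_twists_commute[OF assms] by simp
  qed
  then show ?thesis unfolding half_twist_square_word hecke_word_append m .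
qed

end

subsection \<open>Traces of powers of the Coxeter operator\<close>

text \<open>Divide by the k-th power of \<open>y\<close> and pass to the limit, for k = 0, 1, ..., r
  in turn: each coefficient below \<open>r\<close> vanishes, and the one at \<open>r\<close> equals
  the limit of \<open>g\<close>.\<close>

lemma low_coefficient:
  fixes f :: "nat \<Rightarrow> real"
  assumes eq: "\<forall>\<^sub>F x in F. (\<Sum>k\<le>L. f k * y x ^ k) = y x ^ r * g x"
    and y: "(y \<longlongrightarrow> 0) F" and nz: "\<forall>\<^sub>F x in F. y x \<noteq> 0"
    and g: "(g \<longlongrightarrow> c) F" and r: "r \<le> L" and F: "F \<noteq> bot"
  shows "f r = c"
proof -
  have main: "f k = (if k = r then c else 0)" if "k \<le> r" for k
    using that
  proof (induction k rule: less_induct)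
    case (less k)
    have zero: "f j = 0" if "j < k" for j using less that by auto
    have "((\<lambda>x. \<Sum>j\<in>{k..L}. f j * y x ^ (j - k)) \<longlongrightarrow> (\<Sum>j\<in>{k..L}. f j * 0 ^ (j - k))) F"
      by (intro tendsto_intros y)
    moreover have "(\<Sum>j\<in>{k..L}. f j * 0 ^ (j - k)) = (\<Sum>j\<in>{k..L}. if j = k then f k else 0)"
      by (rule sum.cong[OF HOL.refl]) (auto simp: power_0_left)
    ultimately have 1: "((\<lambda>x. \<Sum>j\<in>{k..L}. f j * y x ^ (j - k)) \<longlongrightarrow> f k) F"
      using less.prems r by simp
    have "\<forall>\<^sub>F x in F. (\<Sum>j\<in>{k..L}. f j * y x ^ (j - k)) = y x ^ (r - k) * g x"
      using eq nz
    proof eventually_elim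
      case (elim x)
      have "y x ^ k * (\<Sum>j\<in>{k..L}. f j * y x ^ (j - k)) = (\<Sum>j\<in>{k..L}. f j * y x ^ j)"
        unfolding sum_distrib_left
        by (rule sum.cong[OF HOL.refl]) (simp add: algebra_simps power_add[symmetric])
      also have "\<dots> = (\<Sum>j\<le>L. f j * y x ^ j)"
        by (rule sum.mono_neutral_left) (auto simp: zero)
      also have "\<dots> = y x ^ k * (y x ^ (r - k) * g x)"
        using elim(1) less.prems by (simp add: mult.assoc[symmetric] power_add[symmetric])
      finally show ?case using elim(2) by simp
    qed
    then have 2: "((\<lambda>x. y x ^ (r - k) * g x) \<longlongrightarrow> f k) F" by (rule Lim_transform_eventually[OF 1])
    have "((\<lambda>x. y x ^ (r - k) * g x) \<longlongrightarrow> 0 ^ (r - k) * c) F" by (intro tendsto_intros y g)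
    then have "f k = 0 ^ (r - k) * c" using tendsto_unique[OF F 2] by blast
    then show ?case using less.prems by (auto simp: power_0_left)
  qed
  then show ?thesis by simp
qed

definition sinh2 :: "real \<Rightarrow> real" where "sinh2 x = exp x - exp (- x)"

lemma sinh2_eq_0 [simp]: "sinh2 x = 0 \<longleftrightarrow> x = 0"
  by (simp add: sinh2_def)

lemma sinh2_ratio: "((\<lambda>x. sinh2 (a * x) / sinh2 x) \<longlongrightarrow> a) (at 0)"
proof -
  have d: "((\<lambda>x. sinh2 (b * x)) has_real_derivative 2 * b) (at 0)" for b
    unfolding sinh2_def by (auto intro!: derivative_eq_intros)
  have z: "sinh2 0 = 0" by (simp add: sinh2_def)
  have l: "((\<lambda>x. sinh2 (b * x) / x) \<longlongrightarrow> 2 * b) (at 0)" for b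
    using d[of b] unfolding has_field_derivative_iff by (simp add: z)
  have "((\<lambda>x. (sinh2 (a * x) / x) / (sinh2 (1 * x) / x)) \<longlongrightarrow> (2 * a) / (2 * 1)) (at 0)"
    by (intro tendsto_divide l) simp
  moreover have "\<forall>\<^sub>F x in at 0. (sinh2 (a * x) / x) / (sinh2 (1 * x) / x) = sinh2 (a * x) / sinh2 x"
    using eventually_neq_at_within[of "0::real" 0 UNIV] by eventually_elim simp
  ultimately show ?thesis by (simp add: Lim_transform_eventually)
qed

lemma sinh2_tendsto_0: "(sinh2 \<longlongrightarrow> 0) (at 0)"
proof -
  have "(sinh2 \<longlongrightarrow> exp 0 - exp (- 0)) (at 0)" unfolding sinh2_def by (intro tendsto_intros)
  then show ?thesis by simp
qed

lemma signed_sum_shift: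
  "(\<Sum>(s, k)\<leftarrow>map (\<lambda>(s, k). (a * s, k + b)) L. of_int s * exp (of_int k * x))
    = of_int a * exp (of_int b * x) * (\<Sum>(s, k)\<leftarrow>L. of_int s * exp (of_int k * (x::real)))"
proof (induction L)
  case (Cons p L)
  then show ?case by (cases p) (simp add: distrib_right distrib_left exp_add mult_ac)
qed simp

context finite_coxeter_system
begin

text \<open>Multiplication by \<open>sinh2 x\<close> splits each monomial into one raised by 1 with
  the same sign and one lowered by 1 with the opposite sign. Repeated monomials stay separate in the
  list, which does not depend on \<open>x\<close>.\<close>

lemma foldr_hecke_signed_sum:
  assumes "set xs \<subseteq> S" "v \<in> carrier G"
  shows "\<exists>L. (\<forall>(s, k)\<in>set L. s = 1 \<or> s = -1) \<and>
    (\<forall>x. foldr (hecke (sinh2 x)) xs (delta w) v = (\<Sum>(s, k)\<leftarrow>L. of_int s * exp (of_int k * x)))"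
  using assms
proof (induction xs arbitrary: v)
  case Nil
  show ?case
  proof (cases "v = w")
    case True
    then show ?thesis by (intro exI[of _ "[(1, 0)]"]) (simp add: delta_def)
  next
    case False
    then show ?thesis by (intro exI[of _ "[]"]) (simp add: delta_def)
  qed
next
  case (Cons s xs)
  then have "v \<otimes> s \<in> carrier G" "set xs \<subseteq> S" by auto
  from Cons.IH[OF this(2,1)] Cons.IH[OF this(2) Cons.prems(2)] obtain L1 L2 where
    L: "\<forall>(s, k)\<in>set L1. s = 1 \<or> s = -1" "\<forall>(s, k)\<in>set L2. s = 1 \<or> s = -1"
      "\<And>x. foldr (hecke (sinh2 x)) xs (delta w) (v \<otimes> s) = (\<Sum>(s, k)\<leftarrow>L1. of_int s * exp (of_int k * x))"
      "\<And>x. foldr (hecke (sinh2 x)) xs (delta w) v = (\<Sum>(s, k)\<leftarrow>L2. of_int s * exp (of_int k * x))"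
    by (elim exE conjE) simp
  define M where "M = (if len v < len (v \<otimes> s)
    then map (\<lambda>(s, k). (1 * s, k + 1)) L2 @ map (\<lambda>(s, k). (-1 * s, k + -1)) L2 else [])"
  have "\<forall>(s, k)\<in>set (L1 @ M). s = 1 \<or> s = -1" using L(1,2) by (auto simp: M_def)
  moreover have "foldr (hecke (sinh2 x)) (s # xs) (delta w) v
      = (\<Sum>(s, k)\<leftarrow>L1 @ M. of_int s * exp (of_int k * x))" for x
    unfolding foldr.simps o_apply hecke_def[of _ s] L(3,4) M_def
    by (simp only: map_append sum_list_append signed_sum_shift sinh2_def split: if_split)
      (simp add: algebra_simps)
  ultimately show ?case by (intro exI[of _ "L1 @ M"]) (intro conjI allI)
qed

definition hecke_trace :: "real \<Rightarrow> 'a list \<Rightarrow> real" where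
  "hecke_trace z xs = (\<Sum>v\<in>carrier G. foldr (hecke z) xs (delta v) v)"

lemma mat_trace_hecke_word:
  assumes "set xs \<subseteq> S" shows "mat_trace (hecke_word (of_real z) xs) = of_real (hecke_trace z xs)"
proof -
  have "mat_trace (hecke_word (of_real z) xs) = (\<Sum>i<gsize. hecke_word (of_real z) xs $$ (i, i))"
    by (simp add: mat_trace_def)
  also have "\<dots> = (\<Sum>i<gsize. of_real (foldr (hecke z) xs (delta (enum i)) (enum i)))"
    by (rule sum.cong[OF HOL.refl]) (simp add: hecke_word_entry_real[OF assms])
  also have "\<dots> = of_real (hecke_trace z xs)"
    unfolding hecke_trace_def of_real_sum[symmetric]
    using sum_enum[of "\<lambda>v. foldr (hecke z) xs (delta v) v"] by simp
  finally show ?thesis .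
qed

lemma word_power_subset: "set xs \<subseteq> S \<Longrightarrow> set (word_power xs m) \<subseteq> S"
  by (induction m) (auto simp: word_power_def)

lemma hecke_word_power: "hecke_word z (word_power xs m) = hecke_word z xs ^\<^sub>m m"
  unfolding hecke_word_def word_power_def map_concat map_replicate
  by (rule mat_prod_concat_replicate) (rule hecke_mats)

lemma pow_mat_power:
  fixes A :: "complex mat"
  assumes A: "A \<in> carrier_mat n n" and M: "\<And>i j. \<lbrakk>i < n; j < n\<rbrakk> \<Longrightarrow> A $$ (i, j) = of_real (M i j)"
    and ij: "i < n" "j < n"
  shows "(A ^\<^sub>m m) $$ (i, j) = of_real (mat_power n M m i j)"
  using ij(1)
proof (induction m arbitrary: i)
  case 0
  then show ?case using A ij(2) by simp
next
  case (Suc m)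
  have P: "A ^\<^sub>m m \<in> carrier_mat n n" using A by simp
  have "(A ^\<^sub>m Suc m) $$ (i, j) = (A * A ^\<^sub>m m) $$ (i, j)" using pow_mat_commute[OF A] by simp
  also have "\<dots> = (\<Sum>k<n. A $$ (i, k) * (A ^\<^sub>m m) $$ (k, j))"
    using A P Suc.prems ij(2) by (simp add: scalar_prod_def atLeast0LessThan)
  also have "\<dots> = (\<Sum>k<n. of_real (M i k * mat_power n M m k j))"
    by (rule sum.cong[OF HOL.refl]) (simp add: M Suc)
  finally show ?case by simp
qed

text \<open>The monomials of the entries become the edges of a signed graph on the group.\<close>

lemma hecke_signed_graph:
  assumes "set xs \<subseteq> S"
  shows "\<exists>(E :: (nat \<times> nat \<times> nat) set) src tgt sg ex. signed_graph gsize E src tgt sg \<and>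
    (\<forall>m>0. \<forall>x. hecke_trace (sinh2 x) (word_power xs m)
      = (\<Sum>k\<in>signed_graph.expos E ex m. of_int (signed_graph.trace_coeff E src tgt sg ex m k) * exp (of_int k
          * x)))"
proof -
  define P where "P i j L \<longleftrightarrow> (\<forall>(s, k)\<in>set L. s = 1 \<or> s = (-1 :: int)) \<and>
    (\<forall>x. foldr (hecke (sinh2 x)) xs (delta (enum j)) (enum i)
        = (\<Sum>(s, k)\<leftarrow>L. of_int s * exp (of_int (k :: int) * x)))"
    for i j L
  define L where "L i j = (SOME L. P i j L)" for i j
  have PL: "P i j (L i j)" if "i < gsize" for i j
  proof -
    have "\<exists>L. P i j L" unfolding P_def by (rule foldr_hecke_signed_sum[OF assms enum_carrier[OF that]])
    then show ?thesis unfolding L_def by (rule someI_ex)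
  qed
  have L: "\<forall>(s, k)\<in>set (L i j). s = 1 \<or> s = -1"
    "foldr (hecke (sinh2 x)) xs (delta (enum j)) (enum i) = (\<Sum>(s, k)\<leftarrow>L i j. of_int s * exp (of_int k * x))"
    if "i < gsize" for i j x
    using PL[OF that, of j] by (simp_all add: P_def)
  define E where "E = (SIGMA i:{..<gsize}. SIGMA j:{..<gsize}. {..<length (L i j)})"
  define src :: "nat \<times> nat \<times> nat \<Rightarrow> nat" where "src = (\<lambda>(i, j, e). i)"
  define tgt :: "nat \<times> nat \<times> nat \<Rightarrow> nat" where "tgt = (\<lambda>(i, j, e). j)"
  define sg where "sg = (\<lambda>(i, j, e). fst (L i j ! e))"
  define ex where "ex = (\<lambda>(i, j, e). snd (L i j ! e))"
  interpret signed_graph gsize E src tgt sg ex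
  proof
    show "finite E" by (auto simp: E_def)
    show "src e < gsize" "tgt e < gsize" if "e \<in> E" for e
      using that by (auto simp: E_def src_def tgt_def)
    show "sg e = 1 \<or> sg e = -1" if "e \<in> E" for e
    proof -
      from that obtain i j k where e: "e = (i, j, k)" "i < gsize" "k < length (L i j)" by (auto simp: E_def)
      have "L i j ! k \<in> set (L i j)" using e by simp
      then have "case L i j ! k of (s, k) \<Rightarrow> s = 1 \<or> s = -1" using L(1)[OF e(2)] by (rule bspec[rotated])
      then show ?thesis unfolding e(1) sg_def by (simp add: case_prod_beta)
    qed
  qed
  have entry: "entry x i j = foldr (hecke (sinh2 x)) xs (delta (enum j)) (enum i)"
    if ij: "i < gsize" "j < gsize" for x i j
  proof -
    let ?t = "\<lambda>i j e. of_int (fst (L i j ! e)) * exp (of_int (snd (L i j ! e)) * x)"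
    have "entry x i j = (\<Sum>(i', j', e)\<in>E. if i' = i \<and> j' = j then ?t i' j' e else 0)"
      unfolding entry_def by (rule sum.cong[OF HOL.refl]) (auto simp: src_def tgt_def sg_def ex_def)
    also have "\<dots> = (\<Sum>i'<gsize. \<Sum>(j', e)\<in>(SIGMA j:{..<gsize}. {..<length (L i' j)}). if i' = i \<and> j'
        = j then ?t i' j' e else 0)"
      unfolding E_def by (rule sum.Sigma[symmetric]) auto
    also have "\<dots> = (\<Sum>i'<gsize. \<Sum>j'<gsize. \<Sum>e<length (L i' j'). if i' = i \<and> j' = j then ?t i' j' e else 0)"
      by (rule sum.cong[OF HOL.refl]) (rule sum.Sigma[symmetric], auto)
    also have "\<dots> = (\<Sum>i'<gsize. \<Sum>j'<gsize. if j' = j then (if i'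
        = i then \<Sum>e<length (L i j). ?t i j e else 0) else 0)"
      by (intro sum.cong HOL.refl) auto
    also have "\<dots> = (\<Sum>e<length (L i j). ?t i j e)" using ij by simp
    also have "\<dots> = (\<Sum>(s, k)\<leftarrow>L i j. of_int s * exp (of_int k * x))"
      unfolding sum_list_sum_nth by (simp add: atLeast0LessThan case_prod_beta)
    finally show ?thesis by (simp only: L(2)[OF ij(1)])
  qed
  have "hecke_trace (sinh2 x) (word_power xs m)
      = (\<Sum>k\<in>expos m. of_int (trace_coeff m k) * exp (of_int k * x))" if "m > 0" for m x
  proof -
    have "complex_of_real (hecke_trace (sinh2 x) (word_power xs m))
        = mat_trace (hecke_word (of_real (sinh2 x)) xs ^\<^sub>m m)"
      unfolding hecke_word_power[symmetric] using mat_trace_hecke_word[OF word_power_subset[OF assms]] by simp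
    also have "\<dots> = (\<Sum>i<gsize. (hecke_word (of_real (sinh2 x)) xs ^\<^sub>m m) $$ (i, i))"
      by (simp add: mat_trace_def)
    also have "\<dots> = (\<Sum>i<gsize. of_real (mat_power gsize (entry x) m i i))"
    proof (rule sum.cong[OF HOL.refl])
      fix i assume "i \<in> {..<gsize}"
      then have i: "i < gsize" by simp
      show "(hecke_word (of_real (sinh2 x)) xs ^\<^sub>m m) $$ (i, i) = of_real (mat_power gsize (entry x) m i i)"
        by (rule pow_mat_power[OF hecke_word_carrier _ i i]) (simp add: hecke_word_entry_real[OF assms] entry)
    qed
    also have "\<dots> = of_real (\<Sum>k\<in>expos m. of_int (trace_coeff m k) * exp (of_int k * x))"
      unfolding trace_expansion[OF that, symmetric] by simp
    finally show ?thesis by (simp only: of_real_eq_iff)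
  qed
  then show ?thesis using signed_graph_axioms by blast
qed

end

context coxeter_word_system
begin

lemma c_subset: "set c \<subseteq> S" using set_c by simp

lemma length_c: "length c = card S" using distinct_card[OF distinct_c] set_c by simp

text \<open>The list \<open>D\<close> may vary with \<open>x\<close>, but its length and the finite
  set of its possible entries do not; this makes the pigeonhole argument possible.\<close>

lemma hecke_coxeter_eigenvalues:
  "\<exists>D. length D = gsize \<and>
    set D \<subseteq> {w. w ^ coxeter_number = 1} \<times>
      (\<lambda>(j, d). of_int j / (real d * real coxeter_number)) `
        ({-int (gsize * (coxeter_number * length c))..int (gsize * (coxeter_number * length c))} \<times> {1..gsize}) \<and>
    (\<forall>m. complex_of_real (hecke_trace (sinh2 x) (word_power c m))
      = (\<Sum>(w, k)\<leftarrow>D. w ^ m * of_real (exp (k * real m * x))))"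
proof -
  let ?h = coxeter_number and ?z = "complex_of_real (sinh2 x)"
  let ?Ms = "map (hecke_mat ?z) c" and ?C = "half_twist ?z (twists div 2)"
  have inv: "1 / exp x = exp (- x)" by (simp add: exp_minus divide_inverse)
  have pow: "mat_prod gsize ?Ms ^\<^sub>m ?h = ?C * ?C"
  proof -
    have "mat_prod gsize ?Ms ^\<^sub>m ?h = hecke_word ?z (word_power c ?h)"
      unfolding hecke_word_def by (rule hecke_word_power[of ?z c ?h, unfolded hecke_word_def, symmetric])
    also have "\<dots> = hecke_word ?z (concat (replicate twists w0_word))"
      by (rule hecke_word_eqI[OF word_power_subset[OF c_subset] w0_words hecke_coxeter_power])
    also have "\<dots> = ?C * ?C" unfolding half_twist_square_word using even_twists by simp
    finally show ?thesis .
  qed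
  have "\<exists>es. length es = gsize \<and> (\<forall>m. mat_trace (mat_prod gsize ?Ms ^\<^sub>m m) = (\<Sum>e\<leftarrow>es. e ^ m)) \<and>
    (\<forall>e\<in>set es. \<exists>(j::int) d. 1 \<le> d \<and> d \<le> gsize \<and> \<bar>j\<bar> \<le> int (gsize * (?h * length ?Ms)) \<and>
      e ^ ?h = of_real (exp x powr (of_int j / real d)))"
  proof (rule hecke_product_eigenvalues[OF _ hecke_mats _ half_twist_carrier half_twist_symmetric pow])
    fix M assume "M \<in> set ?Ms"
    then obtain s where s: "s \<in> S" "M = hecke_mat ?z s" using set_c by auto
    show "M * M = 1\<^sub>m gsize + of_real (exp x - 1 / exp x) \<cdot>\<^sub>m M"
      unfolding s(2) inv sinh2_def[symmetric] by (rule hecke_mat_quadratic[OF s(1)])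
    show "M * (?C * ?C) = ?C * ?C * M" unfolding s(2) by (rule half_twist_central[OF s(1)])
  qed simp
  then obtain es where es: "length es = gsize" "\<And>m. mat_trace (mat_prod gsize ?Ms ^\<^sub>m m) = (\<Sum>e\<leftarrow>es. e ^ m)"
    "\<And>e. e \<in> set es \<Longrightarrow> \<exists>(j::int) d. 1 \<le> d \<and> d \<le> gsize \<and> \<bar>j\<bar> \<le> int (gsize * (?h * length c)) \<and>
      e ^ ?h = of_real (exp x powr (of_int j / real d))"
    unfolding length_map by (elim exE conjE) simp
  let ?K = "(\<lambda>(j, d). of_int j / (real d * real ?h)) `
        ({-int (gsize * (?h * length c))..int (gsize * (?h * length c))} \<times> {1..gsize})"
  define P where "P e p \<longleftrightarrow> fst p ^ ?h = 1 \<and> snd p \<in> ?K \<and> e = fst p * of_real (exp (snd p * x))"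
    for e :: complex and p :: "complex \<times> real"
  have P: "\<exists>p. P e p" if e: "e \<in> set es" for e
  proof -
    from es(3)[OF e] obtain j d where jd: "1 \<le> d" "d \<le> gsize" "\<bar>j\<bar> \<le> int (gsize * (?h * length c))"
      "e ^ ?h = of_real (exp x powr (of_int j / real d))" by (elim exE conjE)
    \<comment> \<open>Chosen so that the positive number \<open>exp (?k * x)\<close> has the same
      h-th power as \<open>e\<close>; the quotient is then an h-th root of unity.\<close>
    let ?k = "of_int j / (real d * real ?h)"
    have "exp (?k * x) ^ ?h = exp (real ?h * (?k * x))" by (rule exp_of_nat_mult[symmetric])
    also have "real ?h * (?k * x) = of_int j / real d * x" using coxeter_number_pos by simp
    also have "exp \<dots> = exp x powr (of_int j / real d)" by (simp add: powr_def)
    finally have "(e / of_real (exp (?k * x))) ^ ?h = 1"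
      unfolding power_divide jd(4) of_real_power[symmetric] by simp
    moreover have "?k \<in> ?K" using jd by (intro image_eqI[of _ _ "(j, d)"]) auto
    ultimately have "P e (e / of_real (exp (?k * x)), ?k)" by (simp add: P_def)
    then show ?thesis by (rule exI)
  qed
  define D where "D = map (\<lambda>e. SOME p. P e p) es"
  have PD: "P e (SOME p. P e p)" if "e \<in> set es" for e using P[OF that] by (rule someI_ex)
  have "length D = gsize" by (simp add: D_def es(1))
  moreover have "set D \<subseteq> {w. w ^ ?h = 1} \<times> ?K"
  proof
    fix p assume "p \<in> set D"
    then obtain e where "e \<in> set es" "p = (SOME p. P e p)" by (auto simp: D_def)
    then have "P e p" using PD by simp
    then show "p \<in> {w. w ^ ?h = 1} \<times> ?K" unfolding P_def mem_Times_iff by simp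
  qed
  moreover have "complex_of_real (hecke_trace (sinh2 x) (word_power c m))
      = (\<Sum>(w, k)\<leftarrow>D. w ^ m * of_real (exp (k * real m * x)))" for m
  proof -
    have "complex_of_real (hecke_trace (sinh2 x) (word_power c m)) = mat_trace (hecke_word ?z c ^\<^sub>m m)"
      unfolding mat_trace_hecke_word[OF word_power_subset[OF c_subset], symmetric] hecke_word_power ..
    also have "\<dots> = (\<Sum>e\<leftarrow>es. e ^ m)" unfolding hecke_word_def by (rule es(2))
    also have "\<dots> = (\<Sum>e\<leftarrow>es. case (SOME p. P e p) of (w, k) \<Rightarrow> w ^ m * of_real (exp (k * real m * x)))"
    proof (rule arg_cong[of _ _ sum_list], rule map_cong[OF HOL.refl])
      fix e assume e: "e \<in> set es"
      obtain w k where p: "(SOME p. P e p) = (w, k)" by (cases "SOME p. P e p")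
      have "P e (w, k)" using PD[OF e] unfolding p .
      then have "e = w * of_real (exp (k * x))" unfolding P_def by simp
      moreover have "exp (k * x) ^ m = exp (k * real m * x)" by (simp add: exp_of_nat_mult[symmetric] mult_ac)
      ultimately show "e ^ m = (case (SOME p. P e p) of (w, k) \<Rightarrow> w ^ m * of_real (exp (k * real m * x)))"
        unfolding p by (simp only: power_mult_distrib of_real_power[symmetric] prod.case)
    qed
    finally show ?thesis by (simp add: D_def o_def)
  qed
  ultimately show ?thesis by (intro exI[of _ D] conjI allI)
qed

text \<open>The eigenvalue data are shared only by infinitely many natural numbers \<open>x\<close>.
  They yield a relation between integer coefficients, and that gives the identity for every real
  \<open>x\<close>.\<close>

theorem hecke_trace_coprime:
  assumes p: "p > 0" "coprime p coxeter_number"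
  shows "hecke_trace (sinh2 x) (word_power c p) = hecke_trace (sinh2 (real p * x)) c"
proof -
  obtain E :: "(nat \<times> nat \<times> nat) set" and src tgt sg ex where sgn: "signed_graph gsize E src tgt sg"
    and tr: "\<And>m x. m > 0 \<Longrightarrow> hecke_trace (sinh2 x) (word_power c m)
      = (\<Sum>k\<in>signed_graph.expos E ex m. of_int (signed_graph.trace_coeff E src tgt sg ex m k) * exp (of_int k
          * x))"
    using hecke_signed_graph[OF c_subset] by (elim exE conjE) simp
  interpret signed_graph gsize E src tgt sg ex by (rule sgn)
  let ?h = coxeter_number
  let ?K = "(\<lambda>(j, d). of_int j / (real d * real ?h)) `
        ({-int (gsize * (?h * length c))..int (gsize * (?h * length c))} \<times> {1..gsize})"
  let ?DD = "{D. set D \<subseteq> {w :: complex. w ^ ?h = 1} \<times> ?K \<and> length D = gsize}"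
  let ?Q = "\<lambda>x D. D \<in> ?DD \<and> (\<forall>m. complex_of_real (hecke_trace (sinh2 x) (word_power c m))
      = (\<Sum>(w, k)\<leftarrow>D. w ^ m * of_real (exp (k * real m * x))))"
  define Dx where "Dx n = (SOME D. ?Q (real n) D)" for n :: nat
  have Dx: "?Q (real n) (Dx n)" for n
  proof -
    have "\<exists>D. ?Q (real n) D" using hecke_coxeter_eigenvalues[of "real n"]
        by (elim exE conjE) (intro exI conjI CollectI)
    then show ?thesis unfolding Dx_def by (rule someI_ex)
  qed
  have "finite {w :: complex. w ^ ?h = 1}" by (rule finite_roots_unity) (use coxeter_number_pos in simp)
  then have "finite ?DD" by (intro finite_lists_length_eq finite_cartesian_product) auto
  moreover have "range Dx \<subseteq> ?DD" using Dx by (intro image_subsetI) (rule conjunct1)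
  ultimately have "finite (range Dx)" by (rule finite_subset[rotated])
  from pigeonhole_infinite[OF infinite_UNIV_nat this]
  obtain n0 where inf: "infinite {n \<in> UNIV. Dx n = Dx n0}" by blast
  define Y where "Y = {n. Dx n = Dx n0}"
  interpret eigenvalue_data trace_coeff ?h "Dx n0" Y expos
  proof
    show "?h > 0" by (rule coxeter_number_pos)
    show "w ^ ?h = 1" if "(w, k) \<in> set (Dx n0)" for w k
    proof -
      have "set (Dx n0) \<subseteq> {w. w ^ ?h = 1} \<times> ?K" using Dx[of n0] by simp
      from subsetD[OF this that] show ?thesis by simp
    qed
    show "infinite Y" using inf by (simp add: Y_def)
    show "finite (expos m)" for m by simp
    show "trace_coeff m k = 0" if "k \<notin> expos m" for k m by (rule trace_coeff_outside[OF that])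
    show "(\<Sum>k\<in>expos m. of_int (trace_coeff m k) * complex_of_real (exp (of_int k * real x)))
        = (\<Sum>(w, k)\<leftarrow>Dx n0. w ^ m * of_real (exp (k * real m * real x)))" if "x \<in> Y" "m > 0" for x m
    proof -
      have "(\<Sum>k\<in>expos m. of_int (trace_coeff m k) * complex_of_real (exp (of_int k * real x)))
          = complex_of_real (hecke_trace (sinh2 (real x)) (word_power c m))"
        unfolding tr[OF that(2)] by simp
      then show ?thesis using Dx[of x] that(1) by (simp add: Y_def)
    qed
    show "int (l ^ Suc b) dvd trace_coeff (l ^ Suc b * m) k -
        (if int l dvd k then trace_coeff (l ^ b * m) (k div int l) else 0)"
      if "Factorial_Ring.prime l" "odd l" for l b m k
      using that by (rule trace_coeff_congruence)
  qed
  \<comment> \<open>The p-th trace uses \<open>expos p\<close>, and the rescaled first trace uses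
    the multiples of \<open>p\<close>. Extending both sums to the union adds only zero
    coefficients.\<close>
  let ?F = "expos p \<union> (\<lambda>k. int p * k) ` expos 1"
  have "hecke_trace (sinh2 x) (word_power c p) = (\<Sum>k\<in>?F. of_int (trace_coeff p k) * exp (of_int k * x))"
    unfolding tr[OF p(1)] by (rule sum.mono_neutral_left) (auto simp: trace_coeff_outside)
  also have "\<dots> = (\<Sum>k\<in>(\<lambda>k. int p * k) ` expos 1. of_int (trace_coeff p k) * exp (of_int k * x))"
  proof (rule sum.mono_neutral_right)
    show "\<forall>k\<in>?F - (\<lambda>k. int p * k) ` expos 1. of_int (trace_coeff p k) * exp (of_int k * x) = 0"
    proof
      fix k assume k: "k \<in> ?F - (\<lambda>k. int p * k) ` expos 1"
      have "trace_coeff 1 (k div int p) = 0" if "int p dvd k"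
      proof (rule trace_coeff_outside)
        show "k div int p \<notin> expos 1"
        proof
          assume "k div int p \<in> expos 1"
          then have "int p * (k div int p) \<in> (\<lambda>k. int p * k) ` expos 1" by (rule imageI)
          then show False using k that by simp
        qed
      qed
      then show "of_int (trace_coeff p k) * exp (of_int k * x) = 0" using coefficient_coprime[OF p, of k]
          by simp
    qed
  qed auto
  also have "\<dots> = (\<Sum>k\<in>expos 1. of_int (trace_coeff p (int p * k)) * exp (of_int (int p * k) * x))"
    using p(1) by (subst sum.reindex) (auto simp: inj_on_def)
  also have "\<dots> = (\<Sum>k\<in>expos 1. of_int (trace_coeff 1 k) * exp (of_int k * (real p * x)))"
    using p(1) by (intro sum.cong HOL.refl) (simp add: coefficient_coprime[OF p] mult_ac)
  also have "\<dots> = hecke_trace (sinh2 (real p * x)) (word_power c 1)" by (rule tr[symmetric]) simp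
  finally show ?thesis by (simp add: word_power_def)
qed

end

section \<open>Counting Deograms by their skips\<close>

context finite_coxeter_system
begin

definition deograms :: "'a list \<Rightarrow> ('a \<times> 'a list) set" where
  "deograms ws = (SIGMA v:carrier G. {us \<in> subwords G ws. word_prod G us = \<one> \<and> distinguished G S v ws us})"

lemma finite_deograms [simp]: "finite (deograms ws)"
  unfolding deograms_def by (rule finite_SigmaI[OF finite_carrier]) simp

lemma hecke_trace_deograms:
  assumes "set ws \<subseteq> S"
  shows "hecke_trace z ws = (\<Sum>(v, us)\<in>deograms ws. z ^ skips G us)"
proof -
  have "foldr (hecke z) ws (delta v) v
      = (\<Sum>us | us \<in> subwords G ws \<and> word_prod G us = \<one> \<and> distinguished G S v ws us. z ^ skips G us)"
    if v: "v \<in> carrier G" for v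
  proof -
    have "foldr (hecke z) ws (delta v) v
        = (\<Sum>us | us \<in> subwords G ws \<and> distinguished G S v ws us. z ^ skips G us * delta v (v \<otimes> word_prod G us))"
      by (rule foldr_hecke_expand[OF assms v])
    also have "\<dots> = (\<Sum>us | us \<in> subwords G ws \<and> distinguished G S v ws us.
        if word_prod G us = \<one> then z ^ skips G us else 0)"
    proof (rule sum.cong[OF HOL.refl])
      fix us assume "us \<in> {us. us \<in> subwords G ws \<and> distinguished G S v ws us}"
      then have "us \<in> subwords G ws" by simp
      then have "word_prod G us \<in> carrier G" by (rule word_prod_closed[OF subwords_closed[OF _ assms]])
      then have "v \<otimes> word_prod G us = v \<longleftrightarrow> word_prod G us = \<one>" using v by simp
      then show "z ^ skips G us * delta v (v \<otimes> word_prod G us)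
          = (if word_prod G us = \<one> then z ^ skips G us else 0)" by (simp add: delta_def)
    qed
    also have "\<dots> = (\<Sum>us | us \<in> subwords G ws \<and> word_prod G us = \<one> \<and> distinguished G S v ws us. z ^ skips G us)"
      by (subst sum.inter_filter[symmetric]) (auto intro!: sum.cong)
    finally show ?thesis .
  qed
  then have "hecke_trace z ws = (\<Sum>v\<in>carrier G.
      \<Sum>us\<in>{us \<in> subwords G ws. word_prod G us = \<one> \<and> distinguished G S v ws us}. z ^ skips G us)"
    unfolding hecke_trace_def by (rule sum.cong[OF HOL.refl])
  also have "\<dots> = (\<Sum>(v, us)\<in>deograms ws. z ^ skips G us)"
    unfolding deograms_def using finite_carrier by (intro sum.Sigma) simp_all
  finally show ?thesis .
qed

lemma skips_le: "us \<in> subwords G ws \<Longrightarrow> skips G us \<le> length ws"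
  using length_filter_le[of "\<lambda>u. u = \<one>" us] by (simp add: skips_filter subwords_def)

lemma hecke_trace_expand:
  assumes "set ws \<subseteq> S"
  shows "hecke_trace z ws = (\<Sum>k\<le>length ws. real (card {(v, us) \<in> deograms ws. skips G us = k}) * z ^ k)"
proof -
  have "hecke_trace z ws = (\<Sum>d\<in>deograms ws. z ^ skips G (snd d))"
    unfolding hecke_trace_deograms[OF assms] by (simp add: case_prod_beta)
  also have "\<dots> = (\<Sum>k\<le>length ws. \<Sum>d | d \<in> deograms ws \<and> skips G (snd d) = k. z ^ skips G (snd d))"
  proof (rule sum.group[symmetric])
    show "(\<lambda>d. skips G (snd d)) ` deograms ws \<subseteq> {..length ws}"
      by (auto simp: deograms_def skips_le)
  qed simp_all
  also have "\<dots> = (\<Sum>k\<le>length ws. real (card {(v, us) \<in> deograms ws. skips G us = k}) * z ^ k)"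
  proof (rule sum.cong[OF HOL.refl])
    fix k
    have "{d. d \<in> deograms ws \<and> skips G (snd d) = k} = {(v, us) \<in> deograms ws. skips G us = k}" by auto
    moreover have "(\<Sum>d | d \<in> deograms ws \<and> skips G (snd d) = k. z ^ skips G (snd d))
        = (\<Sum>d | d \<in> deograms ws \<and> skips G (snd d) = k. z ^ k)"
      by (rule sum.cong[OF HOL.refl]) simp
    ultimately show "(\<Sum>d | d \<in> deograms ws \<and> skips G (snd d) = k. z ^ skips G (snd d))
        = real (card {(v, us) \<in> deograms ws. skips G us = k}) * z ^ k" by simp
  qed
  finally show ?thesis .
qed

lemma subword_act_off:
  assumes "us \<in> subwords G ws" "set ws \<subseteq> S" "t \<notin> set ws"
  shows "act (word_prod G us) x t = x t"
  using assms
proof (induction ws arbitrary: us)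
  case (Cons s ws)
  then obtain vs where vs: "vs \<in> subwords G ws" "us = s # vs \<or> us = \<one> # vs" by (auto simp: subwords_Cons)
  have c: "word_prod G vs \<in> carrier G" using Cons.prems
      by (intro word_prod_closed subwords_closed[OF vs(1)]) simp
  have "act (word_prod G vs) x t = x t" using Cons vs(1) by simp
  then show ?case using vs(2) c Cons.prems by (elim disjE) (simp_all add: act_mult act_simple reflect_apply)
qed simp

text \<open>If the first letter \<open>s\<close> were taken, the rest would have to multiply to
  \<open>s\<close>. But the rest avoids \<open>s\<close> and preserves coordinate \<open>s\<close>,
  while \<open>s\<close> negates that coordinate of its simple root.\<close>

lemma trivial_subword:
  assumes "us \<in> subwords G ws" "distinct ws" "set ws \<subseteq> S" "word_prod G us = \<one>"
  shows "us = replicate (length ws) \<one>"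
  using assms
proof (induction ws arbitrary: us)
  case (Cons s ws)
  then obtain vs where vs: "vs \<in> subwords G ws" "us = s # vs \<or> us = \<one> # vs" by (auto simp: subwords_Cons)
  have c: "word_prod G vs \<in> carrier G" using Cons.prems
      by (intro word_prod_closed subwords_closed[OF vs(1)]) simp
  have s: "s \<in> S" "s \<notin> set ws" "set ws \<subseteq> S" using Cons.prems by auto
  have "us \<noteq> s # vs"
  proof
    assume "us = s # vs"
    then have "s \<otimes> word_prod G vs = \<one>" using Cons.prems by simp
    then have "act s (act (word_prod G vs) (simple_root s)) s = simple_root s s"
      using act_mult[of s "word_prod G vs" "simple_root s"] s c by simp
    moreover have "act s y s = y s - pairing y s" for y using s by (simp add: act_simple reflect_apply)
    moreover have "s \<otimes> (s \<otimes> word_prod G vs) = s" using \<open>s \<otimes> word_prod G vs = \<one>\<close> s(1) by simp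
    then have "word_prod G vs = s" using s(1) c by simp
    ultimately show False
      using subword_act_off[OF vs(1) s(3,2), of "simple_root s"] s(1) pairing_simple_root[OF s(1), of s]
      by (simp add: simple_root_def)
  qed
  then have "us = \<one> # vs" using vs(2) by simp
  then show ?case using Cons vs(1) c s by simp
qed simp

lemma word_prod_replicate_one [simp]: "word_prod G (replicate n \<one>) = \<one>"
  by (induction n) simp_all

lemma skips_replicate_one: "skips G (replicate n \<one>) = n"
  by (simp add: skips_filter)

lemma replicate_one_subword: "replicate (length ws) \<one> \<in> subwords G ws"
  by (simp add: subwords_def)

lemma distinguished_replicate_one:
  assumes "set ws = S" "v \<in> carrier G"
  shows "distinguished G S v ws (replicate (length ws) \<one>) \<longleftrightarrow> v = \<one>"
proof -
  have "distinguished G S v ws (replicate (length ws) \<one>) \<longleftrightarrow> (\<forall>s\<in>S. weak_le G S v (v \<otimes> s))"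
    unfolding distinguished_def assms(1)[symmetric] all_set_conv_all_nth using assms(2) by simp
  also have "\<dots> \<longleftrightarrow> (\<forall>s\<in>S. len v < len (v \<otimes> s))"
    by (rule ball_cong[OF HOL.refl]) (rule weak_le_simple[OF assms(2)])
  also have "\<dots> \<longleftrightarrow> v = \<one>"
  proof
    assume "\<forall>s\<in>S. len v < len (v \<otimes> s)"
    then show "v = \<one>" by (intro no_descent[OF assms(2)]) simp
  qed (simp add: len_simple)
  finally show ?thesis .
qed

text \<open>Skipping every letter requires each simple reflection to be an ascent of
  \<open>v\<close>, which leaves only the identity.\<close>

lemma deograms_coxeter_word:
  assumes "distinct ws" "set ws = S"
  shows "deograms ws = {(\<one>, replicate (length ws) \<one>)}"
proof (rule Set.set_eqI)
  fix d :: "'a \<times> 'a list"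
  obtain v us where d: "d = (v, us)" by (cases d)
  have S: "set ws \<subseteq> S" using assms(2) by simp
  have "us = replicate (length ws) \<one> \<and> v = \<one>" if "d \<in> deograms ws"
  proof -
    from that have us: "v \<in> carrier G" "us \<in> subwords G ws" "word_prod G us = \<one>" "distinguished G S v ws us"
      by (auto simp: d deograms_def)
    have "us = replicate (length ws) \<one>" by (rule trivial_subword[OF us(2) assms(1) S us(3)])
    then show ?thesis using us(4) distinguished_replicate_one[OF assms(2) us(1)] by simp
  qed
  moreover have "(\<one>, replicate (length ws) \<one>) \<in> deograms ws"
    using distinguished_replicate_one[OF assms(2) one_closed] replicate_one_subword by (simp add: deograms_def)
  ultimately show "d \<in> deograms ws \<longleftrightarrow> d \<in> {(\<one>, replicate (length ws) \<one>)}" unfolding d by fastforce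
qed

lemma hecke_trace_coxeter_word:
  assumes "distinct ws" "set ws = S"
  shows "hecke_trace z ws = z ^ length ws"
  using assms by (simp add: hecke_trace_deograms deograms_coxeter_word skips_replicate_one)

end

context coxeter_word_system
begin

theorem card_maximal_deograms:
  assumes p: "p > 0" "coprime p coxeter_number"
  shows "card (SIGMA v:carrier G. maximal_deograms G S (word_power c p) v) = p ^ card S"
proof -
  let ?ws = "word_power c p" and ?r = "card S"
  let ?f = "\<lambda>k. real (card {(v, us) \<in> deograms ?ws. skips G us = k})"
  have ws: "set ?ws \<subseteq> S" by (rule word_power_subset[OF c_subset])
  have len: "length ?ws = p * ?r" unfolding word_power_def by (induction p) (simp_all add: length_c)
  have "?f ?r = real p ^ ?r"
  proof (rule low_coefficient[where F = "at 0" and f = ?f and y = sinh2 and g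
      = "\<lambda>x. (sinh2 (real p * x) / sinh2 x) ^ ?r"])
    show "\<forall>\<^sub>F x in at 0. (\<Sum>k\<le>length ?ws. ?f k * sinh2 x ^ k)
        = sinh2 x ^ ?r * (sinh2 (real p * x) / sinh2 x) ^ ?r"
      using eventually_neq_at_within[of "0::real" 0 UNIV]
    proof eventually_elim
      case (elim x)
      have "(\<Sum>k\<le>length ?ws. ?f k * sinh2 x ^ k) = hecke_trace (sinh2 x) ?ws"
        by (rule hecke_trace_expand[OF ws, symmetric])
      also have "\<dots> = hecke_trace (sinh2 (real p * x)) c" by (rule hecke_trace_coprime[OF p])
      also have "\<dots> = sinh2 (real p * x) ^ ?r"
        unfolding hecke_trace_coxeter_word[OF distinct_c set_c] length_c ..
      finally show ?case using elim by (simp add: power_mult_distrib[symmetric])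
    qed
    show "(sinh2 \<longlongrightarrow> 0) (at 0)" by (rule sinh2_tendsto_0)
    show "\<forall>\<^sub>F x in at 0. sinh2 x \<noteq> 0" using eventually_neq_at_within[of "0::real" 0 UNIV]
        by eventually_elim simp
    show "((\<lambda>x. (sinh2 (real p * x) / sinh2 x) ^ ?r) \<longlongrightarrow> real p ^ ?r) (at 0)"
      by (intro tendsto_power sinh2_ratio)
    show "?r \<le> length ?ws" using p(1) by (simp add: len)
  qed simp
  moreover have "{(v, us) \<in> deograms ?ws. skips G us = ?r} = (SIGMA v:carrier G. maximal_deograms G S ?ws v)"
    by (auto simp: deograms_def maximal_deograms_def)
  ultimately have "real (card (SIGMA v:carrier G. maximal_deograms G S ?ws v)) = real (p ^ ?r)" by simp
  then show ?thesis by (simp only: of_nat_eq_iff)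
qed

end

theorem theorem1p8:
  fixes W (structure) and S :: "'a set" and c :: "'a list" and g :: 'a and h r p :: nat
  assumes "coxeter_system W S"
    and "finite (carrier W)"
    and "coxeter_irreducible W S"
    and "r = card S"
    and "coxeter_element W S g" and "h = group.ord W g"
    and "coxeter_word S c"
    and "p > 0" and "coprime p h"
  shows "card (SIGMA v : carrier W. maximal_deograms W S (word_power c p) v) = p ^ r"
proof -
  interpret coxeter_system W S by (rule assms(1))
  interpret finite_coxeter_system W S by unfold_locales (rule assms(2))
  interpret coxeter_word_system W S c
    using assms(3,7) by unfold_locales (simp_all add: coxeter_word_def)
  \<comment> \<open>The order \<open>h\<close> comes from an arbitrary Coxeter element, possibly
    with another ordering \<open>c'\<close>; by \<open>coxeter_word_ord_eq\<close> it equals the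
    order for \<open>c\<close>.\<close>
  obtain c' where "coxeter_word S c'" "g = word_prod W c'" using assms(5) by (auto simp: coxeter_element_def)
  then have "h = coxeter_number"
    unfolding coxeter_elt_def assms(6) using coxeter_word_ord_eq[OF _ assms(7)] by blast
  then show ?thesis using card_maximal_deograms[of p] assms(4,8,9) by simp
qed

end
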